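(* Let $(B,g_B)$ and $(F,g_F)$ be two non-degenerate semi-Riemannian manifolds, $b\in C^\infty(B\times F)$, and suppose $db=0$ at all points where $b=0$. Let $P\in\Gamma(TB)$ and let $\overline R$ be the semi-symmetric metric curvature, with respect to $P$, of the twisted product $B\times_bF$. For all $X,Y,Z,T\in\Gamma(TB)$ and $U,V,W,Q\in\Gamma(TF)$: (1) $\overline R(X,Y,Z,T)=\overline R_B(X,Y,Z,T)$; (2) $\overline R(X,Y,Z,W)=\overline R(Z,W,X,Y)=0$; (3) $\overline R(X,Y,V,W)=\overline R(V,W,X,Y)=0$; (4) $\overline R(X,V,Y,W)=bXY(b)g_F(V,W)-bg_B^*(\nabla^\flat_XY,db)g_F(V,W)+b^2\mathcal K_B(X,P,Y)g_F(V,W)+b^2g_B(P,P)g_B(X,Y)g_F(V,W)-b^2g_B(X,P)g_B(P,Y)g_F(V,W)+bP(b)g_B(X,Y)g_F(V,W)$; (5) $\overline R(X,V,U,W)=\overline R(U,W,X,V)=bXU(b)g_F(W,V)-X(b)U(b)g_F(W,V)-bXW(b)g_F(U,V)+X(b)W(b)g_F(U,V)$; (6) $\overline R(U,V,W,Q)=b^2R_F(U,V,W,Q)+\big(b^2g_B^*(db,db)+g_F^*(db,db)+2b^3P(b)+b^4g_B(P,P)\big)\big(g_F(U,W)g_F(V,Q)-g_F(V,W)g_F(U,Q)\big)+\big(bUW(b)-2U(b)W(b)-bg_F^*(\nabla^\flat_UW,db)\big)g_F(V,Q)+\big(bVQ(b)-2V(b)Q(b)-bg_F^*(\nabla^\f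lat_VQ,db)\big)g_F(U,W)-\big(bVW(b)-2V(b)W(b)-bg_F^*(\nabla^\flat_VW,db)\big)g_F(U,Q)-\big(bUQ(b)-2U(b)Q(b)-bg_F^*(\nabla^\flat_UQ,db)\big)g_F(V,W)$.
   Context: A singular semi-Riemannian manifold $(M,g)$ is a smooth manifold with a smooth symmetric bilinear form $g$ on $TM$, possibly degenerate and of variable signature; it is non-degenerate if $g$ is non-degenerate everywhere. Its Koszul form is $\mathcal K(X,Y,Z)=\frac12\{X(g(Y,Z))+Y(g(Z,X))-Z(g(X,Y))-g(X,[Y,Z])+g(Y,[Z,X])+g(Z,[X,Y])\}$, and $(\nabla^\flat_XY)(Z)=\mathcal K(X,Y,Z)$. Contraction: let $T_p^\bullet M=\{g_p(v,\cdot):v\in T_pM\}\subset T_p^*M$ with inner product $g_p^\bullet(g_p(v,\cdot),g_p(w,\cdot))=g_p(v,w)$. For 1-forms $\omega,\tau$ with values in $T^\bullet M$, $\omega(\bullet)\tau(\bullet)$ is the function $p\mapsto g^\bullet_p(\omega_p,\tau_p)$ on the dense open set where the rank of $g$ is locally constant; it is called smooth if it extends (uniquely) to a smooth function on $M$, and then the same symbol denotes the extension. $(M,g)$ is radical-stationary if $\mathcal K(X,Y,\cdot)$ takes values in $T^\bullet M$ for all vector fields $X,Y$, and semi-regular if moreover all $\mathcal K(X,Y,\bullet)\mathcal K(Z,T,\bullet)$ are smooth. On a semi-regular manifold $R(X,Y,Z,T)=X(\mathcal K(Y,Z,T))-Y(\mathcal K(X,Z,T))-\mathcal K([X,Y],Z,T)+\mathcal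 K(X,Z,\bullet)\mathcal K(Y,T,\bullet)-\mathcal K(Y,Z,\bullet)\mathcal K(X,T,\bullet)$. For a vector field $P$ on $M$, the semi-symmetric metric Koszul form is $\overline{\mathcal K}(X,Y,Z)=\mathcal K(X,Y,Z)+g(Y,P)g(X,Z)-g(X,Y)g(P,Z)$. The semi-symmetric metric curvature $\overline R$ is given by the formula for $R$ with $\mathcal K$ replaced everywhere by $\overline{\mathcal K}$ (well defined on semi-regular manifolds). The twisted product $B\times_bF$ with twisting function $b:B\times F\to\mathbb R$ (smooth, possibly vanishing) is $B\times F$ with $g=\pi_B^*(g_B)+b^2\pi_F^*(g_F)$, $\pi_B,\pi_F$ the canonical projections. Under the hypotheses of the claim it is semi-regular. Vector fields in $\Gamma(TB)$, $\Gamma(TF)$ are identified with their lifts to the product, and functions and tensors on the factors with their pullbacks. Subscripts $B$, $F$ denote objects of that factor ($\overline R_B$ uses $P$ on $B$). $g_B^*$, $g_F^*$ are the inverse metrics of $g_B$, $g_F$ applied to the restrictions of 1-forms to $TB$, resp. $TF$; in $g_B^*(\nabla^\flat_XY,db)$ one has $\nabla^\flat_XY=\mathcal K_B(X,Y,\cdot)$, and in $g_F^*(\nabla^\flat_UW,db)$ one has $\nabla^\flat_UW=\mathcal K_F(U,W,\cdot)$. $XY(f)$ means $X(Y(f))$. *)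

theory Defs
  imports "HOL-Analysis.Analysis" "HOL-Library.Function_Algebras"
begin

section \<open>Smooth maps between open subsets of vector spaces\<close>

text \<open>
  Only used for open \<open>S\<close> in a finite-dimensional space, where \<open>smooth_on\<close> is the usual
  \<open>C\<^sup>\<infinity>\<close>: all iterated directional derivatives exist and are (totally) differentiable.
\<close>

fun Ck_on :: "nat \<Rightarrow> 'a::real_normed_vector set \<Rightarrow> ('a \<Rightarrow> 'b::real_normed_vector) \<Rightarrow> bool" where
  "Ck_on 0 S f \<longleftrightarrow> continuous_on S f"
| "Ck_on (Suc k) S f \<longleftrightarrow>
     (\<forall>x\<in>S. f differentiable (at x)) \<and> (\<forall>v. Ck_on k S (\<lambda>x. frechet_derivative f (at x) v))"

definition smooth_on :: "'a::real_normed_vector set \<Rightarrow> ('a \<Rightarrow> 'b::real_normed_vector) \<Rightarrow> bool" where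
  "smooth_on S f \<longleftrightarrow> (\<forall>k. Ck_on k S f)"


section \<open>Smooth manifolds\<close>

text \<open>
  A manifold is a Hausdorff second countable type \<open>'m\<close> with a smooth atlas \<open>A\<close> of charts
  \<open>(U, \<phi>)\<close>. The model space \<open>'e\<close> is a finite-dimensional real inner product space, i.e.
  \<open>\<real>\<^sup>n\<close> up to isometry; class \<open>euclidean_space\<close> is not used because it excludes \<open>n = 0\<close>.
\<close>

type_synonym ('m, 'e) chart = "'m set \<times> ('m \<Rightarrow> 'e)"

definition smooth_manifold ::
    "('m::{t2_space,second_countable_topology}, 'e::real_inner) chart set \<Rightarrow> bool" where
  "smooth_manifold A \<longleftrightarrow>
     (\<exists>S::'e set. finite S \<and> span S = UNIV) \<and>
     (\<forall>(U, \<phi>)\<in>A. open U \<and> open (\<phi> ` U) \<and> homeomorphism U (\<phi> ` U) \<phi> (inv_into U \<phi>)) \<and>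
     (\<Union>(U, \<phi>)\<in>A. U) = UNIV \<and>
     (\<forall>(U, \<phi>)\<in>A. \<forall>(V, \<psi>)\<in>A. smooth_on (\<phi> ` (U \<inter> V)) (\<psi> \<circ> inv_into U \<phi>))"

definition smooth_functions ::
    "('m::topological_space, 'e::real_inner) chart set \<Rightarrow> ('m \<Rightarrow> real) set" where
  "smooth_functions A = {f. \<forall>(U, \<phi>)\<in>A. smooth_on (\<phi> ` U) (f \<circ> inv_into U \<phi>)}"

text \<open>
  Tangent vectors at \<open>p\<close> are the directional derivatives at \<open>p\<close>, as operators on the smooth
  functions. So that equal operators are equal in HOL, they are set to \<open>0\<close> on non-smooth
  functions. Covectors are likewise set to \<open>0\<close> outside the tangent space.
\<close>

type_synonym 'm tangent = "('m \<Rightarrow> real) \<Rightarrow> real"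
type_synonym 'm vfield = "'m \<Rightarrow> 'm tangent"
type_synonym 'm covector = "'m tangent \<Rightarrow> real"
type_synonym 'm form = "'m vfield \<Rightarrow> 'm \<Rightarrow> real"
type_synonym 'm metric = "'m \<Rightarrow> 'm tangent \<Rightarrow> 'm tangent \<Rightarrow> real"

definition tangent_space ::
    "('m::topological_space, 'e::real_inner) chart set \<Rightarrow> 'm \<Rightarrow> 'm tangent set" where
  "tangent_space A p = {v. \<exists>(U, \<phi>)\<in>A. p \<in> U \<and> (\<exists>w.
     v = (\<lambda>f. if f \<in> smooth_functions A
              then frechet_derivative (f \<circ> inv_into U \<phi>) (at (\<phi> p)) w else 0))}"

definition lie_derivative :: "'m vfield \<Rightarrow> ('m \<Rightarrow> real) \<Rightarrow> 'm \<Rightarrow> real" where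
  "lie_derivative X f = (\<lambda>p. X p f)"

definition vector_fields ::
    "('m::topological_space, 'e::real_inner) chart set \<Rightarrow> 'm vfield set" where
  "vector_fields A = {X. (\<forall>p. X p \<in> tangent_space A p) \<and>
     (\<forall>f\<in>smooth_functions A. lie_derivative X f \<in> smooth_functions A)}"

definition lie_bracket :: "'m vfield \<Rightarrow> 'm vfield \<Rightarrow> 'm vfield" where
  "lie_bracket X Y = (\<lambda>p f. X p (lie_derivative Y f) - Y p (lie_derivative X f))"

definition differential ::
    "('m::topological_space, 'e::real_inner) chart set \<Rightarrow> ('m \<Rightarrow> real) \<Rightarrow> 'm \<Rightarrow> 'm covector" where
  "differential A f p = (\<lambda>v. if v \<in> tangent_space A p then v f else 0)"

text \<open>
  A 1-form is given by its action on vector fields; \<open>covector_at A \<omega> p\<close> is its value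
  \<open>\<omega>\<^sub>p\<close>, defined by \<open>\<omega>\<^sub>p(V\<^sub>p) = (\<omega>(V))(p)\<close>.
\<close>

definition covector_at ::
    "('m::topological_space, 'e::real_inner) chart set \<Rightarrow> 'm form \<Rightarrow> 'm \<Rightarrow> 'm covector" where
  "covector_at A \<omega> p = (\<lambda>v. if v \<in> tangent_space A p
     then (THE c. \<forall>V\<in>vector_fields A. V p = v \<longrightarrow> \<omega> V p = c) else 0)"


section \<open>Singular semi-Riemannian metrics\<close>

definition metric_fun :: "'m metric \<Rightarrow> 'm vfield \<Rightarrow> 'm vfield \<Rightarrow> 'm \<Rightarrow> real" where
  "metric_fun g X Y = (\<lambda>p. g p (X p) (Y p))"

definition singular_metric ::
    "('m::topological_space, 'e::real_inner) chart set \<Rightarrow> 'm metric \<Rightarrow> bool" where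
  "singular_metric A g \<longleftrightarrow>
     (\<forall>p. \<forall>u\<in>tangent_space A p. \<forall>v\<in>tangent_space A p. g p u v = g p v u) \<and>
     (\<forall>p. \<forall>u\<in>tangent_space A p. \<forall>v\<in>tangent_space A p. \<forall>w\<in>tangent_space A p. \<forall>c.
        g p (\<lambda>f. u f + c * v f) w = g p u w + c * g p v w) \<and>
     (\<forall>X\<in>vector_fields A. \<forall>Y\<in>vector_fields A. metric_fun g X Y \<in> smooth_functions A)"

definition nondegenerate ::
    "('m::topological_space, 'e::real_inner) chart set \<Rightarrow> 'm metric \<Rightarrow> bool" where
  "nondegenerate A g \<longleftrightarrow>
     (\<forall>p. \<forall>u\<in>tangent_space A p. (\<forall>v\<in>tangent_space A p. g p u v = 0) \<longrightarrow> u = (\<lambda>f. 0))"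

definition nondegenerate_semi_riemannian_manifold ::
    "('m::{t2_space,second_countable_topology}, 'e::real_inner) chart set \<Rightarrow> 'm metric \<Rightarrow> bool" where
  "nondegenerate_semi_riemannian_manifold A g \<longleftrightarrow>
     smooth_manifold A \<and> singular_metric A g \<and> nondegenerate A g"

definition flat ::
    "('m::topological_space, 'e::real_inner) chart set \<Rightarrow> 'm metric \<Rightarrow> 'm \<Rightarrow> 'm tangent \<Rightarrow> 'm covector"
  where "flat A g p u = (\<lambda>v. if v \<in> tangent_space A p then g p u v else 0)"

text \<open>The inverse metric, for non-degenerate \<open>g\<close>.\<close>

definition sharp ::
    "('m::topological_space, 'e::real_inner) chart set \<Rightarrow> 'm metric \<Rightarrow> 'm \<Rightarrow> 'm covector \<Rightarrow> 'm tangent"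
  where "sharp A g p \<alpha> = (THE u. u \<in> tangent_space A p \<and> flat A g p u = \<alpha>)"

definition inverse_metric ::
    "('m::topological_space, 'e::real_inner) chart set \<Rightarrow> 'm metric \<Rightarrow> 'm \<Rightarrow>
      'm covector \<Rightarrow> 'm covector \<Rightarrow> real" where
  "inverse_metric A g p \<alpha> \<beta> = g p (sharp A g p \<alpha>) (sharp A g p \<beta>)"


section \<open>Covariant contraction\<close>

text \<open>\<open>T\<^sub>p\<^sup>\<bullet>M\<close>, the inner product \<open>g\<^sub>p\<^sup>\<bullet>\<close> on it, and the set where the rank is locally constant.\<close>

definition cotangent_bullet ::
    "('m::topological_space, 'e::real_inner) chart set \<Rightarrow> 'm metric \<Rightarrow> 'm \<Rightarrow> 'm covector set" where
  "cotangent_bullet A g p = flat A g p ` tangent_space A p"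

definition bullet_metric ::
    "('m::topological_space, 'e::real_inner) chart set \<Rightarrow> 'm metric \<Rightarrow> 'm \<Rightarrow>
      'm covector \<Rightarrow> 'm covector \<Rightarrow> real" where
  "bullet_metric A g p \<alpha> \<beta> = (THE c. \<exists>u\<in>tangent_space A p. \<exists>v\<in>tangent_space A p.
     \<alpha> = flat A g p u \<and> \<beta> = flat A g p v \<and> c = g p u v)"

definition metric_rank ::
    "('m::topological_space, 'e::real_inner) chart set \<Rightarrow> 'm metric \<Rightarrow> 'm \<Rightarrow> nat" where
  "metric_rank A g p = vector_space.dim (\<lambda>(c::real) \<alpha> v. c * \<alpha> v) (cotangent_bullet A g p)"

definition regular_points ::
    "('m::topological_space, 'e::real_inner) chart set \<Rightarrow> 'm metric \<Rightarrow> 'm set" where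
  "regular_points A g =
     {p. \<exists>N. open N \<and> p \<in> N \<and> (\<forall>q\<in>N. metric_rank A g q = metric_rank A g p)}"

text \<open>
  The contraction \<open>\<omega>(\<bullet>)\<tau>(\<bullet>)\<close>, already extended smoothly to the whole manifold; unspecified if
  there is no smooth extension.
\<close>

definition contraction ::
    "('m::topological_space, 'e::real_inner) chart set \<Rightarrow> 'm metric \<Rightarrow>
      'm form \<Rightarrow> 'm form \<Rightarrow> 'm \<Rightarrow> real" where
  "contraction A g \<omega> \<tau> = (THE h. h \<in> smooth_functions A \<and>
     (\<forall>p\<in>regular_points A g.
        h p = bullet_metric A g p (covector_at A \<omega> p) (covector_at A \<tau> p)))"


section \<open>Koszul forms and curvatures\<close>

definition koszul :: "'m metric \<Rightarrow> 'm vfield \<Rightarrow> 'm vfield \<Rightarrow> 'm form" where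
  "koszul g X Y Z = (\<lambda>p. 1/2 *
     (X p (metric_fun g Y Z) + Y p (metric_fun g Z X) - Z p (metric_fun g X Y)
      - metric_fun g X (lie_bracket Y Z) p + metric_fun g Y (lie_bracket Z X) p
      + metric_fun g Z (lie_bracket X Y) p))"

definition semi_symmetric_koszul ::
    "'m metric \<Rightarrow> 'm vfield \<Rightarrow> 'm vfield \<Rightarrow> 'm vfield \<Rightarrow> 'm form" where
  "semi_symmetric_koszul g P X Y Z = (\<lambda>p. koszul g X Y Z p
     + metric_fun g Y P p * metric_fun g X Z p - metric_fun g X Y p * metric_fun g P Z p)"

definition curvature_of ::
    "('m::topological_space, 'e::real_inner) chart set \<Rightarrow> 'm metric \<Rightarrow>
      ('m vfield \<Rightarrow> 'm vfield \<Rightarrow> 'm form) \<Rightarrow>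
      'm vfield \<Rightarrow> 'm vfield \<Rightarrow> 'm vfield \<Rightarrow> 'm vfield \<Rightarrow> 'm \<Rightarrow> real" where
  "curvature_of A g \<kappa> X Y Z T = (\<lambda>p.
     X p (\<kappa> Y Z T) - Y p (\<kappa> X Z T) - \<kappa> (lie_bracket X Y) Z T p
     + contraction A g (\<kappa> X Z) (\<kappa> Y T) p - contraction A g (\<kappa> Y Z) (\<kappa> X T) p)"

definition curvature ::
    "('m::topological_space, 'e::real_inner) chart set \<Rightarrow> 'm metric \<Rightarrow>
      'm vfield \<Rightarrow> 'm vfield \<Rightarrow> 'm vfield \<Rightarrow> 'm vfield \<Rightarrow> 'm \<Rightarrow> real" where
  "curvature A g = curvature_of A g (koszul g)"

definition semi_symmetric_curvature ::
    "('m::topological_space, 'e::real_inner) chart set \<Rightarrow> 'm metric \<Rightarrow> 'm vfield \<Rightarrow>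
      'm vfield \<Rightarrow> 'm vfield \<Rightarrow> 'm vfield \<Rightarrow> 'm vfield \<Rightarrow> 'm \<Rightarrow> real" where
  "semi_symmetric_curvature A g P = curvature_of A g (semi_symmetric_koszul g P)"


section \<open>Twisted products\<close>

definition product_atlas ::
    "('b, 'eb) chart set \<Rightarrow> ('f, 'ef) chart set \<Rightarrow> ('b \<times> 'f, 'eb \<times> 'ef) chart set" where
  "product_atlas AB AF = {(U \<times> V, map_prod \<phi> \<psi>) | U \<phi> V \<psi>. (U, \<phi>) \<in> AB \<and> (V, \<psi>) \<in> AF}"

definition push_forward :: "('m \<Rightarrow> 'n) \<Rightarrow> 'm tangent \<Rightarrow> 'n tangent" where
  "push_forward h v = (\<lambda>f. v (f \<circ> h))"

definition twisted_metric ::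
    "'b metric \<Rightarrow> 'f metric \<Rightarrow> ('b \<times> 'f \<Rightarrow> real) \<Rightarrow> ('b \<times> 'f) metric" where
  "twisted_metric gB gF b = (\<lambda>z u v.
     gB (fst z) (push_forward fst u) (push_forward fst v)
     + (b z)\<^sup>2 * gF (snd z) (push_forward snd u) (push_forward snd v))"

text \<open>
  The lift to \<open>(x, y)\<close> of a vector \<open>v\<close> tangent to \<open>B\<close> at \<open>x\<close> differentiates in the first variable
  only; this is the tangent vector with projections \<open>v\<close> and \<open>0\<close>. Similarly for \<open>F\<close>.
\<close>

definition lift_vector_B ::
    "('b::topological_space, 'eb::real_inner) chart set \<Rightarrow>
     ('f::topological_space, 'ef::real_inner) chart set \<Rightarrow>
      'b \<times> 'f \<Rightarrow> 'b tangent \<Rightarrow> ('b \<times> 'f) tangent" where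
  "lift_vector_B AB AF z v =
     (\<lambda>f. if f \<in> smooth_functions (product_atlas AB AF) then v (\<lambda>x. f (x, snd z)) else 0)"

definition lift_vector_F ::
    "('b::topological_space, 'eb::real_inner) chart set \<Rightarrow>
     ('f::topological_space, 'ef::real_inner) chart set \<Rightarrow>
      'b \<times> 'f \<Rightarrow> 'f tangent \<Rightarrow> ('b \<times> 'f) tangent" where
  "lift_vector_F AB AF z v =
     (\<lambda>f. if f \<in> smooth_functions (product_atlas AB AF) then v (\<lambda>y. f (fst z, y)) else 0)"

definition lift_B ::
    "('b::topological_space, 'eb::real_inner) chart set \<Rightarrow>
     ('f::topological_space, 'ef::real_inner) chart set \<Rightarrow> 'b vfield \<Rightarrow> ('b \<times> 'f) vfield" where
  "lift_B AB AF X = (\<lambda>z. lift_vector_B AB AF z (X (fst z)))"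

definition lift_F ::
    "('b::topological_space, 'eb::real_inner) chart set \<Rightarrow>
     ('f::topological_space, 'ef::real_inner) chart set \<Rightarrow> 'f vfield \<Rightarrow> ('b \<times> 'f) vfield" where
  "lift_F AB AF V = (\<lambda>z. lift_vector_F AB AF z (V (snd z)))"

text \<open>Restriction of a covector at \<open>z\<close> on the product to \<open>TB\<close>, resp. \<open>TF\<close>.\<close>

definition restrict_B ::
    "('b::topological_space, 'eb::real_inner) chart set \<Rightarrow>
     ('f::topological_space, 'ef::real_inner) chart set \<Rightarrow>
      'b \<times> 'f \<Rightarrow> ('b \<times> 'f) covector \<Rightarrow> 'b covector" where
  "restrict_B AB AF z \<alpha> =
     (\<lambda>v. if v \<in> tangent_space AB (fst z) then \<alpha> (lift_vector_B AB AF z v) else 0)"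

definition restrict_F ::
    "('b::topological_space, 'eb::real_inner) chart set \<Rightarrow>
     ('f::topological_space, 'ef::real_inner) chart set \<Rightarrow>
      'b \<times> 'f \<Rightarrow> ('b \<times> 'f) covector \<Rightarrow> 'f covector" where
  "restrict_F AB AF z \<alpha> =
     (\<lambda>v. if v \<in> tangent_space AF (snd z) then \<alpha> (lift_vector_F AB AF z v) else 0)"

end

theory Submission
  imports Defs
begin

text \<open>
  On the lifts of fields on the factors, the Koszul form of the twisted product has a part along
  \<open>B\<close> and a part along \<open>F\<close>, and the latter is always \<open>b\<close> times a smooth family of
  covectors of \<open>F\<close> which vanishes where \<open>b\<close> does, because \<open>db = 0\<close> there. Since the
  metric along \<open>F\<close> is \<open>b\<^sup>2 g\<^sub>F\<close>, the two factors \<open>b\<close> cancel in a contraction, which is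
  therefore the sum of the contractions of the parts with respect to \<open>g\<^sub>B\<close> and \<open>g\<^sub>F\<close>,
  also where \<open>b\<close> vanishes. The rank of the metric is constant on \<open>b \<noteq> 0\<close> and on
  \<open>b = 0\<close>, so the regular points are dense and this sum is the smooth extension sought. The
  six formulas are then identities in the values of the Koszul forms of the factors and the
  derivatives of \<open>b\<close>.
\<close>

section \<open>Calculus of smooth maps\<close>

text \<open>A contraction is a \<open>THE\<close> over smooth extensions, yet no limit is ever
  computed: at every point of the product, also where b = 0, vectors are exhibited whose flats are
  the two covectors, and the smooth candidate is shown to be their inner product. The vector for a
  fibre part b \<alpha>' is 1/b times the g_F-dual of \<alpha>', and the convention that the inverse
  of 0 is 0 yields the right vector at the zeros of b. The candidate is smooth because an everywhere
  smooth orthogonal family on a factor diagonalises the inverse metric near a given point, so that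
  no matrix of functions has to be inverted. Tangent vectors act on globally smooth functions; hence
  coordinates and coordinate fields are cut off by bump functions, and that the bracket of two
  fields is a field rests on the symmetry of second derivatives. In the curvature, metric
  compatibility and torsion-freeness of the Koszul forms of the factors trade derivatives of g_B and
  g_F and brackets for Koszul values; what remains is polynomial algebra.\<close>

lemma Ck_on_cong:
  assumes "open S" "\<And>x. x \<in> S \<Longrightarrow> f x = g x"
  shows "Ck_on k S f \<longleftrightarrow> Ck_on k S g"
proof -
  have "Ck_on k S g" if "Ck_on k S f" "\<And>x. x \<in> S \<Longrightarrow> f x = g x" for f g :: "'a \<Rightarrow> 'b"
    using that
  proof (induction k arbitrary: f g)
    case 0
    then show ?case using continuous_on_cong by force
  next
    case (Suc k)
    have d: "(g has_derivative frechet_derivative f (at x)) (at x)" if "x \<in> S" for x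
      using Suc.prems that \<open>open S\<close> has_derivative_transform_within_open[of f _ x UNIV S g]
      by (simp add: frechet_derivative_works)
    then have "frechet_derivative f (at x) = frechet_derivative g (at x)" if "x \<in> S" for x
      using that frechet_derivative_at by blast
    with Suc d show ?case
      by (fastforce simp: differentiable_def)
  qed
  then show ?thesis using assms by (metis (full_types))
qed

text \<open>\<open>frechet_derivative\<close> is a choice operator, whereas a rule of calculus gives
  a formula that is valid on \<open>S\<close> only. Since \<open>S\<close> is open, the two have the
  same differentiability on it by \<open>Ck_on_cong\<close>, and the formula may be used at all
  further orders.\<close>

lemma Ck_on_SucI:
  assumes "open S" "\<And>x. x \<in> S \<Longrightarrow> (f has_derivative f' x) (at x)"
    "\<And>v. Ck_on k S (\<lambda>x. f' x v)"
  shows "Ck_on (Suc k) S f"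
proof -
  have "frechet_derivative f (at x) = f' x" if "x \<in> S" for x
    using assms(2)[OF that] frechet_derivative_at by metis
  then have "Ck_on k S (\<lambda>x. frechet_derivative f (at x) v)" for v
    using Ck_on_cong[OF assms(1), of "\<lambda>x. frechet_derivative f (at x) v" "\<lambda>x. f' x v"] assms(3) by simp
  then show ?thesis using assms(2) by (auto simp: differentiable_def)
qed

lemma Ck_on_SucD:
  assumes "Ck_on (Suc k) S f" "x \<in> S"
  shows "(f has_derivative frechet_derivative f (at x)) (at x)"
  using assms by (simp add: frechet_derivative_works)

lemma Ck_on_Suc_imp: "Ck_on (Suc k) S f \<Longrightarrow> Ck_on k S f"
proof (induction k arbitrary: f)
  case 0
  then show ?case
    by (auto intro!: continuous_at_imp_continuous_on differentiable_imp_continuous_within)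
next
  case (Suc k)
  then show ?case by (metis Ck_on.simps(2))
qed

lemma Ck_on_subset: "Ck_on k S f \<Longrightarrow> T \<subseteq> S \<Longrightarrow> Ck_on k T f"
  by (induction k arbitrary: f) (auto intro: continuous_on_subset)

lemma Ck_on_local:
  "(\<And>x. x \<in> S \<Longrightarrow> \<exists>T. open T \<and> x \<in> T \<and> Ck_on k T f) \<Longrightarrow> Ck_on k S f"
proof (induction k arbitrary: f)
  case 0
  have "isCont f x" if x: "x \<in> S" for x
  proof -
    obtain T where "open T" "x \<in> T" "continuous_on T f" using 0[OF x] by auto
    then show ?thesis by (simp add: continuous_on_eq_continuous_at)
  qed
  then show ?case by (simp add: continuous_at_imp_continuous_on)
next
  case (Suc k)
  have "f differentiable (at x)" if "x \<in> S" for x using Suc.prems[OF that] by auto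
  moreover have "Ck_on k S (\<lambda>x. frechet_derivative f (at x) v)" for v
    by (rule Suc.IH) (use Suc.prems in force)
  ultimately show ?case by simp
qed

lemma Ck_on_const: "Ck_on k S (\<lambda>x. c)"
  by (induction k arbitrary: c) auto

lemma Ck_on_bounded_linear_comp:
  assumes "open S" "bounded_linear L" "Ck_on k S f"
  shows "Ck_on k S (\<lambda>x. L (f x))"
  using assms(3)
proof (induction k arbitrary: f)
  case 0
  then show ?case using bounded_linear.continuous_on[OF assms(2)] by auto
next
  case (Suc k)
  show ?case
  proof (rule Ck_on_SucI[OF \<open>open S\<close>])
    fix x assume "x \<in> S"
    show "((\<lambda>x. L (f x)) has_derivative (\<lambda>v. L (frechet_derivative f (at x) v))) (at x)"
      by (rule bounded_linear.has_derivative[OF assms(2) Ck_on_SucD[OF Suc.prems \<open>x \<in> S\<close>]])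
  qed (use Suc in auto)
qed

lemma Ck_on_bounded_linear:
  assumes "open S" "bounded_linear L"
  shows "Ck_on k S L"
proof (cases k)
  case 0
  then show ?thesis using linear_continuous_on[OF assms(2)] by simp
next
  case (Suc n)
  show ?thesis unfolding Suc
    by (rule Ck_on_SucI[OF \<open>open S\<close>, where f' = "\<lambda>_. L"])
      (auto intro: bounded_linear_imp_has_derivative assms Ck_on_const)
qed

lemma Ck_on_add:
  assumes "open S" "Ck_on k S f" "Ck_on k S g"
  shows "Ck_on k S (\<lambda>x. f x + g x)"
  using assms(2,3)
proof (induction k arbitrary: f g)
  case 0
  then show ?case by (auto intro: continuous_intros)
next
  case (Suc k)
  show ?case
    by (rule Ck_on_SucI[OF \<open>open S\<close>])
      (use Suc in \<open>auto intro!: has_derivative_add Ck_on_SucD[OF Suc.prems(1)] Ck_on_SucD[OF Suc.prems(2)]\<close>)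
qed

lemma Ck_on_sum:
  assumes "open S" "\<And>i. i \<in> I \<Longrightarrow> Ck_on k S (f i)"
  shows "Ck_on k S (\<lambda>x. \<Sum>i\<in>I. f i x)"
  using assms(2)
  by (induction I rule: infinite_finite_induct) (auto intro: Ck_on_const Ck_on_add \<open>open S\<close>)

lemma Ck_on_scaleR:
  fixes f :: "'a::real_normed_vector \<Rightarrow> real"
  assumes "open S" "Ck_on k S f" "Ck_on k S g"
  shows "Ck_on k S (\<lambda>x. f x *\<^sub>R g x)"
  using assms(2,3)
proof (induction k arbitrary: f g)
  case 0
  then show ?case by (auto intro: continuous_intros)
next
  case (Suc k)
  have "Ck_on k S f" "Ck_on k S g" using Suc.prems Ck_on_Suc_imp by blast+
  then have *: "Ck_on k S (\<lambda>x. f x *\<^sub>R frechet_derivative g (at x) v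
      + frechet_derivative f (at x) v *\<^sub>R g x)" for v
    using Suc by (intro Ck_on_add \<open>open S\<close> Suc.IH) auto
  show ?case
    by (rule Ck_on_SucI[OF \<open>open S\<close> _ *])
      (rule has_derivative_scaleR[OF Ck_on_SucD[OF Suc.prems(1)] Ck_on_SucD[OF Suc.prems(2)]])
qed

text \<open>The derivative -(1/f) f' (1/f) involves only f' and 1/f itself, at one order less, so
  the induction closes.\<close>

lemma Ck_on_inverse:
  fixes f :: "'a::real_normed_vector \<Rightarrow> real"
  assumes "open S" "Ck_on k S f" "\<And>x. x \<in> S \<Longrightarrow> f x \<noteq> 0"
  shows "Ck_on k S (\<lambda>x. inverse (f x))"
  using assms(2,3)
proof (induction k arbitrary: f)
  case 0
  then show ?case by (auto intro!: continuous_intros)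
next
  case (Suc k)
  have "Ck_on k S (\<lambda>x. inverse (f x))" using Suc Ck_on_Suc_imp by blast
  then have "Ck_on k S (\<lambda>x. inverse (f x) *\<^sub>R (-1) *\<^sub>R inverse (f x) *\<^sub>R frechet_derivative f (at x) v)" for v
    using Suc.prems by (intro Ck_on_scaleR \<open>open S\<close> Ck_on_const) auto
  then have *: "Ck_on k S (\<lambda>x. - (inverse (f x) * frechet_derivative f (at x) v * inverse (f x)))" for v
    by (simp add: mult_ac)
  have "((\<lambda>x. inverse (f x)) has_derivative
      (\<lambda>v. - (inverse (f x) * frechet_derivative f (at x) v * inverse (f x)))) (at x)" if "x \<in> S" for x
    by (rule Deriv.has_derivative_inverse[OF Suc.prems(2)[OF that] Ck_on_SucD[OF Suc.prems(1) that]])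
  then show ?case by (rule Ck_on_SucI[OF \<open>open S\<close> _ *])
qed

section \<open>Orthonormal bases and the chain rule\<close>

definition orthonormal_basis :: "'a::real_inner set \<Rightarrow> bool" where
  "orthonormal_basis E \<longleftrightarrow> finite E \<and> (\<forall>e\<in>E. \<forall>e'\<in>E. e \<bullet> e' = (if e = e' then 1 else 0)) \<and>
     (\<forall>x. (\<Sum>e\<in>E. (x \<bullet> e) *\<^sub>R e) = x)"

lemma orthonormal_basis_exists:
  fixes S :: "'a::real_inner set"
  assumes "finite S" "span S = UNIV"
  obtains E :: "'a set" where "orthonormal_basis E"
proof -
  obtain C :: "'a set" where C: "finite C" "span C = UNIV" "pairwise orthogonal C"
    using basis_orthogonal[OF assms(1)] assms(2) by auto
  \<comment> \<open>The orthogonalised set may contain 0, which cannot be normalised and adds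
    nothing to the span. For the zero space \<open>E\<close> is empty, so zero-dimensional factors
    are covered.\<close>
  define E where "E = (\<lambda>x. x /\<^sub>R norm x) ` (C - {0})"
  have fin: "finite E" using C by (simp add: E_def)
  have orth: "e \<bullet> e' = (if e = e' then 1 else 0)" if e: "e \<in> E" "e' \<in> E" for e e'
  proof -
    obtain c c' where c: "c \<in> C" "c \<noteq> 0" "e = c /\<^sub>R norm c" "c' \<in> C" "c' \<noteq> 0" "e' = c' /\<^sub>R norm c'"
      using e unfolding E_def by (elim imageE DiffE) simp
    show ?thesis
    proof (cases "c = c'")
      case True
      then show ?thesis using c by (simp add: power2_norm_eq_inner[symmetric] power2_eq_square)
    next
      case False
      then have o: "c \<bullet> c' = 0" using C(3) c by (auto simp: pairwise_def orthogonal_def)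
      have "e \<noteq> e'"
      proof
        assume "e = e'"
        moreover have "e \<bullet> e' = 0" unfolding c(3,6) using o by simp
        ultimately show False using c(1,2,3) by simp
      qed
      then show ?thesis using c o by simp
    qed
  qed
  have "x \<in> span E" if "x \<in> C" for x
  proof (cases "x = 0")
    case False
    then have "norm x *\<^sub>R (x /\<^sub>R norm x) \<in> span E"
      using that by (intro span_scale span_base) (auto simp: E_def)
    then show ?thesis using False by simp
  qed (simp add: span_zero)
  then have "span E = UNIV" using C(2) by (metis subsetI span_minimal subspace_span top.extremum_uniqueI)
  moreover have "(\<Sum>e\<in>E. (x \<bullet> e) *\<^sub>R e) = x" if "x \<in> span E" for x
    using that
  proof (induction rule: span_induct_alt)
    case (step c y z)
    have "(\<Sum>e\<in>E. ((c *\<^sub>R y + z) \<bullet> e) *\<^sub>R e) = c *\<^sub>R (\<Sum>e\<in>E. (y \<bullet> e) *\<^sub>R e) + (\<Sum>e\<in>E. (z \<bullet> e) *\<^sub>R e)"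
      by (simp add: inner_add_left scaleR_add_left sum.distrib scaleR_sum_right)
    also have "(\<Sum>e\<in>E. (y \<bullet> e) *\<^sub>R e) = (\<Sum>e\<in>E. if y = e then e else 0)"
      by (rule sum.cong) (use orth step in auto)
    finally show ?case using step fin by simp
  qed simp
  ultimately have "orthonormal_basis E" using fin orth by (simp add: orthonormal_basis_def)
  then show ?thesis by (rule that)
qed

text \<open>\<open>Ck_on\<close> controls derivatives in fixed directions, while the chain rule
  evaluates the derivative of \<open>f\<close> in the moving direction Dg(x) v. Expanding that
  direction in \<open>E\<close> gives a finite sum of coordinates of Dg(x) v times derivatives of
  \<open>f\<close> in fixed directions, to which the induction hypothesis applies.\<close>

lemma Ck_on_compose:
  fixes g :: "'a::real_normed_vector \<Rightarrow> 'e::real_inner"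
  assumes E: "orthonormal_basis (E::'e set)" and "open S" "open T" "\<And>x. x \<in> S \<Longrightarrow> g x \<in> T"
    and "Ck_on k S g" "Ck_on k T f"
  shows "Ck_on k S (\<lambda>x. f (g x))"
  using assms(5,6)
proof (induction k arbitrary: f)
  case 0
  then show ?case using assms(4) continuous_on_compose2[of T f S g] by auto
next
  case (Suc k)
  have "Ck_on k S g" using Suc.prems Ck_on_Suc_imp by blast
  then have "Ck_on k S (\<lambda>x. frechet_derivative f (at (g x)) e)" for e
    using Suc.IH[of "\<lambda>y. frechet_derivative f (at y) e"] Suc.prems by simp
  then have "Ck_on k S (\<lambda>x. \<Sum>e\<in>E. (frechet_derivative g (at x) v \<bullet> e) *\<^sub>R frechet_derivative f (at (g x)) e)" for v
    using Suc by (intro Ck_on_sum Ck_on_scaleR \<open>open S\<close>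
        Ck_on_bounded_linear_comp[OF _ bounded_linear_inner_left]) auto
  then show ?case
  proof (rule Ck_on_SucI[OF \<open>open S\<close>, rotated])
    fix x assume x: "x \<in> S"
    let ?Df = "frechet_derivative f (at (g x))" and ?Dg = "frechet_derivative g (at x)"
    have f: "(f has_derivative ?Df) (at (g x))" using Ck_on_SucD[OF Suc.prems(2)] x assms(4) by blast
    have Df: "?Df w = (\<Sum>e\<in>E. (w \<bullet> e) *\<^sub>R ?Df e)" for w
    proof -
      have l: "linear ?Df" using f has_derivative_linear by blast
      have "?Df w = ?Df (\<Sum>e\<in>E. (w \<bullet> e) *\<^sub>R e)" using E by (simp add: orthonormal_basis_def)
      then show ?thesis by (simp add: linear_sum[OF l] linear_scale[OF l])
    qed
    have "(\<lambda>v. \<Sum>e\<in>E. (?Dg v \<bullet> e) *\<^sub>R ?Df e) = (\<lambda>v. ?Df (?Dg v))"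
      by (rule ext) (rule Df[symmetric])
    then show "((\<lambda>x. f (g x)) has_derivative (\<lambda>v. \<Sum>e\<in>E. (?Dg v \<bullet> e) *\<^sub>R ?Df e)) (at x)"
      using has_derivative_compose[OF Ck_on_SucD[OF Suc.prems(1) x] f] by simp
  qed
qed

lemma smooth_on_frechet_derivative:
  assumes "smooth_on S f" shows "smooth_on S (\<lambda>x. frechet_derivative f (at x) v)"
  using assms unfolding smooth_on_def by (metis Ck_on.simps(2))

lemma smooth_on_has_derivative:
  assumes "smooth_on S f" "x \<in> S"
  shows "(f has_derivative frechet_derivative f (at x)) (at x)"
  using assms Ck_on_SucD unfolding smooth_on_def by blast

lemma smooth_on_continuous: "smooth_on S f \<Longrightarrow> continuous_on S f"
  unfolding smooth_on_def by (metis Ck_on.simps(1))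

lemma smooth_on_cong:
  "open S \<Longrightarrow> (\<And>x. x \<in> S \<Longrightarrow> f x = g x) \<Longrightarrow> smooth_on S f \<longleftrightarrow> smooth_on S g"
  unfolding smooth_on_def using Ck_on_cong by blast

lemma smooth_on_subset: "smooth_on S f \<Longrightarrow> T \<subseteq> S \<Longrightarrow> smooth_on T f"
  unfolding smooth_on_def using Ck_on_subset by blast

lemma smooth_on_local:
  "(\<And>x. x \<in> S \<Longrightarrow> \<exists>T. open T \<and> x \<in> T \<and> smooth_on T f) \<Longrightarrow> smooth_on S f"
  unfolding smooth_on_def by (meson Ck_on_local)

lemma smooth_on_const: "smooth_on S (\<lambda>x. c)"
  by (simp add: smooth_on_def Ck_on_const)

lemma smooth_on_bounded_linear: "open S \<Longrightarrow> bounded_linear L \<Longrightarrow> smooth_on S L"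
  by (simp add: smooth_on_def Ck_on_bounded_linear)

lemma smooth_on_add:
  "open S \<Longrightarrow> smooth_on S f \<Longrightarrow> smooth_on S g \<Longrightarrow> smooth_on S (\<lambda>x. f x + g x)"
  by (simp add: smooth_on_def Ck_on_add)

lemma smooth_on_mult:
  fixes f g :: "'a::real_normed_vector \<Rightarrow> real"
  shows "open S \<Longrightarrow> smooth_on S f \<Longrightarrow> smooth_on S g \<Longrightarrow> smooth_on S (\<lambda>x. f x * g x)"
  using Ck_on_scaleR[of S _ f g] by (simp add: smooth_on_def)

lemma smooth_on_diff:
  fixes f g :: "'a::real_normed_vector \<Rightarrow> real"
  shows "open S \<Longrightarrow> smooth_on S f \<Longrightarrow> smooth_on S g \<Longrightarrow> smooth_on S (\<lambda>x. f x - g x)"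
  using smooth_on_add[of S f "\<lambda>x. (-1) * g x"] smooth_on_mult[of S "\<lambda>_. -1" g]
  by (simp add: smooth_on_const)

lemma smooth_on_inverse:
  fixes f :: "'a::real_normed_vector \<Rightarrow> real"
  shows "open S \<Longrightarrow> smooth_on S f \<Longrightarrow> (\<And>x. x \<in> S \<Longrightarrow> f x \<noteq> 0) \<Longrightarrow> smooth_on S (\<lambda>x. inverse (f x))"
  by (simp add: smooth_on_def Ck_on_inverse)

lemma smooth_on_compose:
  fixes g :: "'a::real_normed_vector \<Rightarrow> 'e::real_inner"
  assumes "orthonormal_basis (E::'e set)" "open S" "open T" "\<And>x. x \<in> S \<Longrightarrow> g x \<in> T"
    "smooth_on S g" "smooth_on T f"
  shows "smooth_on S (\<lambda>x. f (g x))"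
  using Ck_on_compose[OF assms(1-3), where g = g and f = f] assms(4-6) by (simp add: smooth_on_def)

subsection \<open>Bump functions\<close>

text \<open>The factors 1/t^n make the family closed under differentiation up to linear
  combinations, so smoothness is one induction on the order for all \<open>n\<close> at once. The
  bump function is built from n = 0.\<close>

definition flat_exp :: "nat \<Rightarrow> real \<Rightarrow> real" where
  "flat_exp n t = (if t > 0 then exp (- (1 / t)) / t ^ n else 0)"

text \<open>With x = 1/t the right-hand limit is the decay of x^n / exp x at infinity; on the left
  the function is 0.\<close>

lemma flat_exp_tendsto_0: "(flat_exp n \<longlongrightarrow> 0) (at 0)"
proof -
  have "((\<lambda>x::real. x ^ n / exp x) \<longlongrightarrow> 0) at_top" by (rule tendsto_power_div_exp_0)
  then have "((\<lambda>t::real. inverse t ^ n / exp (inverse t)) \<longlongrightarrow> 0) (at_right 0)"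
    by (rule filterlim_compose[OF _ filterlim_inverse_at_top_right])
  then have "(flat_exp n \<longlongrightarrow> 0) (at_right 0)"
    by (rule Lim_transform_eventually)
      (auto simp: eventually_at_right_field flat_exp_def exp_minus field_simps intro!: exI[of _ 1])
  moreover have "(flat_exp n \<longlongrightarrow> 0) (at_left 0)"
    by (rule tendsto_eventually) (auto simp: eventually_at_left_field flat_exp_def intro!: exI[of _ "-1"])
  ultimately show ?thesis by (simp add: filterlim_at_split)
qed

lemma flat_exp_has_derivative:
  "(flat_exp n has_real_derivative flat_exp (Suc (Suc n)) t - real n * flat_exp (Suc n) t) (at t)"
proof -
  consider "t > 0" | "t < 0" | "t = 0" by linarith
  then show ?thesis
  proof cases
    case 1
    have "((\<lambda>t. exp (- (1 / t))) has_real_derivative exp (- (1 / t)) / t\<^sup>2) (at t)"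
      using 1 by (auto intro!: derivative_eq_intros simp: power2_eq_square)
    then have "((\<lambda>t. exp (- (1 / t)) / t ^ n) has_real_derivative
        (exp (- (1 / t)) / t\<^sup>2 * t ^ n - exp (- (1 / t)) * (real n * t ^ (n - Suc 0))) / (t ^ n * t ^ n)) (at t)"
      using 1 by (intro DERIV_divide DERIV_pow) auto
    also have "(exp (- (1 / t)) / t\<^sup>2 * t ^ n - exp (- (1 / t)) * (real n * t ^ (n - Suc 0))) / (t ^ n * t ^ n) =
        flat_exp (Suc (Suc n)) t - real n * flat_exp (Suc n) t"
      using 1 by (cases n) (simp_all add: flat_exp_def field_simps power2_eq_square)
    finally have "((\<lambda>t. exp (- (1 / t)) / t ^ n) has_real_derivative
        flat_exp (Suc (Suc n)) t - real n * flat_exp (Suc n) t) (at t)" .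
    then show ?thesis
      by (rule has_field_derivative_transform_within_open[where S = "{0<..}"])
        (use 1 in \<open>auto simp: flat_exp_def\<close>)
  next
    case 2
    have "((\<lambda>t. 0) has_real_derivative flat_exp (Suc (Suc n)) t - real n * flat_exp (Suc n) t) (at t)"
      using 2 by (simp add: flat_exp_def)
    then show ?thesis
      by (rule has_field_derivative_transform_within_open[where S = "{..<0}"])
        (use 2 in \<open>auto simp: flat_exp_def\<close>)
  next
    case 3
    \<comment> \<open>Dividing by h raises the exponent of the denominator, so the difference
      quotient at 0 is \<open>flat_exp (Suc n)\<close>.\<close>
    have "(\<lambda>h. (flat_exp n (0 + h) - flat_exp n 0) / h) \<midarrow>0\<rightarrow> 0"
      by (rule Lim_transform_eventually[OF flat_exp_tendsto_0[of "Suc n"]])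
        (auto simp: flat_exp_def eventually_at field_simps intro!: exI[of _ 1])
    then show ?thesis using 3 by (simp add: DERIV_def flat_exp_def)
  qed
qed

lemma smooth_on_flat_exp: "smooth_on UNIV (flat_exp n)"
proof -
  have "Ck_on k UNIV (flat_exp n)" for k
  proof (induction k arbitrary: n)
    case 0
    then show ?case
      using DERIV_isCont[OF flat_exp_has_derivative] by (auto intro!: continuous_at_imp_continuous_on)
  next
    case (Suc k)
    have "Ck_on k UNIV (\<lambda>t. v *\<^sub>R (flat_exp (Suc (Suc n)) t + (- real n) *\<^sub>R flat_exp (Suc n) t))" for v :: real
      by (intro Ck_on_scaleR Ck_on_add Ck_on_const Suc open_UNIV)
    then have *: "Ck_on k UNIV (\<lambda>t. (flat_exp (Suc (Suc n)) t - real n * flat_exp (Suc n) t) * v)" for v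
      by (simp add: mult_ac)
    show ?case
      by (rule Ck_on_SucI[OF _ _ *])
        (use flat_exp_has_derivative in \<open>auto simp: has_field_derivative_def\<close>)
  qed
  then show ?thesis by (simp add: smooth_on_def)
qed

lemma orthonormal_basis_real: "orthonormal_basis {1::real}"
  by (simp add: orthonormal_basis_def)

text \<open>The quotient F(r^2 - q) / (F(r^2 - q) + F(q - (r/2)^2)), where F is
  \<open>flat_exp 0\<close> and q is the squared distance, which unlike the distance is smooth at
  the centre. One of the two arguments is always positive because r/2 < r, so the denominator never
  vanishes.\<close>

lemma smooth_bump:
  fixes x0 :: "'e::real_inner"
  assumes "r > 0"
  obtains h :: "'e \<Rightarrow> real" where "smooth_on UNIV h" "\<And>x. dist x0 x \<le> r / 2 \<Longrightarrow> h x = 1"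
    "\<And>x. dist x0 x \<ge> r \<Longrightarrow> h x = 0"
proof -
  define q where "q x = (x - x0) \<bullet> (x - x0)" for x
  have q: "smooth_on UNIV q"
  proof -
    have "Ck_on k UNIV q" for k
    proof -
      have "bounded_linear (\<lambda>x::'e. 2 * (x \<bullet> v))" for v
        by (intro bounded_linear_const_mult bounded_linear_inner_left)
      then have "Ck_on k UNIV (\<lambda>x. 2 * (x \<bullet> v) + (- (2 * (x0 \<bullet> v))))" for v
        by (intro Ck_on_add Ck_on_const Ck_on_bounded_linear) auto
      then have *: "Ck_on k UNIV (\<lambda>x. 2 * ((x - x0) \<bullet> v))" for v by (simp add: inner_diff_left algebra_simps)
      have "Ck_on (Suc k) UNIV q"
        by (rule Ck_on_SucI[where f' = "\<lambda>x v. 2 * ((x - x0) \<bullet> v)", OF _ _ *])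
          (auto simp: q_def[abs_def] inner_commute intro!: derivative_eq_intros)
      then show ?thesis by (rule Ck_on_Suc_imp)
    qed
    then show ?thesis by (simp add: smooth_on_def)
  qed
  have q': "q x = (dist x0 x)\<^sup>2" for x
    by (metis dist_commute dist_norm power2_norm_eq_inner q_def)
  let ?f = "flat_exp 0"
  have s: "smooth_on UNIV (\<lambda>x. ?f (p x))" if "smooth_on UNIV p" for p :: "'e \<Rightarrow> real"
    by (rule smooth_on_compose[OF orthonormal_basis_real, of UNIV UNIV])
      (auto intro: that smooth_on_flat_exp)
  have ge: "?f t \<ge> 0" for t by (simp add: flat_exp_def)
  have gt: "?f t > 0 \<longleftrightarrow> t > 0" and eq: "t \<le> 0 \<Longrightarrow> ?f t = 0" for t by (auto simp: flat_exp_def)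
  have ne: "?f (r\<^sup>2 - q x) + ?f (q x - (r/2)\<^sup>2) \<noteq> 0" for x
  proof (cases "r\<^sup>2 - q x > 0")
    case True
    then show ?thesis using gt[of "r\<^sup>2 - q x"] ge[of "q x - (r/2)\<^sup>2"] by linarith
  next
    case False
    moreover have "(r/2)\<^sup>2 < r\<^sup>2" using assms by (simp add: power_divide)
    ultimately show ?thesis using gt[of "q x - (r/2)\<^sup>2"] ge[of "r\<^sup>2 - q x"] by linarith
  qed
  define h where "h x = ?f (r\<^sup>2 - q x) * inverse (?f (r\<^sup>2 - q x) + ?f (q x - (r/2)\<^sup>2))" for x
  have "smooth_on UNIV h" unfolding h_def
    by (intro smooth_on_mult smooth_on_inverse smooth_on_add smooth_on_diff smooth_on_const q s ne) auto
  moreover have "h x = 1" if "dist x0 x \<le> r / 2" for x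
  proof -
    have "q x - (r/2)\<^sup>2 \<le> 0" using that by (simp add: q' power_mono)
    then show ?thesis using ne[of x] by (simp add: h_def eq)
  qed
  moreover have "h x = 0" if "dist x0 x \<ge> r" for x
  proof -
    have "r\<^sup>2 - q x \<le> 0" using that assms by (simp add: q' power_mono)
    then show ?thesis by (simp add: h_def eq)
  qed
  ultimately show ?thesis using that by blast
qed

text \<open>Sums with coefficients bounded by R form a box, compact by induction on the basis
  because it is the sum of a segment and a smaller box. The ball is a closed subset of a large
  enough box.\<close>

lemma compact_cball_orthonormal:
  assumes E: "orthonormal_basis (E::'e::real_inner set)"
  shows "compact (cball (x::'e) r)"
proof -
  have "compact ((\<lambda>c. \<Sum>e\<in>F. c e *\<^sub>R e) ` {c. \<forall>e. \<bar>c e\<bar> \<le> R})" if "finite F" for F :: "'e set" and R :: real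
    using that
  proof (induction F)
    case empty
    show ?case by (simp add: image_constant_conv)
  next
    case (insert e F)
    let ?C = "{c::'e\<Rightarrow>real. \<forall>e. \<bar>c e\<bar> \<le> R}"
    have 1: "compact ((\<lambda>t. t *\<^sub>R e) ` {-R..R})"
      by (intro compact_continuous_image continuous_intros compact_Icc)
    have "(\<lambda>c. \<Sum>e\<in>insert e F. c e *\<^sub>R e) ` ?C =
        {a + b | a b. a \<in> (\<lambda>t. t *\<^sub>R e) ` {-R..R} \<and> b \<in> (\<lambda>c. \<Sum>e\<in>F. c e *\<^sub>R e) ` ?C}" (is "?L = ?S")
    proof
      show "?L \<subseteq> ?S"
      proof
        fix y assume "y \<in> ?L"
        then obtain c where c: "c \<in> ?C" "y = (\<Sum>e\<in>insert e F. c e *\<^sub>R e)" by auto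
        then have "y = c e *\<^sub>R e + (\<Sum>e\<in>F. c e *\<^sub>R e)" using insert by simp
        moreover have "\<bar>c e\<bar> \<le> R" using c(1) by blast
        then have "c e \<in> {-R..R}" unfolding atLeastAtMost_iff by linarith
        ultimately show "y \<in> ?S" using c(1) by blast
      qed
      show "?S \<subseteq> ?L"
      proof
        fix y assume "y \<in> ?S"
        then obtain t c where *: "y = t *\<^sub>R e + (\<Sum>e\<in>F. c e *\<^sub>R e)" "t \<in> {-R..R}" "c \<in> ?C" by auto
        have "(\<Sum>a\<in>F. (c(e := t)) a *\<^sub>R a) = (\<Sum>a\<in>F. c a *\<^sub>R a)"
          by (rule sum.cong) (use insert in auto)
        then have "y = (\<Sum>a\<in>insert e F. (c(e := t)) a *\<^sub>R a)" using insert * by simp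
        moreover have "c(e := t) \<in> ?C" using * by auto
        ultimately show "y \<in> ?L" by blast
      qed
    qed
    then show ?case using compact_sums[OF 1 insert.IH] by simp
  qed
  moreover have "finite E" using E by (simp add: orthonormal_basis_def)
  ultimately have "compact ((\<lambda>c. \<Sum>e\<in>E. c e *\<^sub>R e) ` {c. \<forall>e. \<bar>c e\<bar> \<le> norm x + r})" by blast
  then have "compact ((\<lambda>c. \<Sum>e\<in>E. c e *\<^sub>R e) ` {c. \<forall>e. \<bar>c e\<bar> \<le> norm x + r} \<inter> cball x r)"
    by (rule compact_Int_closed) (rule closed_cball)
  moreover have "cball x r \<subseteq> (\<lambda>c. \<Sum>e\<in>E. c e *\<^sub>R e) ` {c. \<forall>e. \<bar>c e\<bar> \<le> norm x + r}"
  proof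
    fix y assume y: "y \<in> cball x r"
    have ny: "norm y \<le> norm x + r" using y norm_triangle_ineq2[of y x] by (simp add: dist_norm norm_minus_commute)
    \<comment> \<open>By Cauchy-Schwarz a coefficient is at most the norm of y, hence at most
      \<open>norm x + r\<close>. The value 0 off the basis is there because the box bounds a
      function on the whole space.\<close>
    define c where "c e = (if e \<in> E then y \<bullet> e else 0)" for e
    have "\<bar>c e\<bar> \<le> norm x + r" for e
    proof (cases "e \<in> E")
      case True
      then have "norm e = 1" using E by (simp add: orthonormal_basis_def norm_eq_sqrt_inner)
      then show ?thesis using Cauchy_Schwarz_ineq2[of y e] ny True by (simp add: c_def)
    next
      case False
      moreover have "0 \<le> norm x + r" by (rule order_trans[OF norm_ge_zero ny])
      ultimately show ?thesis by (simp add: c_def)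
    qed
    moreover have "y = (\<Sum>e\<in>E. c e *\<^sub>R e)" using E by (simp add: c_def orthonormal_basis_def)
    ultimately show "y \<in> (\<lambda>c. \<Sum>e\<in>E. c e *\<^sub>R e) ` {c. \<forall>e. \<bar>c e\<bar> \<le> norm x + r}" by blast
  qed
  ultimately show ?thesis by (simp add: Int_absorb1)
qed

subsection \<open>Symmetry of second derivatives\<close>

text \<open>Two mean value theorems: along \<open>u\<close>, for the difference of \<open>f\<close>
  on two parallel segments, then along \<open>v\<close>, for the derivative in direction
  \<open>u\<close>. The second difference is symmetric in \<open>u\<close> and \<open>v\<close>
  while its evaluation is not, and this is what gets exploited.\<close>

lemma second_difference_mean_value:
  fixes f :: "'a::real_normed_vector \<Rightarrow> real"
  assumes f: "smooth_on S f" and s: "s > 0" and S: "cball x (s * (norm u + norm v)) \<subseteq> S"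
  obtains a where "dist x a \<le> s * (norm u + norm v)"
    "f (x + s *\<^sub>R u + s *\<^sub>R v) - f (x + s *\<^sub>R u) - f (x + s *\<^sub>R v) + f x =
      s\<^sup>2 * frechet_derivative (\<lambda>y. frechet_derivative f (at y) u) (at a) v"
proof -
  let ?Du = "\<lambda>y. frechet_derivative f (at y) u"
  have in_cball: "dist x (x + t *\<^sub>R u + t' *\<^sub>R v) \<le> s * (norm u + norm v)" if "0 \<le> t" "t \<le> s" "0 \<le> t'" "t' \<le> s" for t t'
  proof -
    have "dist x (x + t *\<^sub>R u + t' *\<^sub>R v) = norm (t *\<^sub>R u + t' *\<^sub>R v)"
      by (metis add.assoc add_diff_cancel_left' dist_commute dist_norm)
    also have "\<dots> \<le> t * norm u + t' * norm v" using norm_triangle_ineq[of "t *\<^sub>R u" "t' *\<^sub>R v"] that by simp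
    also have "\<dots> \<le> s * norm u + s * norm v" using that by (intro add_mono mult_right_mono) auto
    finally show ?thesis by (simp add: algebra_simps)
  qed
  have D: "(f has_derivative frechet_derivative f (at y)) (at y)"
    and D2: "(?Du has_derivative frechet_derivative ?Du (at y)) (at y)" if "dist x y \<le> s * (norm u + norm v)" for y
    using smooth_on_has_derivative[OF f] smooth_on_has_derivative[OF smooth_on_frechet_derivative[OF f]]
      that S by (auto simp: subset_iff)
  have line: "((\<lambda>t. h (p + t *\<^sub>R w)) has_real_derivative h' w) (at t)"
    if "(h has_derivative h') (at (p + t *\<^sub>R w))" for h h' t and p w :: 'a
  proof -
    have "((\<lambda>t. h (p + t *\<^sub>R w)) has_derivative (\<lambda>r. h' (r *\<^sub>R w))) (at t)"
      by (rule has_derivative_compose[where f = "\<lambda>t. p + t *\<^sub>R w" and g = h and g' = h', OF _ that]) (auto intro!: derivative_eq_intros)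
    moreover have "linear h'" using that has_derivative_linear by blast
    ultimately show ?thesis by (simp add: has_field_derivative_def linear_scale mult.commute[of _ "h' w"])
  qed
  define \<phi> where "\<phi> t = f (x + s *\<^sub>R v + t *\<^sub>R u) - f (x + t *\<^sub>R u)" for t
  have "\<exists>z>0. z < s \<and> \<phi> s - \<phi> 0 = (s - 0) * (?Du (x + s *\<^sub>R v + z *\<^sub>R u) - ?Du (x + z *\<^sub>R u))"
  proof (rule MVT2[OF s])
    fix t assume t: "0 \<le> t" "t \<le> s"
    show "(\<phi> has_real_derivative (?Du (x + s *\<^sub>R v + t *\<^sub>R u) - ?Du (x + t *\<^sub>R u))) (at t)"
      unfolding \<phi>_def
      by (intro DERIV_diff line D) (use in_cball[of t s] in_cball[of t 0] t s in \<open>simp_all add: algebra_simps\<close>)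
  qed
  then obtain t where t: "0 < t" "t < s" "\<phi> s - \<phi> 0 = s * (?Du (x + t *\<^sub>R u + s *\<^sub>R v) - ?Du (x + t *\<^sub>R u))"
    by (auto simp: algebra_simps)
  have "\<exists>z>0. z < s \<and> ?Du (x + t *\<^sub>R u + s *\<^sub>R v) - ?Du (x + t *\<^sub>R u + 0 *\<^sub>R v) =
      (s - 0) * frechet_derivative ?Du (at (x + t *\<^sub>R u + z *\<^sub>R v)) v"
    by (rule MVT2[OF s]) (intro line D2, use in_cball t in simp)
  then obtain z where z: "0 < z" "z < s" "?Du (x + t *\<^sub>R u + s *\<^sub>R v) - ?Du (x + t *\<^sub>R u) =
      s * frechet_derivative ?Du (at (x + t *\<^sub>R u + z *\<^sub>R v)) v" by auto
  show thesis
    by (rule that[of "x + t *\<^sub>R u + z *\<^sub>R v"])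
      (use in_cball[of t z] t z in \<open>simp_all add: \<phi>_def power2_eq_square algebra_simps\<close>)
qed

text \<open>If the mixed derivatives differed at \<open>x\<close>, then for a small enough step the
  single number (second difference) / s^2 would lie within half of their distance of both, by
  continuity.\<close>

lemma smooth_on_second_derivative_symmetric:
  fixes f :: "'a::real_normed_vector \<Rightarrow> real"
  assumes f: "smooth_on S f" and "open S" "x \<in> S"
  shows "frechet_derivative (\<lambda>y. frechet_derivative f (at y) u) (at x) v =
    frechet_derivative (\<lambda>y. frechet_derivative f (at y) v) (at x) u"
proof (rule ccontr)
  let ?A = "\<lambda>u v x. frechet_derivative (\<lambda>y. frechet_derivative f (at y) u) (at x) v"
  assume "\<not> ?thesis"
  then have ne: "?A u v x \<noteq> ?A v u x" by simp
  define e where "e = \<bar>?A u v x - ?A v u x\<bar> / 2"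
  have e: "e > 0" using ne by (simp add: e_def)
  have c: "isCont (?A u v) x" for u v
    using smooth_on_continuous[OF smooth_on_frechet_derivative[OF smooth_on_frechet_derivative[OF f]]]
      assms(2,3) by (simp add: continuous_on_eq_continuous_at)
  obtain d1 where d1: "d1 > 0" "\<And>y. dist y x < d1 \<Longrightarrow> dist (?A u v y) (?A u v x) < e"
    using c[of u v] e unfolding continuous_at_eps_delta by blast
  obtain d2 where d2: "d2 > 0" "\<And>y. dist y x < d2 \<Longrightarrow> dist (?A v u y) (?A v u x) < e"
    using c[of v u] e unfolding continuous_at_eps_delta by blast
  obtain d3 where d3: "d3 > 0" "cball x d3 \<subseteq> S" using assms(2,3) open_contains_cball by blast
  \<comment> \<open>The points found below are only known to lie within \<open>d\<close>; halving
    the minimum makes \<open>d\<close> strictly less than \<open>d1\<close> and \<open>d2\<close>,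
    and \<open>d3\<close> keeps the closed ball inside \<open>S\<close>. In \<open>s\<close> the
    summand 1 keeps the denominator positive when u = v = 0.\<close>
  define d where "d = min d3 (min d1 d2 / 2)"
  define s where "s = d / (norm u + norm v + 1)"
  have d: "d > 0" using d1 d2 d3 by (simp add: d_def)
  have n: "norm u + norm v + 1 > 0" using norm_ge_zero[of u] norm_ge_zero[of v] by linarith
  have s: "s > 0" using d n by (simp add: s_def)
  have "s * (norm u + norm v) \<le> s * (norm u + norm v + 1)" using s by simp
  also have "\<dots> = d" using n by (simp add: s_def)
  finally have sd: "s * (norm u + norm v) \<le> d" .
  then have S: "cball x (s * (norm u + norm v)) \<subseteq> S" "cball x (s * (norm v + norm u)) \<subseteq> S"
    using d3 by (auto simp: d_def subset_iff add.commute)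
  obtain a where a: "dist x a \<le> s * (norm u + norm v)"
    "f (x + s *\<^sub>R u + s *\<^sub>R v) - f (x + s *\<^sub>R u) - f (x + s *\<^sub>R v) + f x = s\<^sup>2 * ?A u v a"
    using second_difference_mean_value[OF f s S(1)] by blast
  obtain a' where a': "dist x a' \<le> s * (norm v + norm u)"
    "f (x + s *\<^sub>R v + s *\<^sub>R u) - f (x + s *\<^sub>R v) - f (x + s *\<^sub>R u) + f x = s\<^sup>2 * ?A v u a'"
    using second_difference_mean_value[OF f s S(2)] by blast
  have eq: "x + s *\<^sub>R u + s *\<^sub>R v = x + s *\<^sub>R v + s *\<^sub>R u" by (simp add: ac_simps)
  have "s\<^sup>2 * ?A u v a = s\<^sup>2 * ?A v u a'" using a(2) a'(2) unfolding eq by linarith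
  then have "?A u v a = ?A v u a'" using s by simp
  moreover have "dist x a \<le> d" "dist x a' \<le> d" using a a' sd by (simp_all add: add.commute)
  moreover have "d < d1" "d < d2" using d1 d2 by (auto simp: d_def)
  ultimately have "dist (?A u v a) (?A u v x) < e" "dist (?A u v a) (?A v u x) < e"
    using d1(2)[of a] d2(2)[of a'] by (simp_all add: dist_commute)
  moreover have False if "dist w A < \<bar>A - B\<bar> / 2" "dist w B < \<bar>A - B\<bar> / 2" for w A B :: real
    using dist_triangle_half_r[OF that] by (simp add: dist_real_def)
  ultimately show False unfolding e_def by blast
qed

section \<open>Smooth manifolds\<close>

lemma smooth_on_transform:
  "smooth_on S f \<Longrightarrow> open S \<Longrightarrow> (\<And>x. x \<in> S \<Longrightarrow> f x = g x) \<Longrightarrow> smooth_on S g"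
  using smooth_on_cong[of S f g] by simp

locale manifold =
  fixes A :: "('m::{t2_space,second_countable_topology}, 'e::real_inner) chart set"
  assumes smooth_manifold: "smooth_manifold A"
begin

abbreviation C where "C \<equiv> smooth_functions A"
abbreviation VF where "VF \<equiv> vector_fields A"
abbreviation T where "T \<equiv> tangent_space A"

text \<open>Chosen once for the manifold, so that all frames share an index set and
  \<open>card Bas\<close> serves as the dimension.\<close>

definition Bas :: "'e set" where "Bas = (SOME E. orthonormal_basis E)"

lemma orthonormal_Bas: "orthonormal_basis Bas"
proof -
  obtain S :: "'e set" where "finite S" "span S = UNIV" using smooth_manifold by (auto simp: smooth_manifold_def)
  then have "\<exists>E::'e set. orthonormal_basis E" using orthonormal_basis_exists by blast
  then show ?thesis unfolding Bas_def by (rule someI_ex)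
qed

lemma finite_Bas: "finite Bas"
  using orthonormal_Bas by (simp add: orthonormal_basis_def)

lemma
  assumes "(U, \<phi>) \<in> A"
  shows chart_open: "open U" and chart_open_range: "open (\<phi> ` U)"
    and chart_homeomorphism: "homeomorphism U (\<phi> ` U) \<phi> (inv_into U \<phi>)"
  using assms smooth_manifold by (auto simp: smooth_manifold_def)

lemma chart_inv: "(U, \<phi>) \<in> A \<Longrightarrow> q \<in> U \<Longrightarrow> inv_into U \<phi> (\<phi> q) = q"
  using chart_homeomorphism homeomorphism_apply1 by metis

lemma chart_at: obtains U \<phi> where "(U, \<phi>) \<in> A" "p \<in> U"
proof -
  have "p \<in> (\<Union>(U, \<phi>)\<in>A. U)" using smooth_manifold by (simp add: smooth_manifold_def)
  then show ?thesis using that by auto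
qed

lemma chart_transition:
  "(U, \<phi>) \<in> A \<Longrightarrow> (V, \<psi>) \<in> A \<Longrightarrow> smooth_on (\<phi> ` (U \<inter> V)) (\<psi> \<circ> inv_into U \<phi>)"
  using smooth_manifold by (fastforce simp: smooth_manifold_def)

lemma chart_open_image:
  assumes "(U, \<phi>) \<in> A" "open W" "W \<subseteq> U"
  shows "open (\<phi> ` W)"
proof -
  have "openin (top_of_set U) W" using assms chart_open by (simp add: openin_open_eq)
  then have "openin (top_of_set (\<phi> ` U)) (\<phi> ` W)"
    using homeomorphism_imp_open_map[OF chart_homeomorphism[OF assms(1)]] by blast
  then show ?thesis using chart_open_range[OF assms(1)] by (simp add: openin_open_eq)
qed

lemma chart_continuous: "(U, \<phi>) \<in> A \<Longrightarrow> continuous_on U \<phi>"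
  using chart_homeomorphism homeomorphism_def by metis

lemma smooth_on_chart: "f \<in> C \<Longrightarrow> (U, \<phi>) \<in> A \<Longrightarrow> smooth_on (\<phi> ` U) (f \<circ> inv_into U \<phi>)"
  by (auto simp: smooth_functions_def)

text \<open>For functions known only through formulas near each point, such as components in a local
  frame. Bump functions supply the global smooth function with which each local formula is
  compared.\<close>

lemma smooth_functions_local:
  assumes "\<And>p. \<exists>N f'. open N \<and> p \<in> N \<and> f' \<in> C \<and> (\<forall>q\<in>N. f q = f' q)"
  shows "f \<in> C"
  unfolding smooth_functions_def
proof clarify
  fix U \<phi> assume U: "(U, \<phi>) \<in> A"
  show "smooth_on (\<phi> ` U) (f \<circ> inv_into U \<phi>)"
  proof (rule smooth_on_local)
    fix x assume "x \<in> \<phi> ` U"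
    then obtain q where q: "q \<in> U" "x = \<phi> q" by auto
    obtain N f' where N: "open N" "q \<in> N" "f' \<in> C" "\<forall>q\<in>N. f q = f' q" using assms by metis
    let ?T = "\<phi> ` (N \<inter> U)"
    have op: "open ?T" using U N chart_open by (intro chart_open_image open_Int) auto
    have "smooth_on ?T (f' \<circ> inv_into U \<phi>)"
      by (rule smooth_on_subset[OF smooth_on_chart[OF N(3) U]]) auto
    moreover have "(f' \<circ> inv_into U \<phi>) y = (f \<circ> inv_into U \<phi>) y" if "y \<in> ?T" for y
      using that N U by (auto simp: chart_inv)
    ultimately have "smooth_on ?T (f \<circ> inv_into U \<phi>)" by (rule smooth_on_transform[OF _ op])
    then show "\<exists>T. open T \<and> x \<in> T \<and> smooth_on T (f \<circ> inv_into U \<phi>)" using op q N by blast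
  qed
qed

text \<open>The copy of \<open>K\<close> in the manifold is compact, hence closed because the
  manifold is Hausdorff. So a point outside the chart has a neighbourhood avoiding that copy, and
  there the extended function is 0.\<close>

lemma smooth_functions_chart_extension:
  assumes U: "(U, \<phi>) \<in> A" and G: "smooth_on (\<phi> ` U) G"
    and K: "compact K" "K \<subseteq> \<phi> ` U" "\<And>y. y \<in> \<phi> ` U - K \<Longrightarrow> G y = 0"
  shows "(\<lambda>q. if q \<in> U then G (\<phi> q) else 0) \<in> C"
  unfolding smooth_functions_def
proof clarify
  fix V \<psi> assume V: "(V, \<psi>) \<in> A"
  let ?f = "\<lambda>q. if q \<in> U then G (\<phi> q) else 0"
  show "smooth_on (\<psi> ` V) (?f \<circ> inv_into V \<psi>)"
  proof (rule smooth_on_local)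
    fix x assume "x \<in> \<psi> ` V"
    then obtain q where q: "q \<in> V" "x = \<psi> q" by auto
    show "\<exists>T. open T \<and> x \<in> T \<and> smooth_on T (?f \<circ> inv_into V \<psi>)"
    proof (cases "q \<in> U")
      case True
      let ?T = "\<psi> ` (V \<inter> U)"
      have op: "open ?T" using U V chart_open by (intro chart_open_image open_Int) auto
      have "smooth_on ?T (\<lambda>y. G ((\<phi> \<circ> inv_into V \<psi>) y))"
        by (rule smooth_on_compose[OF orthonormal_Bas op chart_open_range[OF U] _ chart_transition[OF V U] G])
          (auto simp: chart_inv[OF V])
      moreover have "G ((\<phi> \<circ> inv_into V \<psi>) y) = (?f \<circ> inv_into V \<psi>) y" if "y \<in> ?T" for y
        using that by (auto simp: chart_inv[OF V])
      ultimately have "smooth_on ?T (?f \<circ> inv_into V \<psi>)" by (rule smooth_on_transform[OF _ op])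
      then show ?thesis using op q True by blast
    next
      case False
      let ?K = "inv_into U \<phi> ` K"
      have "continuous_on K (inv_into U \<phi>)"
        using chart_homeomorphism[OF U] K(2) continuous_on_subset homeomorphism_def by metis
      then have cl: "closed ?K" using K(1) by (intro compact_imp_closed compact_continuous_image)
      let ?T = "\<psi> ` (V - ?K)"
      have op: "open ?T" using V cl chart_open by (intro chart_open_image open_Diff) auto
      have KU: "?K \<subseteq> U" using K(2) chart_inv[OF U] by auto
      have "?f q = 0" if "q \<notin> ?K" for q
      proof -
        have "\<phi> q \<notin> K" if "q \<in> U" using that \<open>q \<notin> ?K\<close> chart_inv[OF U that] by (metis imageI)
        then show ?thesis using K(3) by simp
      qed
      then have "(?f \<circ> inv_into V \<psi>) y = 0" if "y \<in> ?T" for y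
        using that chart_inv[OF V] by force
      then have "smooth_on ?T (?f \<circ> inv_into V \<psi>)"
        by (intro smooth_on_transform[OF smooth_on_const op]) auto
      moreover have "x \<in> ?T" using q KU False by auto
      ultimately show ?thesis using op by blast
    qed
  qed
qed

lemma smooth_functions_continuous:
  assumes "f \<in> C" shows "continuous_on UNIV f"
proof -
  have "isCont f p" for p
  proof -
    obtain U \<phi> where U: "(U, \<phi>) \<in> A" "p \<in> U" by (rule chart_at)
    have "continuous_on U (\<lambda>q. (f \<circ> inv_into U \<phi>) (\<phi> q))"
      by (rule continuous_on_compose2[OF smooth_on_continuous[OF smooth_on_chart[OF assms U(1)]]])
        (auto intro: chart_continuous U)
    then have "continuous_on U f"
      by (rule continuous_on_eq) (simp add: chart_inv[OF U(1)])
    then show ?thesis using chart_open[OF U(1)] U(2) by (simp add: continuous_on_eq_continuous_at)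
  qed
  then show ?thesis by (simp add: continuous_on_eq_continuous_at)
qed

lemma smooth_const: "(\<lambda>p. c) \<in> C"
  by (auto simp: smooth_functions_def comp_def smooth_on_const)

lemma smooth_add: "f \<in> C \<Longrightarrow> g \<in> C \<Longrightarrow> (\<lambda>p. f p + g p) \<in> C"
  by (auto simp: smooth_functions_def comp_def intro!: smooth_on_add chart_open_range)

lemma smooth_mult: "f \<in> C \<Longrightarrow> g \<in> C \<Longrightarrow> (\<lambda>p. f p * g p) \<in> C"
  by (auto simp: smooth_functions_def comp_def intro!: smooth_on_mult chart_open_range)

lemma smooth_minus: "f \<in> C \<Longrightarrow> (\<lambda>p. - f p) \<in> C"
  using smooth_mult[OF smooth_const[of "-1"]] by simp

lemma smooth_diff: "f \<in> C \<Longrightarrow> g \<in> C \<Longrightarrow> (\<lambda>p. f p - g p) \<in> C"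
  using smooth_add[OF _ smooth_minus] by simp

lemma smooth_power: "f \<in> C \<Longrightarrow> (\<lambda>p. f p ^ n) \<in> C"
  by (induction n) (simp_all add: smooth_const smooth_mult)

lemma smooth_sum: "(\<And>i. i \<in> I \<Longrightarrow> f i \<in> C) \<Longrightarrow> (\<lambda>p. \<Sum>i\<in>I. f i p) \<in> C"
  by (induction I rule: infinite_finite_induct) (simp_all add: smooth_const smooth_add)

lemma smooth_prod: "(\<And>i. i \<in> I \<Longrightarrow> f i \<in> C) \<Longrightarrow> (\<lambda>p. \<Prod>i\<in>I. f i p) \<in> C"
  by (induction I rule: infinite_finite_induct) (simp_all add: smooth_const smooth_mult)

lemmas smooth_intros = smooth_const smooth_add smooth_mult smooth_minus smooth_diff smooth_power
  smooth_sum smooth_prod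

subsection \<open>Bump functions and coordinate frames\<close>

text \<open>The bump is kept on the model space, so that it can multiply a chart expression before
  \<open>smooth_functions_chart_extension\<close> carries the product to the manifold.\<close>

lemma chart_bump:
  assumes U: "(U, \<phi>) \<in> A" and p: "p \<in> U" "open W" "p \<in> W"
  obtains r h where "r > 0" "cball (\<phi> p) r \<subseteq> \<phi> ` (U \<inter> W)" "smooth_on UNIV h"
    "\<And>y. dist (\<phi> p) y \<le> r / 2 \<Longrightarrow> h y = 1" "\<And>y. dist (\<phi> p) y \<ge> r \<Longrightarrow> h y = (0::real)"
proof -
  have "open (\<phi> ` (U \<inter> W))" using assms chart_open by (intro chart_open_image open_Int) auto
  then obtain r where r: "r > 0" "cball (\<phi> p) r \<subseteq> \<phi> ` (U \<inter> W)"
    using p open_contains_cball by blast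
  obtain h :: "'e \<Rightarrow> real" where "smooth_on UNIV h"
    "\<And>y. dist (\<phi> p) y \<le> r / 2 \<Longrightarrow> h y = 1" "\<And>y. dist (\<phi> p) y \<ge> r \<Longrightarrow> h y = (0::real)"
    using smooth_bump[OF r(1)] by blast
  then show ?thesis using that r by blast
qed

lemma chart_ball_nhd:
  assumes U: "(U, \<phi>) \<in> A" and p: "p \<in> U" and "r > 0"
  shows "open (U \<inter> \<phi> -` ball (\<phi> p) r)" "p \<in> U \<inter> \<phi> -` ball (\<phi> p) r"
  using assms continuous_open_preimage[OF chart_continuous chart_open] by auto

lemma bump_function:
  assumes "open W" "p \<in> W"
  obtains k N where "k \<in> C" "open N" "p \<in> N" "\<forall>q\<in>N. k q = 1" "\<forall>q. q \<notin> W \<longrightarrow> k q = 0"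
proof -
  obtain U \<phi> where U: "(U, \<phi>) \<in> A" "p \<in> U" by (rule chart_at)
  obtain r h where h: "r > 0" "cball (\<phi> p) r \<subseteq> \<phi> ` (U \<inter> W)" "smooth_on UNIV h"
    "\<And>y. dist (\<phi> p) y \<le> r / 2 \<Longrightarrow> h y = 1" "\<And>y. dist (\<phi> p) y \<ge> r \<Longrightarrow> h y = (0::real)"
    using chart_bump[OF U assms] by metis
  let ?k = "\<lambda>q. if q \<in> U then h (\<phi> q) else 0"
  have 1: "?k \<in> C"
    by (rule smooth_functions_chart_extension[OF U(1) _ compact_cball_orthonormal[OF orthonormal_Bas, of "\<phi> p" r]])
      (use h in \<open>auto intro: smooth_on_subset\<close>)
  have "?k q = 0" if "q \<notin> W" for q
  proof (cases "q \<in> U")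
    case True
    have "\<phi> q \<notin> cball (\<phi> p) r"
    proof
      assume "\<phi> q \<in> cball (\<phi> p) r"
      then obtain q' where "q' \<in> U \<inter> W" "\<phi> q = \<phi> q'" using h(2) by blast
      then show False using True that chart_inv[OF U(1)] by (metis IntD1 IntD2)
    qed
    then show ?thesis using h(5) by simp
  qed simp
  then have 2: "\<forall>q. q \<notin> W \<longrightarrow> ?k q = 0" by simp
  have 3: "\<forall>q\<in>U \<inter> \<phi> -` ball (\<phi> p) (r/2). ?k q = 1"
    using h(4) by simp
  have "r / 2 > 0" using h(1) by simp
  from that[OF 1 chart_ball_nhd[OF U this] 3 2] show ?thesis .
qed

definition chart_vector :: "'m set \<Rightarrow> ('m \<Rightarrow> 'e) \<Rightarrow> 'm \<Rightarrow> 'e \<Rightarrow> 'm tangent" where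
  "chart_vector U \<phi> p w =
     (\<lambda>f. if f \<in> C then frechet_derivative (f \<circ> inv_into U \<phi>) (at (\<phi> p)) w else 0)"

lemma chart_has_derivative:
  assumes "(U, \<phi>) \<in> A" "p \<in> U" "f \<in> C"
  shows "(f \<circ> inv_into U \<phi> has_derivative (\<lambda>w. chart_vector U \<phi> p w f)) (at (\<phi> p))"
  using smooth_on_has_derivative[OF smooth_on_chart[OF assms(3,1)]] assms by (simp add: chart_vector_def)

lemma chart_vector_linear:
  assumes "(U, \<phi>) \<in> A" "p \<in> U"
  shows "linear (\<lambda>w. chart_vector U \<phi> p w f)"
proof (cases "f \<in> C")
  case True
  show ?thesis by (rule has_derivative_linear[OF chart_has_derivative[OF assms True]])
next
  case False
  then show ?thesis by (simp add: chart_vector_def linear_iff)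
qed

text \<open>The definition lets each vector choose its own chart. By the chain rule a direction
  passes to another chart through the derivative of the transition map, so any single chart around
  the point yields all tangent vectors.\<close>

lemma tangent_space_chart:
  assumes U: "(U, \<phi>) \<in> A" "p \<in> U"
  shows "T p = range (chart_vector U \<phi> p)"
proof
  show "range (chart_vector U \<phi> p) \<subseteq> T p"
    using U unfolding tangent_space_def chart_vector_def by blast
  show "T p \<subseteq> range (chart_vector U \<phi> p)"
  proof
    fix v assume "v \<in> T p"
    then obtain V \<psi> w where V: "(V, \<psi>) \<in> A" "p \<in> V" "v = chart_vector V \<psi> p w"
      unfolding tangent_space_def chart_vector_def by blast
    let ?t = "\<phi> \<circ> inv_into V \<psi>"
    have t: "(?t has_derivative frechet_derivative ?t (at (\<psi> p))) (at (\<psi> p))"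
      using smooth_on_has_derivative[OF chart_transition[OF V(1) U(1)]] U V by blast
    have "v f = chart_vector U \<phi> p (frechet_derivative ?t (at (\<psi> p)) w) f" for f
    proof (cases "f \<in> C")
      case True
      have op: "open (\<psi> ` (V \<inter> U))" using U V chart_open by (intro chart_open_image open_Int) auto
      have tp: "?t (\<psi> p) = \<phi> p" using V chart_inv by simp
      have "((\<lambda>y. (f \<circ> inv_into U \<phi>) (?t y)) has_derivative
          (\<lambda>w. chart_vector U \<phi> p (frechet_derivative ?t (at (\<psi> p)) w) f)) (at (\<psi> p))"
        by (rule has_derivative_compose[OF t]) (use chart_has_derivative[OF U True] tp in \<open>simp add: comp_def\<close>)
      then have "(f \<circ> inv_into V \<psi> has_derivative
          (\<lambda>w. chart_vector U \<phi> p (frechet_derivative ?t (at (\<psi> p)) w) f)) (at (\<psi> p))"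
        by (rule has_derivative_transform_within_open[OF _ op])
          (use U V in \<open>auto simp: chart_inv[OF V(1)] chart_inv[OF U(1)]\<close>)
      then show ?thesis using chart_has_derivative[OF V(1,2) True] has_derivative_unique V(3) by metis
    next
      case False
      then show ?thesis by (simp add: V(3) chart_vector_def)
    qed
    then show "v \<in> range (chart_vector U \<phi> p)" by blast
  qed
qed

lemma vector_fieldI:
  assumes "\<And>p. X p \<in> T p" "\<And>f. f \<in> C \<Longrightarrow> (\<lambda>p. X p f) \<in> C"
  shows "X \<in> VF"
  using assms by (simp add: vector_fields_def lie_derivative_def)

lemma vector_field_tangent: "X \<in> VF \<Longrightarrow> X p \<in> T p"
  by (simp add: vector_fields_def)

lemma vector_field_smooth: "X \<in> VF \<Longrightarrow> f \<in> C \<Longrightarrow> (\<lambda>p. X p f) \<in> C"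
  by (simp add: vector_fields_def lie_derivative_def)

text \<open>Functions and fields are global, since tangent vectors act on globally smooth functions
  only, but they behave as coordinates on \<open>N\<close> alone.\<close>

definition coordinate_frame :: "'m set \<Rightarrow> ('e \<Rightarrow> 'm \<Rightarrow> real) \<Rightarrow> ('e \<Rightarrow> 'm vfield) \<Rightarrow> bool" where
  "coordinate_frame N x V \<longleftrightarrow> open N \<and> (\<forall>e\<in>Bas. x e \<in> C \<and> V e \<in> VF) \<and>
     (\<forall>q\<in>N. \<forall>e\<in>Bas. \<forall>e'\<in>Bas. V e q (x e') = (if e = e' then 1 else 0)) \<and>
     (\<forall>q\<in>N. \<forall>v\<in>T q. \<forall>f. v f = (\<Sum>e\<in>Bas. v (x e) * V e q f)) \<and>
     (\<forall>q\<in>N. \<forall>f\<in>C. \<forall>e\<in>Bas. \<forall>e'\<in>Bas. V e q (\<lambda>p. V e' p f) = V e' q (\<lambda>p. V e p f))"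

lemma
  assumes "coordinate_frame N x V"
  shows coordinate_frame_open: "open N"
    and coordinate_frame_smooth: "e \<in> Bas \<Longrightarrow> x e \<in> C"
    and coordinate_frame_field: "e \<in> Bas \<Longrightarrow> V e \<in> VF"
    and coordinate_frame_delta: "q \<in> N \<Longrightarrow> e \<in> Bas \<Longrightarrow> e' \<in> Bas \<Longrightarrow> V e q (x e') = (if e = e' then 1 else 0)"
    and coordinate_frame_commute:
      "q \<in> N \<Longrightarrow> f \<in> C \<Longrightarrow> e \<in> Bas \<Longrightarrow> e' \<in> Bas \<Longrightarrow> V e q (\<lambda>p. V e' p f) = V e' q (\<lambda>p. V e p f)"
  using assms unfolding coordinate_frame_def by simp_all

lemma coordinate_frame_expand:
  assumes "coordinate_frame N x V" "q \<in> N" "v \<in> T q"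
  shows "v f = (\<Sum>e\<in>Bas. v (x e) * V e q f)"
proof -
  have "\<forall>q\<in>N. \<forall>v\<in>T q. \<forall>f. v f = (\<Sum>e\<in>Bas. v (x e) * V e q f)"
    using assms(1) unfolding coordinate_frame_def by (elim conjE) assumption
  from this[THEN bspec, OF assms(2), THEN bspec, OF assms(3), THEN spec] show ?thesis .
qed

text \<open>The chart coordinates and the constant fields of the chart become global when multiplied
  by a bump that is 1 on the chart ball of radius r/2. The last conclusion keeps the link with the
  chart, which is needed to lift vectors to a product.\<close>

lemma chart_frame:
  assumes U: "(U, \<phi>) \<in> A" "p \<in> U"
  obtains N x V where "p \<in> N" "N \<subseteq> U" "coordinate_frame N x V"
    "\<forall>q\<in>N. \<forall>w e. chart_vector U \<phi> q w (x e) = w \<bullet> e"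
proof -
  obtain r h where h: "r > 0" "cball (\<phi> p) r \<subseteq> \<phi> ` (U \<inter> UNIV)" "smooth_on UNIV h"
    "\<And>y. dist (\<phi> p) y \<le> r / 2 \<Longrightarrow> h y = 1" "\<And>y. dist (\<phi> p) y \<ge> r \<Longrightarrow> h y = (0::real)"
    using chart_bump[OF U open_UNIV UNIV_I] by metis
  define N where "N = U \<inter> \<phi> -` ball (\<phi> p) (r/2)"
  have N: "open N" "p \<in> N" using chart_ball_nhd[OF U, of "r/2"] h(1) by (simp_all add: N_def)
  define x where "x e q = (if q \<in> U then h (\<phi> q) * (\<phi> q \<bullet> e) else 0)" for e q
  define V where "V e q = (if q \<in> U then chart_vector U \<phi> q (h (\<phi> q) *\<^sub>R e) else (\<lambda>f. 0))" for e q
  let ?S = "\<phi> ` U" and ?i = "inv_into U \<phi>"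
  have ext: "(\<lambda>q. if q \<in> U then h (\<phi> q) * G (\<phi> q) else 0) \<in> C" if "smooth_on ?S G" for G
    by (rule smooth_functions_chart_extension[OF U(1) _ compact_cball_orthonormal[OF orthonormal_Bas, of "\<phi> p" r]])
      (use h that in \<open>auto intro!: smooth_on_mult chart_open_range[OF U(1)] intro: smooth_on_subset\<close>)
  have xC: "x e \<in> C" for e
    unfolding x_def[abs_def]
    by (rule ext) (intro smooth_on_bounded_linear chart_open_range[OF U(1)] bounded_linear_inner_left)
  have VT: "V e q \<in> T q" for e q
  proof (cases "q \<in> U")
    case True
    then show ?thesis using tangent_space_chart[OF U(1)] by (simp add: V_def)
  next
    case False
    obtain U' \<phi>' where U': "(U', \<phi>') \<in> A" "q \<in> U'" by (rule chart_at)
    have "V e q = chart_vector U' \<phi>' q 0"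
      using False linear_0[OF chart_vector_linear[OF U']] by (auto simp: V_def)
    then show ?thesis using tangent_space_chart[OF U'] by simp
  qed
  have Vf: "V e q f = (if q \<in> U then h (\<phi> q) * frechet_derivative (f \<circ> ?i) (at (\<phi> q)) e else 0)"
    if "f \<in> C" for e q f
    using linear_scale[OF chart_vector_linear[OF U(1)], of q] that
    by (simp add: V_def) (simp add: chart_vector_def)
  have VX: "V e \<in> VF" for e
  proof (rule vector_fieldI[OF VT])
    fix f assume f: "f \<in> C"
    show "(\<lambda>q. V e q f) \<in> C" unfolding Vf[OF f]
      by (rule ext) (rule smooth_on_frechet_derivative[OF smooth_on_chart[OF f U(1)]])
  qed
  have NN: "q \<in> U" "h (\<phi> q) = 1" if "q \<in> N" for q
    using that h(4) by (auto simp: N_def)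
  have imN: "open (\<phi> ` N)" using N by (intro chart_open_image[OF U(1)]) (auto simp: N_def)
  have vx: "chart_vector U \<phi> q w (x e) = w \<bullet> e" if q: "q \<in> N" for q w e
  proof -
    have "((\<lambda>y. y \<bullet> e) has_derivative (\<lambda>w. w \<bullet> e)) (at (\<phi> q))"
      by (auto intro!: derivative_eq_intros)
    then have "(x e \<circ> ?i has_derivative (\<lambda>w. w \<bullet> e)) (at (\<phi> q))"
      by (rule has_derivative_transform_within_open[OF _ imN])
        (use q NN in \<open>auto simp: x_def chart_inv[OF U(1)]\<close>)
    then show ?thesis
      using chart_has_derivative[OF U(1) NN(1)[OF q] xC] has_derivative_unique by metis
  qed
  have Vq: "V e q = chart_vector U \<phi> q e" if "q \<in> N" for e q
    using NN[OF that] by (simp add: V_def)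
  have on: "e \<bullet> e' = (if e = e' then 1 else 0)" if "e \<in> Bas" "e' \<in> Bas" for e e'
    using orthonormal_Bas that by (simp add: orthonormal_basis_def)
  have exp: "v f = (\<Sum>e\<in>Bas. v (x e) * V e q f)" if q: "q \<in> N" and v: "v \<in> T q" for q v f
  proof -
    obtain w where w: "v = chart_vector U \<phi> q w"
      using v tangent_space_chart[OF U(1) NN(1)[OF q]] by auto
    note l = chart_vector_linear[OF U(1) NN(1)[OF q], of f]
    have "v f = chart_vector U \<phi> q (\<Sum>e\<in>Bas. (w \<bullet> e) *\<^sub>R e) f"
      using orthonormal_Bas by (simp add: w orthonormal_basis_def)
    also have "\<dots> = (\<Sum>e\<in>Bas. (w \<bullet> e) * chart_vector U \<phi> q e f)"
      by (simp add: linear_sum[OF l] linear_scale[OF l])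
    finally show ?thesis by (simp add: w vx[OF q] Vq[OF q])
  qed
  \<comment> \<open>Near a point of \<open>N\<close> the bump is 1, so the iterated derivative is an
    ordinary second derivative in the chart, whose symmetry gives the commutation of the frame
    fields.\<close>
  have VV: "V e q (\<lambda>p. V e' p f) =
      frechet_derivative (\<lambda>y. frechet_derivative (f \<circ> ?i) (at y) e') (at (\<phi> q)) e"
    if q: "q \<in> N" and f: "f \<in> C" for q f e e'
  proof -
    let ?D = "\<lambda>y. frechet_derivative (f \<circ> ?i) (at y) e'"
    have "(?D has_derivative frechet_derivative ?D (at (\<phi> q))) (at (\<phi> q))"
      by (rule smooth_on_has_derivative[OF smooth_on_frechet_derivative[OF smooth_on_chart[OF f U(1)]]])
        (use NN q in auto)
    then have "((\<lambda>p. V e' p f) \<circ> ?i has_derivative frechet_derivative ?D (at (\<phi> q))) (at (\<phi> q))"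
      by (rule has_derivative_transform_within_open[OF _ imN])
        (use q NN in \<open>auto simp: Vf[OF f] chart_inv[OF U(1)]\<close>)
    then show ?thesis
      using chart_has_derivative[OF U(1) NN(1)[OF q] vector_field_smooth[OF VX f]] has_derivative_unique
        Vq[OF q] by metis
  qed
  have "V e q (\<lambda>p. V e' p f) = V e' q (\<lambda>p. V e p f)" if "q \<in> N" "f \<in> C" for q f e e'
    unfolding VV[OF that]
    by (rule smooth_on_second_derivative_symmetric[OF smooth_on_chart[OF that(2) U(1)] chart_open_range[OF U(1)]])
      (use NN that in auto)
  then have "coordinate_frame N x V"
    unfolding coordinate_frame_def using N xC VX Vq vx on exp by auto
  moreover have "N \<subseteq> U" by (simp add: N_def)
  moreover have "\<forall>q\<in>N. \<forall>w e. chart_vector U \<phi> q w (x e) = w \<bullet> e" using vx by simp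
  ultimately show ?thesis by (intro that[OF N(2)])
qed

lemma coordinate_frame_exists: obtains N x V where "p \<in> N" "coordinate_frame N x V"
proof -
  obtain U \<phi> where U: "(U, \<phi>) \<in> A" "p \<in> U" by (rule chart_at)
  obtain N x V where "p \<in> N" "N \<subseteq> U" "coordinate_frame N x V"
    "\<forall>q\<in>N. \<forall>w e. chart_vector U \<phi> q w (x e) = w \<bullet> e" by (rule chart_frame[OF U])
  then show ?thesis by (intro that[of N x V])
qed

subsection \<open>Tangent vectors and vector fields\<close>

lemma tangent_chartE:
  assumes "v \<in> T p"
  obtains U \<phi> w where "(U, \<phi>) \<in> A" "p \<in> U" "v = chart_vector U \<phi> p w"
proof -
  obtain U \<phi> where U: "(U, \<phi>) \<in> A" "p \<in> U" by (rule chart_at)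
  then show ?thesis using that assms tangent_space_chart[OF U] by auto
qed

lemma tangent_nonsmooth: "v \<in> T p \<Longrightarrow> f \<notin> C \<Longrightarrow> v f = 0"
  by (auto simp: tangent_space_def)

lemma tangent_lincomb:
  assumes "u \<in> T p" "v \<in> T p" shows "(\<lambda>f. a * u f + b * v f) \<in> T p"
proof -
  obtain U \<phi> where U: "(U, \<phi>) \<in> A" "p \<in> U" by (rule chart_at)
  obtain w w' where w: "u = chart_vector U \<phi> p w" "v = chart_vector U \<phi> p w'"
    using assms tangent_space_chart[OF U] by auto
  have "(\<lambda>f. a * u f + b * v f) = chart_vector U \<phi> p (a *\<^sub>R w + b *\<^sub>R w')"
    using linear_add[OF chart_vector_linear[OF U]] linear_scale[OF chart_vector_linear[OF U]]
    by (auto simp: w)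
  then show ?thesis using tangent_space_chart[OF U] by blast
qed

lemma tangent_zero: "(\<lambda>f. 0) \<in> T p"
proof -
  obtain U \<phi> where "(U, \<phi>) \<in> A" "p \<in> U" by (rule chart_at)
  then obtain v where "v \<in> T p" using tangent_space_chart by blast
  then show ?thesis using tangent_lincomb[of v p v 0 0] by simp
qed

lemma tangent_add: "u \<in> T p \<Longrightarrow> v \<in> T p \<Longrightarrow> (\<lambda>f. u f + v f) \<in> T p"
  using tangent_lincomb[of u p v 1 1] by simp

lemma tangent_scale: "v \<in> T p \<Longrightarrow> (\<lambda>f. c * v f) \<in> T p"
  using tangent_lincomb[of v p v c 0] by simp

lemma tangent_sum: "(\<And>i. i \<in> I \<Longrightarrow> v i \<in> T p) \<Longrightarrow> (\<lambda>f. \<Sum>i\<in>I. c i * v i f) \<in> T p"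
proof (induction I rule: infinite_finite_induct)
  case (insert i I)
  have "(\<lambda>f. c i * v i f + (\<Sum>i\<in>I. c i * v i f)) \<in> T p"
    using insert by (intro tangent_add tangent_scale) auto
  then show ?case using insert by simp
qed (simp_all add: tangent_zero)

lemma tangent_has_derivative:
  assumes "v \<in> T p"
  obtains U \<phi> D w where "(U, \<phi>) \<in> A" "p \<in> U"
    "\<And>f. f \<in> C \<Longrightarrow> (f \<circ> inv_into U \<phi> has_derivative D f) (at (\<phi> p))"
    "\<And>f. f \<in> C \<Longrightarrow> v f = D f w"
proof -
  obtain U \<phi> w where U: "(U, \<phi>) \<in> A" "p \<in> U" "v = chart_vector U \<phi> p w"
    using tangent_chartE[OF assms] by blast
  show ?thesis
    by (rule that[OF U(1,2) chart_has_derivative[OF U(1,2)]]) (simp_all add: U(3))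
qed

text \<open>A derivative depends on the germ only. Both functions have to be smooth: on any other
  function a tangent vector is 0 by convention, whatever its germ.\<close>

lemma tangent_local:
  assumes v: "v \<in> T p" and N: "open N" "p \<in> N" "\<And>q. q \<in> N \<Longrightarrow> f q = g q" and C: "f \<in> C" "g \<in> C"
  shows "v f = v g"
proof -
  obtain U \<phi> D w where U: "(U, \<phi>) \<in> A" "p \<in> U"
    "\<And>f. f \<in> C \<Longrightarrow> (f \<circ> inv_into U \<phi> has_derivative D f) (at (\<phi> p))" "\<And>f. f \<in> C \<Longrightarrow> v f = D f w"
    using tangent_has_derivative[OF v] by blast
  have op: "open (\<phi> ` (U \<inter> N))" using U N chart_open by (intro chart_open_image open_Int) auto
  have "(g \<circ> inv_into U \<phi> has_derivative D f) (at (\<phi> p))"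
    by (rule has_derivative_transform_within_open[OF U(3)[OF C(1)] op])
      (use U N in \<open>auto simp: chart_inv[OF U(1)]\<close>)
  then show ?thesis using U(3,4) C has_derivative_unique by metis
qed

lemma
  assumes v: "v \<in> T p" and C: "f \<in> C" "g \<in> C"
  shows tangent_add_fun: "v (\<lambda>q. f q + g q) = v f + v g"
    and tangent_mult_fun: "v (\<lambda>q. f q * g q) = f p * v g + v f * g p"
proof -
  obtain U \<phi> D w where U: "(U, \<phi>) \<in> A" "p \<in> U"
    "\<And>f. f \<in> C \<Longrightarrow> (f \<circ> inv_into U \<phi> has_derivative D f) (at (\<phi> p))" "\<And>f. f \<in> C \<Longrightarrow> v f = D f w"
    using tangent_has_derivative[OF v] by blast
  have "((\<lambda>q. f q + g q) \<circ> inv_into U \<phi> has_derivative (\<lambda>w. D f w + D g w)) (at (\<phi> p))"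
    using has_derivative_add[OF U(3)[OF C(1)] U(3)[OF C(2)]] by (simp add: comp_def)
  from fun_cong[OF has_derivative_unique[OF U(3)[OF smooth_add[OF C]] this], of w]
  show "v (\<lambda>q. f q + g q) = v f + v g"
    by (simp add: U(4) C smooth_add[OF C])
  have "((\<lambda>q. f q * g q) \<circ> inv_into U \<phi> has_derivative (\<lambda>w. f p * D g w + D f w * g p)) (at (\<phi> p))"
    using has_derivative_mult[OF U(3)[OF C(1)] U(3)[OF C(2)]] chart_inv[OF U(1,2)] by (simp add: comp_def)
  from fun_cong[OF has_derivative_unique[OF U(3)[OF smooth_mult[OF C]] this], of w]
  show "v (\<lambda>q. f q * g q) = f p * v g + v f * g p"
    by (simp add: U(4) C smooth_mult[OF C])
qed

lemma tangent_const_fun: "v \<in> T p \<Longrightarrow> v (\<lambda>q. c) = 0"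
proof -
  assume v: "v \<in> T p"
  obtain U \<phi> D w where U: "(U, \<phi>) \<in> A" "p \<in> U"
    "\<And>f. f \<in> C \<Longrightarrow> (f \<circ> inv_into U \<phi> has_derivative D f) (at (\<phi> p))" "\<And>f. f \<in> C \<Longrightarrow> v f = D f w"
    using tangent_has_derivative[OF v] by blast
  have "((\<lambda>q. c) \<circ> inv_into U \<phi> has_derivative (\<lambda>w. 0)) (at (\<phi> p))"
    by (simp add: comp_def)
  then have "D (\<lambda>q. c) = (\<lambda>w. 0)" by (rule has_derivative_unique[OF U(3)[OF smooth_const]])
  then show ?thesis using U(4)[OF smooth_const] by simp
qed

lemma tangent_scale_fun: "v \<in> T p \<Longrightarrow> f \<in> C \<Longrightarrow> v (\<lambda>q. c * f q) = c * v f"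
  using tangent_mult_fun[OF _ smooth_const, of v p f c] tangent_const_fun by simp

lemma tangent_minus_fun: "v \<in> T p \<Longrightarrow> f \<in> C \<Longrightarrow> v (\<lambda>q. - f q) = - v f"
  using tangent_scale_fun[of v p f "-1"] by simp

lemma tangent_diff_fun: "v \<in> T p \<Longrightarrow> f \<in> C \<Longrightarrow> g \<in> C \<Longrightarrow> v (\<lambda>q. f q - g q) = v f - v g"
  using tangent_add_fun[of v p f "\<lambda>q. - g q"] by (simp add: smooth_minus tangent_minus_fun)

lemma tangent_sum_fun:
  "v \<in> T p \<Longrightarrow> (\<And>i. i \<in> I \<Longrightarrow> f i \<in> C) \<Longrightarrow> v (\<lambda>q. \<Sum>i\<in>I. f i q) = (\<Sum>i\<in>I. v (f i))"
proof (induction I rule: infinite_finite_induct)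
  case (insert i I)
  then show ?case using tangent_add_fun[of v p "f i" "\<lambda>q. \<Sum>i\<in>I. f i q"] by (simp add: smooth_sum)
qed (simp_all add: tangent_const_fun)

lemma tangent_power2_fun: "v \<in> T p \<Longrightarrow> f \<in> C \<Longrightarrow> v (\<lambda>q. (f q)\<^sup>2) = 2 * f p * v f"
  using tangent_mult_fun[of v p f f] by (simp add: power2_eq_square)

lemma field_add: "X \<in> VF \<Longrightarrow> Y \<in> VF \<Longrightarrow> (\<lambda>p f. X p f + Y p f) \<in> VF"
  using tangent_add[OF vector_field_tangent[of X] vector_field_tangent[of Y]]
    smooth_add[OF vector_field_smooth[of X] vector_field_smooth[of Y]] by (intro vector_fieldI) simp_all

lemma field_mult: "X \<in> VF \<Longrightarrow> h \<in> C \<Longrightarrow> (\<lambda>p f. h p * X p f) \<in> VF"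
  using tangent_scale[OF vector_field_tangent[of X]] smooth_mult[OF _ vector_field_smooth[of X]]
  by (intro vector_fieldI) simp_all

lemma field_zero: "(\<lambda>p f. 0) \<in> VF"
  by (rule vector_fieldI) (simp_all add: tangent_zero smooth_const)

lemma field_sum:
  "(\<And>i. i \<in> I \<Longrightarrow> X i \<in> VF) \<Longrightarrow> (\<And>i. i \<in> I \<Longrightarrow> h i \<in> C) \<Longrightarrow> (\<lambda>p f. \<Sum>i\<in>I. h i p * X i p f) \<in> VF"
proof (rule vector_fieldI)
  assume X: "\<And>i. i \<in> I \<Longrightarrow> X i \<in> VF" and h: "\<And>i. i \<in> I \<Longrightarrow> h i \<in> C"
  show "(\<lambda>f. \<Sum>i\<in>I. h i p * X i p f) \<in> T p" for p
    using tangent_sum[OF vector_field_tangent[OF X], of I] by simp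
  show "(\<lambda>p. \<Sum>i\<in>I. h i p * X i p f) \<in> C" if "f \<in> C" for f
    by (rule smooth_sum) (rule smooth_mult[OF h vector_field_smooth[OF X that]])
qed

text \<open>A combination of frame fields with constant coefficients is already a global
  field.\<close>

lemma field_through:
  assumes "v \<in> T p" obtains X where "X \<in> VF" "X p = v"
proof -
  obtain N x V where "p \<in> N" and c: "coordinate_frame N x V" by (rule coordinate_frame_exists)
  let ?X = "\<lambda>q f. \<Sum>e\<in>Bas. v (x e) * V e q f"
  have "?X \<in> VF" by (rule field_sum) (simp_all add: coordinate_frame_field[OF c] smooth_const)
  moreover have "?X p = v" by (rule ext) (rule coordinate_frame_expand[OF c \<open>p \<in> N\<close> assms, symmetric])
  ultimately show ?thesis by (rule that)
qed

lemma lie_derivative_smooth: "X \<in> VF \<Longrightarrow> f \<in> C \<Longrightarrow> lie_derivative X f \<in> C"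
  by (simp add: vector_fields_def)

lemma lie_bracket_smooth: "X \<in> VF \<Longrightarrow> Y \<in> VF \<Longrightarrow> f \<in> C \<Longrightarrow> (\<lambda>p. lie_bracket X Y p f) \<in> C"
  using smooth_diff[OF vector_field_smooth[of X "lie_derivative Y f"] vector_field_smooth[of Y "lie_derivative X f"]]
  by (simp add: lie_bracket_def lie_derivative_smooth)

text \<open>In a frame the operator XY has a first-order part and a second-order part, and the
  latter is symmetric in X and Y because coordinate fields commute. It cancels in the bracket, which
  is therefore a combination of frame vectors.\<close>

lemma lie_bracket_tangent:
  assumes "X \<in> VF" "Y \<in> VF" shows "lie_bracket X Y p \<in> T p"
proof -
  obtain N x V where N: "p \<in> N" and c: "coordinate_frame N x V" by (rule coordinate_frame_exists)
  note x = coordinate_frame_smooth[OF c] coordinate_frame_field[OF c]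
  note op = coordinate_frame_open[OF c] and exp = coordinate_frame_expand[OF c]
  have XY: "X p (lie_derivative Y f) = (\<Sum>e\<in>Bas. X p (lie_derivative Y (x e)) * V e p f)
      + (\<Sum>e\<in>Bas. \<Sum>e'\<in>Bas. Y p (x e) * X p (x e') * V e' p (\<lambda>q. V e q f))"
    if XY: "X \<in> VF" "Y \<in> VF" and f: "f \<in> C" for X Y f
  proof -
    have s: "(\<lambda>q. Y q (x e)) \<in> C" "(\<lambda>q. V e q f) \<in> C" if "e \<in> Bas" for e
      by (rule vector_field_smooth[OF XY(2) x(1)[OF that]], rule vector_field_smooth[OF x(2)[OF that] f])
    note Xp = vector_field_tangent[OF XY(1), of p]
    have "X p (lie_derivative Y f) = X p (\<lambda>q. \<Sum>e\<in>Bas. Y q (x e) * V e q f)"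
    proof (rule tangent_local[OF Xp op N])
      show "lie_derivative Y f q = (\<Sum>e\<in>Bas. Y q (x e) * V e q f)" if "q \<in> N" for q
        unfolding lie_derivative_def by (rule exp[OF that vector_field_tangent[OF XY(2)]])
    qed (use XY f s in \<open>simp_all add: lie_derivative_smooth smooth_sum smooth_mult\<close>)
    also have "\<dots> = (\<Sum>e\<in>Bas. X p (\<lambda>q. Y q (x e) * V e q f))"
      by (rule tangent_sum_fun[OF Xp smooth_mult[OF s]])
    also have "\<dots> = (\<Sum>e\<in>Bas. Y p (x e) * X p (\<lambda>q. V e q f) + X p (\<lambda>q. Y q (x e)) * V e p f)"
      by (rule sum.cong[OF refl]) (rule tangent_mult_fun[OF Xp s])
    also have "\<dots> = (\<Sum>e\<in>Bas. Y p (x e) * (\<Sum>e'\<in>Bas. X p (x e') * V e' p (\<lambda>q. V e q f)))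
        + (\<Sum>e\<in>Bas. X p (\<lambda>q. Y q (x e)) * V e p f)"
      unfolding sum.distrib
      by (rule arg_cong2[where f = "(+)", OF sum.cong[OF refl arg_cong[OF exp[OF N Xp]]] refl])
    finally show ?thesis by (simp add: lie_derivative_def sum_distrib_left mult.assoc)
  qed
  have "lie_bracket X Y p f = (\<Sum>e\<in>Bas. lie_bracket X Y p (x e) * V e p f)" for f
  proof (cases "f \<in> C")
    case True
    have "(\<Sum>e\<in>Bas. \<Sum>e'\<in>Bas. X p (x e) * Y p (x e') * V e' p (\<lambda>q. V e q f)) =
        (\<Sum>e'\<in>Bas. \<Sum>e\<in>Bas. X p (x e) * Y p (x e') * V e' p (\<lambda>q. V e q f))"
      by (rule sum.swap)
    also have "\<dots> = (\<Sum>e\<in>Bas. \<Sum>e'\<in>Bas. Y p (x e) * X p (x e') * V e' p (\<lambda>q. V e q f))"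
      by (intro sum.cong refl) (simp add: coordinate_frame_commute[OF c N True])
    finally show ?thesis
      using XY[OF assms True] XY[OF assms(2,1) True]
      by (simp add: lie_bracket_def sum_subtractf[symmetric] left_diff_distrib)
  next
    \<comment> \<open>The bracket is defined for every function, so its vanishing on a non-smooth
      one has to be checked: both inner derivatives are identically 0 there, and a tangent vector
      kills constants.\<close>
    case False
    have "lie_derivative X f = (\<lambda>p. 0)" "lie_derivative Y f = (\<lambda>p. 0)"
      using tangent_nonsmooth[OF vector_field_tangent False] assms by (auto simp: lie_derivative_def)
    then have "lie_bracket X Y p f = 0"
      by (simp add: lie_bracket_def tangent_const_fun[OF vector_field_tangent[OF assms(1)]]
          tangent_const_fun[OF vector_field_tangent[OF assms(2)]])
    moreover have "V e p f = 0" if "e \<in> Bas" for e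
      by (rule tangent_nonsmooth[OF vector_field_tangent[OF x(2)[OF that]] False])
    ultimately show ?thesis by simp
  qed
  then have "lie_bracket X Y p = (\<lambda>f. \<Sum>e\<in>Bas. lie_bracket X Y p (x e) * V e p f)" by (rule ext)
  also have "\<dots> \<in> T p" by (rule tangent_sum[OF vector_field_tangent[OF x(2)]])
  finally show ?thesis .
qed

lemma lie_bracket_field: "X \<in> VF \<Longrightarrow> Y \<in> VF \<Longrightarrow> lie_bracket X Y \<in> VF"
  by (rule vector_fieldI) (simp_all add: lie_bracket_tangent lie_bracket_smooth)

end

section \<open>Dimensions of function spaces and of tangent spaces\<close>

lemma orthonormal_basis_independent:
  assumes "orthonormal_basis B" shows "independent B"
proof (rule pairwise_orthogonal_independent)
  show "pairwise orthogonal B" using assms by (simp add: orthonormal_basis_def pairwise_def orthogonal_def)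
  show "0 \<notin> B" using assms unfolding orthonormal_basis_def by (metis inner_zero_left zero_neq_one)
qed

lemma orthonormal_basis_span:
  assumes "orthonormal_basis B" shows "x \<in> span B"
proof -
  have "(\<Sum>e\<in>B. (x \<bullet> e) *\<^sub>R e) \<in> span B" by (intro span_sum span_scale span_base)
  then show ?thesis using assms by (simp add: orthonormal_basis_def)
qed

text \<open>\<open>metric_rank\<close> is a dimension in a space of functions on tangent vectors
  with its own scalar multiplication. A linear injection carries an orthonormal basis of its source
  to a basis of its range in that space.\<close>

lemma dim_range_injective:
  fixes M :: "'d::real_inner \<Rightarrow> ('t \<Rightarrow> real)"
  assumes B: "orthonormal_basis (B :: 'd set)" and "inj M"
    and lin: "\<And>a b w w' v. M (a *\<^sub>R w + b *\<^sub>R w') v = a * M w v + b * M w' v"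
  shows "vector_space.dim (\<lambda>(c::real) \<alpha> v. c * \<alpha> v) (range M) = card B"
proof -
  interpret vs: vector_space "\<lambda>(c::real) (\<alpha>::'t \<Rightarrow> real) v. c * \<alpha> v"
    by unfold_locales (auto simp: algebra_simps fun_eq_iff)
  interpret lin: Vector_Spaces.linear scaleR "\<lambda>(c::real) (\<alpha>::'t \<Rightarrow> real) v. c * \<alpha> v" M
  proof unfold_locales
    show "M (w + w') = M w + M w'" for w w' using lin[of 1 w 1 w'] by (auto simp: fun_eq_iff)
    show "M (c *\<^sub>R w) = (\<lambda>v. c * M w v)" for c w using lin[of c w 0 w] by (auto simp: fun_eq_iff)
  qed
  have ind: "vs.independent (M ` B)"
    using lin.independent_inj_image[OF _ \<open>inj M\<close>] orthonormal_basis_independent[OF B]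
    by (simp add: dependent_raw_def)
  from orthonormal_basis_span[OF B] have "range M \<subseteq> vs.span (M ` B)" unfolding lin.span_image span_raw_def by auto
  then show ?thesis
    using vs.dim_unique[OF _ _ ind, of "range M"] card_image[OF inj_on_subset[OF \<open>inj M\<close>]] by auto
qed

context manifold
begin

text \<open>Moves dimension counts to the model space. Linearity is spelled out at each argument
  because the values of \<open>L\<close> are operators, compared function by function.\<close>

lemma tangent_parametrization:
  obtains L :: "'e \<Rightarrow> 'm tangent" where
    "\<forall>a b w w' f. L (a *\<^sub>R w + b *\<^sub>R w') f = a * L w f + b * L w' f" "inj L" "range L = T p"
proof -
  obtain N x V where N: "p \<in> N" and c: "coordinate_frame N x V" by (rule coordinate_frame_exists)
  let ?L = "\<lambda>w f. \<Sum>e\<in>Bas. (w \<bullet> e) * V e p f"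
  have 1: "\<forall>a b w w' f. ?L (a *\<^sub>R w + b *\<^sub>R w') f = a * ?L w f + b * ?L w' f"
    by (simp add: inner_add_left distrib_right sum.distrib sum_distrib_left mult.assoc)
  have 3: "?L w (x e) = w \<bullet> e" if "e \<in> Bas" for w e
  proof -
    have "?L w (x e) = (\<Sum>e'\<in>Bas. if e = e' then w \<bullet> e else 0)"
      using coordinate_frame_delta[OF c N _ that] by (intro sum.cong) auto
    then show ?thesis using finite_Bas that by simp
  qed
  have 2: "inj ?L"
  proof (rule injI)
    fix w w' assume "?L w = ?L w'"
    then have "?L w (x e) = ?L w' (x e)" for e by (rule fun_cong)
    then have "w \<bullet> e = w' \<bullet> e" if "e \<in> Bas" for e
      by (rule trans[OF 3[OF that, symmetric] trans[OF _ 3[OF that]]])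
    then have "(\<Sum>e\<in>Bas. (w \<bullet> e) *\<^sub>R e) = (\<Sum>e\<in>Bas. (w' \<bullet> e) *\<^sub>R e)" by simp
    then show "w = w'" using orthonormal_Bas by (simp add: orthonormal_basis_def)
  qed
  have "?L w \<in> T p" for w
    by (rule tangent_sum[OF vector_field_tangent[OF coordinate_frame_field[OF c]]])
  moreover have "v \<in> range ?L" if v: "v \<in> T p" for v
  proof
    show "v = ?L (\<Sum>e\<in>Bas. v (x e) *\<^sub>R e)"
    proof
      fix f
      have "(\<Sum>e'\<in>Bas. v (x e') *\<^sub>R e') \<bullet> e = v (x e)" if e: "e \<in> Bas" for e
      proof -
        have "(\<Sum>e'\<in>Bas. v (x e') *\<^sub>R e') \<bullet> e = (\<Sum>e'\<in>Bas. if e = e' then v (x e) else 0)"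
          using orthonormal_Bas e unfolding inner_sum_left orthonormal_basis_def by (intro sum.cong) auto
        then show ?thesis using finite_Bas e by simp
      qed
      then have "?L (\<Sum>e\<in>Bas. v (x e) *\<^sub>R e) f = (\<Sum>e\<in>Bas. v (x e) * V e p f)"
        by (intro sum.cong) auto
      then show "v f = ?L (\<Sum>e\<in>Bas. v (x e) *\<^sub>R e) f"
        using coordinate_frame_expand[OF c N v, of f] by (rule trans[OF _ sym, rotated])
    qed
  qed simp
  ultimately have "range ?L = T p" by blast
  from that[OF 1 2 this] show ?thesis .
qed

text \<open>Where the bump \<open>k0\<close> does not vanish, h has the sign of h(p). Hence k0^2 h +
  (1 - k0)^2 h(p) has that sign everywhere and has a globally smooth reciprocal, while it equals h
  wherever k0 = 1.\<close>

lemma smooth_reciprocal: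
  assumes h: "h \<in> C" "h p \<noteq> 0"
  obtains N k where "open N" "p \<in> N" "k \<in> C" "\<forall>q\<in>N. h q \<noteq> 0" "\<forall>q\<in>N. k q = inverse (h q)"
proof -
  let ?W = "{q. h q * h p > 0}"
  have "open ?W"
    by (intro open_Collect_less continuous_intros smooth_functions_continuous h)
  moreover have "p \<in> ?W" using h(2) by (auto simp: zero_less_mult_iff linorder_neq_iff)
  ultimately obtain k0 N where k: "k0 \<in> C" "open N" "p \<in> N" "\<forall>q\<in>N. k0 q = 1" "\<forall>q. q \<notin> ?W \<longrightarrow> k0 q = 0"
    by (rule bump_function)
  define d where "d q = (k0 q)\<^sup>2 * h q + (1 - k0 q)\<^sup>2 * h p" for q
  have dC: "d \<in> C" unfolding d_def[abs_def] by (intro smooth_intros k h)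
  have "d q * h p > 0" for q
  proof (cases "k0 q = 0")
    case True
    then show ?thesis using h(2) by (auto simp: d_def zero_less_mult_iff linorder_neq_iff)
  next
    case False
    then have "h q * h p > 0" using k(5) by blast
    then have "(k0 q)\<^sup>2 * (h q * h p) > 0" using False by simp
    then have "0 < (k0 q)\<^sup>2 * (h q * h p) + (1 - k0 q)\<^sup>2 * (h p * h p)"
      by (rule add_pos_nonneg) simp
    then show ?thesis unfolding d_def by (simp add: distrib_right mult.assoc)
  qed
  then have d0: "d q \<noteq> 0" for q by (metis less_irrefl mult_zero_left)
  have "smooth_on (\<phi> ` U) (\<lambda>y. inverse ((d \<circ> inv_into U \<phi>) y))" if "(U, \<phi>) \<in> A" for U \<phi>
    by (rule smooth_on_inverse[OF chart_open_range[OF that] smooth_on_chart[OF dC that]]) (simp add: d0)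
  then have "(\<lambda>q. inverse (d q)) \<in> C"
    by (auto simp: smooth_functions_def comp_def)
  moreover have "open (N \<inter> ?W)" using k(2) \<open>open ?W\<close> by (rule open_Int)
  moreover have "p \<in> N \<inter> ?W" using k(3) \<open>p \<in> ?W\<close> by (rule IntI)
  moreover have "\<forall>q\<in>N \<inter> ?W. h q \<noteq> 0" by auto
  moreover have "\<forall>q\<in>N \<inter> ?W. inverse (d q) = inverse (h q)" using k(4) by (simp add: d_def)
  ultimately show ?thesis by (intro that[of "N \<inter> ?W" "\<lambda>q. inverse (d q)"])
qed

lemma lie_bracket_nonsmooth: "X \<in> VF \<Longrightarrow> Y \<in> VF \<Longrightarrow> f \<notin> C \<Longrightarrow> lie_bracket X Y p f = 0"
  by (rule tangent_nonsmooth[OF lie_bracket_tangent])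

lemma lie_bracket_add_right:
  assumes "X \<in> VF" "Y \<in> VF" "Z \<in> VF"
  shows "lie_bracket X (\<lambda>p f. Y p f + Z p f) = (\<lambda>p f. lie_bracket X Y p f + lie_bracket X Z p f)"
proof (intro ext)
  fix p f
  show "lie_bracket X (\<lambda>p f. Y p f + Z p f) p f = lie_bracket X Y p f + lie_bracket X Z p f"
  proof (cases "f \<in> C")
    case True
    then have C: "(\<lambda>q. Y q f) \<in> C" "(\<lambda>q. Z q f) \<in> C" using assms vector_field_smooth by auto
    show ?thesis
      using tangent_add_fun[OF vector_field_tangent[OF assms(1)] C]
      by (simp add: lie_bracket_def lie_derivative_def)
  next
    case False
    then show ?thesis
      using lie_bracket_nonsmooth[OF assms(1) field_add[OF assms(2,3)]] lie_bracket_nonsmooth assms by simp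
  qed
qed

lemma lie_bracket_mult_right:
  assumes "X \<in> VF" "Y \<in> VF" "h \<in> C"
  shows "lie_bracket X (\<lambda>p f. h p * Y p f) = (\<lambda>p f. h p * lie_bracket X Y p f + X p h * Y p f)"
proof (intro ext)
  fix p f
  show "lie_bracket X (\<lambda>p f. h p * Y p f) p f = h p * lie_bracket X Y p f + X p h * Y p f"
  proof (cases "f \<in> C")
    case True
    then have C: "(\<lambda>q. Y q f) \<in> C" using assms vector_field_smooth by auto
    show ?thesis
      using tangent_mult_fun[OF vector_field_tangent[OF assms(1)] assms(3) C]
      by (simp add: lie_bracket_def lie_derivative_def algebra_simps)
  next
    case False
    then show ?thesis
      using lie_bracket_nonsmooth[OF assms(1) field_mult[OF assms(2,3)]] lie_bracket_nonsmooth[OF assms(1,2)]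
        tangent_nonsmooth[OF vector_field_tangent[OF assms(2)]] by simp
  qed
qed

lemma lie_bracket_antisym: "lie_bracket Y X = (\<lambda>p f. - lie_bracket X Y p f)"
  by (simp add: lie_bracket_def fun_eq_iff)

subsection \<open>One-forms\<close>

definition smooth_form :: "'m form \<Rightarrow> bool" where
  "smooth_form \<omega> \<longleftrightarrow> (\<forall>X\<in>VF. \<omega> X \<in> C) \<and>
     (\<forall>X\<in>VF. \<forall>Y\<in>VF. \<forall>p. \<omega> (\<lambda>p f. X p f + Y p f) p = \<omega> X p + \<omega> Y p) \<and>
     (\<forall>X\<in>VF. \<forall>h\<in>C. \<forall>p. \<omega> (\<lambda>p f. h p * X p f) p = h p * \<omega> X p)"

lemma
  assumes "smooth_form \<omega>" "X \<in> VF"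
  shows smooth_form_smooth: "\<omega> X \<in> C"
    and smooth_form_add: "Y \<in> VF \<Longrightarrow> \<omega> (\<lambda>p f. X p f + Y p f) p = \<omega> X p + \<omega> Y p"
    and smooth_form_mult: "h \<in> C \<Longrightarrow> \<omega> (\<lambda>p f. h p * X p f) p = h p * \<omega> X p"
  using assms by (simp_all add: smooth_form_def)

lemma smooth_form_zero:
  assumes "smooth_form \<omega>" shows "\<omega> (\<lambda>p f. 0) p = 0"
  using smooth_form_mult[OF assms field_zero smooth_const, of 0 p] by simp

lemma smooth_form_sum:
  assumes \<omega>: "smooth_form \<omega>" and X: "\<And>i. i \<in> I \<Longrightarrow> X i \<in> VF" and h: "\<And>i. i \<in> I \<Longrightarrow> h i \<in> C"
  shows "\<omega> (\<lambda>p f. \<Sum>i\<in>I. h i p * X i p f) p = (\<Sum>i\<in>I. h i p * \<omega> (X i) p)"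
  using X h
proof (induction I rule: infinite_finite_induct)
  case (insert i I)
  then show ?case
    using smooth_form_add[OF \<omega> field_mult[of "X i" "h i"] field_sum[of I X h]] smooth_form_mult[OF \<omega>]
    by simp
qed (simp_all add: smooth_form_zero[OF \<omega>])

text \<open>Tensoriality. A frame expansion of X holds near \<open>p\<close> only; multiplied by a
  bump it becomes an identity of global fields, to which linearity over the smooth functions
  applies, and at \<open>p\<close> the bump is 1.\<close>

lemma smooth_form_pointwise:
  assumes \<omega>: "smooth_form \<omega>" and "X \<in> VF" "Y \<in> VF" "X p = Y p"
  shows "\<omega> X p = \<omega> Y p"
proof -
  obtain N x V where N: "p \<in> N" and c: "coordinate_frame N x V" by (rule coordinate_frame_exists)
  obtain k N' where k: "k \<in> C" "open N'" "p \<in> N'" "\<forall>q\<in>N'. k q = 1" "\<forall>q. q \<notin> N \<longrightarrow> k q = 0"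
    by (rule bump_function[OF coordinate_frame_open[OF c] N])
  have "\<omega> X p = (\<Sum>e\<in>Bas. X p (x e) * \<omega> (V e) p)" if X: "X \<in> VF" for X
  proof -
    have "(\<lambda>q f. k q * X q f) = (\<lambda>q f. \<Sum>e\<in>Bas. (k q * X q (x e)) * V e q f)"
    proof (intro ext)
      fix q f
      show "k q * X q f = (\<Sum>e\<in>Bas. (k q * X q (x e)) * V e q f)"
      proof (cases "q \<in> N")
        case True
        have "k q * X q f = k q * (\<Sum>e\<in>Bas. X q (x e) * V e q f)"
          by (rule arg_cong[OF coordinate_frame_expand[OF c True vector_field_tangent[OF X]]])
        then show ?thesis by (simp add: sum_distrib_left mult.assoc)
      qed (simp add: k(5))
    qed
    moreover have "\<omega> (\<lambda>q f. \<Sum>e\<in>Bas. (k q * X q (x e)) * V e q f) p =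
        (\<Sum>e\<in>Bas. (k p * X p (x e)) * \<omega> (V e) p)"
      by (rule smooth_form_sum[OF \<omega> coordinate_frame_field[OF c] smooth_mult[OF k(1) vector_field_smooth[OF X coordinate_frame_smooth[OF c]]]])
    ultimately have "k p * \<omega> X p = (\<Sum>e\<in>Bas. (k p * X p (x e)) * \<omega> (V e) p)"
      using smooth_form_mult[OF \<omega> X k(1), of p] by simp
    then show ?thesis using k(3,4) by simp
  qed
  then show ?thesis using assms by simp
qed

text \<open>The value 0 off the tangent space is part of the notion, matching \<open>flat\<close>
  and \<open>covector_at\<close>: two covectors that agree on tangent vectors are then equal as
  functions.\<close>

definition covector :: "'m \<Rightarrow> 'm covector \<Rightarrow> bool" where
  "covector p \<alpha> \<longleftrightarrow> (\<forall>v. v \<notin> T p \<longrightarrow> \<alpha> v = 0) \<and>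
     (\<forall>u\<in>T p. \<forall>v\<in>T p. \<forall>a b. \<alpha> (\<lambda>f. a * u f + b * v f) = a * \<alpha> u + b * \<alpha> v)"

lemma
  assumes "covector p \<alpha>"
  shows covector_outside: "v \<notin> T p \<Longrightarrow> \<alpha> v = 0"
    and covector_lincomb: "u \<in> T p \<Longrightarrow> v \<in> T p \<Longrightarrow> \<alpha> (\<lambda>f. a * u f + b * v f) = a * \<alpha> u + b * \<alpha> v"
  using assms by (simp_all add: covector_def)

lemma covector_scale: "covector p \<alpha> \<Longrightarrow> v \<in> T p \<Longrightarrow> \<alpha> (\<lambda>f. a * v f) = a * \<alpha> v"
  using covector_lincomb[of p \<alpha> v v a 0] by simp

lemma covector_add: "covector p \<alpha> \<Longrightarrow> u \<in> T p \<Longrightarrow> v \<in> T p \<Longrightarrow> \<alpha> (\<lambda>f. u f + v f) = \<alpha> u + \<alpha> v"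
  using covector_lincomb[of p \<alpha> u v 1 1] by simp

lemma covector_zero: "covector p \<alpha> \<Longrightarrow> \<alpha> (\<lambda>f. 0) = 0"
  using covector_scale[of p \<alpha> "\<lambda>f. 0" 0] tangent_zero by simp

lemma covector_sum:
  assumes "covector p \<alpha>" "\<And>i. i \<in> I \<Longrightarrow> v i \<in> T p"
  shows "\<alpha> (\<lambda>f. \<Sum>i\<in>I. c i * v i f) = (\<Sum>i\<in>I. c i * \<alpha> (v i))"
  using assms(2)
proof (induction I rule: infinite_finite_induct)
  case (insert i I)
  then show ?case
    using covector_add[OF assms(1) tangent_scale[of "v i" p "c i"] tangent_sum[of I v p c]]
      covector_scale[OF assms(1)] by simp
qed (simp_all add: covector_zero[OF assms(1)])

lemma covector_combine:
  assumes "covector p \<alpha>" "covector p \<beta>" shows "covector p (\<lambda>v. a * \<alpha> v + b * \<beta> v)"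
  using assms unfolding covector_def by (auto simp: algebra_simps)

lemma covector_eqI:
  assumes "covector p \<alpha>" "covector p \<beta>" "\<And>v. v \<in> T p \<Longrightarrow> \<alpha> v = \<beta> v" shows "\<alpha> = \<beta>"
proof
  show "\<alpha> v = \<beta> v" for v
    using assms(3) covector_outside[OF assms(1)] covector_outside[OF assms(2)] by (cases "v \<in> T p") simp_all
qed

text \<open>By tensoriality the \<open>THE\<close> in \<open>covector_at\<close> has a unique
  candidate.\<close>

lemma covector_at_eq:
  assumes \<omega>: "smooth_form \<omega>" and X: "X \<in> VF"
  shows "covector_at A \<omega> p (X p) = \<omega> X p"
proof -
  have "(THE c. \<forall>V\<in>VF. V p = X p \<longrightarrow> \<omega> V p = c) = \<omega> X p"
  proof (rule the_equality)
    show "\<forall>V\<in>VF. V p = X p \<longrightarrow> \<omega> V p = \<omega> X p" by (intro ballI impI smooth_form_pointwise[OF \<omega> _ X])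
    show "c = \<omega> X p" if "\<forall>V\<in>VF. V p = X p \<longrightarrow> \<omega> V p = c" for c
      using bspec[OF that X] by simp
  qed
  then show ?thesis using vector_field_tangent[OF X] by (simp add: covector_at_def)
qed

lemma covector_covector_at:
  assumes \<omega>: "smooth_form \<omega>" shows "covector p (covector_at A \<omega> p)"
  unfolding covector_def
proof safe
  fix u v a b assume u: "u \<in> T p" and v: "v \<in> T p"
  obtain X Y where X: "X \<in> VF" "X p = u" "Y \<in> VF" "Y p = v"
    by (rule field_through[OF u], rule field_through[OF v])
  have "(\<lambda>q f. a * X q f + b * Y q f) \<in> VF"
    using field_add[OF field_mult[OF X(1) smooth_const] field_mult[OF X(3) smooth_const]] .
  from covector_at_eq[OF \<omega> this, of p]
  show "covector_at A \<omega> p (\<lambda>f. a * u f + b * v f) = a * covector_at A \<omega> p u + b * covector_at A \<omega> p v"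
    using smooth_form_add[OF \<omega> field_mult[OF X(1) smooth_const[of a]] field_mult[OF X(3) smooth_const[of b]]]
      smooth_form_mult[OF \<omega> _ smooth_const] covector_at_eq[OF \<omega> X(1), of p] covector_at_eq[OF \<omega> X(3), of p] X
    by simp
qed (simp add: covector_at_def)

end

section \<open>Metrics\<close>

locale metric_manifold = manifold A
  for A :: "('m::{t2_space,second_countable_topology}, 'e::real_inner) chart set" +
  fixes g :: "'m metric"
  assumes singular_metric: "singular_metric A g"
begin

lemma metric_sym: "u \<in> T p \<Longrightarrow> v \<in> T p \<Longrightarrow> g p u v = g p v u"
  using singular_metric by (simp add: singular_metric_def)

lemma metric_add_scale:
  "u \<in> T p \<Longrightarrow> v \<in> T p \<Longrightarrow> w \<in> T p \<Longrightarrow> g p (\<lambda>f. u f + c * v f) w = g p u w + c * g p v w"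
  using singular_metric by (simp add: singular_metric_def)

lemma metric_zero_left: "w \<in> T p \<Longrightarrow> g p (\<lambda>f. 0) w = 0"
  using metric_add_scale[OF tangent_zero tangent_zero, of w p 1] by simp

lemma metric_lincomb_left:
  assumes "u \<in> T p" "v \<in> T p" "w \<in> T p"
  shows "g p (\<lambda>f. a * u f + b * v f) w = a * g p u w + b * g p v w"
  using metric_add_scale[OF tangent_scale[OF assms(1), of a] assms(2,3), of b]
    metric_add_scale[OF tangent_zero assms(1,3), of a] metric_zero_left[OF assms(3)] by simp

lemma covector_metric: "w \<in> T p \<Longrightarrow> covector p (flat A g p w)"
  using metric_sym[of w p] metric_lincomb_left[of _ p _ w] by (auto simp: covector_def flat_def tangent_lincomb)

lemma flat_apply: "v \<in> T p \<Longrightarrow> flat A g p u v = g p u v"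
  by (simp add: flat_def)

lemma metric_lincomb_right:
  "u \<in> T p \<Longrightarrow> v \<in> T p \<Longrightarrow> w \<in> T p \<Longrightarrow> g p w (\<lambda>f. a * u f + b * v f) = a * g p w u + b * g p w v"
  using covector_lincomb[OF covector_metric[of w p], of u v a b] by (simp add: flat_apply tangent_lincomb)

lemma metric_fun_smooth: "X \<in> VF \<Longrightarrow> Y \<in> VF \<Longrightarrow> metric_fun g X Y \<in> C"
  using singular_metric by (simp add: singular_metric_def)

lemma metric_fun_sym: "X \<in> VF \<Longrightarrow> Y \<in> VF \<Longrightarrow> metric_fun g X Y = metric_fun g Y X"
  by (simp add: metric_fun_def fun_eq_iff metric_sym vector_field_tangent)

lemma metric_fun_add_right: "X \<in> VF \<Longrightarrow> Y \<in> VF \<Longrightarrow> Z \<in> VF \<Longrightarrow>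
    metric_fun g X (\<lambda>p f. Y p f + Z p f) = (\<lambda>p. metric_fun g X Y p + metric_fun g X Z p)"
  using metric_lincomb_right[of _ _ _ _ 1 1] by (simp add: metric_fun_def fun_eq_iff vector_field_tangent)

lemma metric_fun_mult_right: "X \<in> VF \<Longrightarrow> Y \<in> VF \<Longrightarrow>
    metric_fun g X (\<lambda>p f. h p * Y p f) = (\<lambda>p. h p * metric_fun g X Y p)"
  using metric_lincomb_right[of "Y p" p "Y p" "X p" "h p" 0 for p] by (simp add: metric_fun_def fun_eq_iff vector_field_tangent)

lemma metric_fun_add_left: "X \<in> VF \<Longrightarrow> Y \<in> VF \<Longrightarrow> Z \<in> VF \<Longrightarrow>
    metric_fun g (\<lambda>p f. Y p f + Z p f) X = (\<lambda>p. metric_fun g Y X p + metric_fun g Z X p)"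
  using metric_lincomb_left[of _ _ _ _ 1 1] by (simp add: metric_fun_def fun_eq_iff vector_field_tangent)

lemma metric_fun_mult_left: "X \<in> VF \<Longrightarrow> Y \<in> VF \<Longrightarrow>
    metric_fun g (\<lambda>p f. h p * Y p f) X = (\<lambda>p. h p * metric_fun g Y X p)"
  using metric_lincomb_left[of "Y p" p "Y p" "X p" "h p" 0 for p] by (simp add: metric_fun_def fun_eq_iff vector_field_tangent)

lemma metric_fun_lincomb_right: "X \<in> VF \<Longrightarrow> Y \<in> VF \<Longrightarrow> Z \<in> VF \<Longrightarrow>
    metric_fun g X (\<lambda>p f. h p * Y p f + k p * Z p f) p = h p * metric_fun g X Y p + k p * metric_fun g X Z p"
  by (simp add: metric_fun_def metric_lincomb_right vector_field_tangent)

lemma metric_fun_minus_right: "X \<in> VF \<Longrightarrow> Y \<in> VF \<Longrightarrow>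
    metric_fun g X (\<lambda>p f. - Y p f) = (\<lambda>p. - metric_fun g X Y p)"
  using metric_fun_mult_right[of X Y "\<lambda>_. -1"] by simp

text \<open>With hZ in place of Z, the product rule creates X(h) g(Y,Z) and Y(h) g(Z,X). The terms
  g(Y,[hZ,X]) and - g(X,[Y,hZ]) create the same expressions with the opposite sign.\<close>

lemma smooth_form_koszul:
  assumes X: "X \<in> VF" and Y: "Y \<in> VF" shows "smooth_form (koszul g X Y)"
  unfolding smooth_form_def
proof (intro conjI ballI allI)
  note [simp] = X Y metric_fun_smooth lie_bracket_field
  fix Z assume [simp]: "Z \<in> VF"
  have "(\<lambda>p. X p (metric_fun g Y Z)) \<in> C" "(\<lambda>p. Y p (metric_fun g Z X)) \<in> C" "(\<lambda>p. Z p (metric_fun g X Y)) \<in> C"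
    by (simp_all add: vector_field_smooth)
  then show "koszul g X Y Z \<in> C"
    unfolding koszul_def by (intro smooth_mult smooth_const smooth_add smooth_diff metric_fun_smooth lie_bracket_field) simp_all
  show "koszul g X Y (\<lambda>p f. Z p f + Z' p f) p = koszul g X Y Z p + koszul g X Y Z' p"
    if [simp]: "Z' \<in> VF" for Z' p
  proof -
    have "lie_bracket (\<lambda>p f. Z p f + Z' p f) X = (\<lambda>p f. lie_bracket Z X p f + lie_bracket Z' X p f)"
      using lie_bracket_add_right[of X Z Z'] lie_bracket_antisym[of _ X] by (simp add: fun_eq_iff)
    then show ?thesis
      using tangent_add_fun[OF vector_field_tangent[OF X]] tangent_add_fun[OF vector_field_tangent[OF Y]]
      by (simp add: koszul_def metric_fun_add_right metric_fun_add_left lie_bracket_add_right algebra_simps)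
  qed
  show "koszul g X Y (\<lambda>p f. h p * Z p f) p = h p * koszul g X Y Z p" if h: "h \<in> C" for h p
  proof -
    have 1: "lie_bracket (\<lambda>p f. h p * Z p f) X = (\<lambda>p f. h p * lie_bracket Z X p f + (- X p h) * Z p f)"
      using lie_bracket_mult_right[of X Z h] lie_bracket_antisym[of _ X] h by (simp add: fun_eq_iff)
    note 2 = metric_fun_lincomb_right[OF Y lie_bracket_field[OF \<open>Z \<in> VF\<close> X] \<open>Z \<in> VF\<close>,
        of h "\<lambda>p. - X p h" p]
    note 3 = metric_fun_lincomb_right[OF X lie_bracket_field[OF Y \<open>Z \<in> VF\<close>] \<open>Z \<in> VF\<close>,
        of h "\<lambda>p. Y p h" p]
    have 4: "metric_fun g Z X = metric_fun g X Z" by (simp add: metric_fun_sym)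
    show ?thesis
      unfolding koszul_def lie_bracket_mult_right[OF Y \<open>Z \<in> VF\<close> h] 1 2 3
      using tangent_mult_fun[OF vector_field_tangent[OF X] h metric_fun_smooth[OF Y \<open>Z \<in> VF\<close>], of p]
        tangent_mult_fun[OF vector_field_tangent[OF Y] h metric_fun_smooth[OF \<open>Z \<in> VF\<close> X], of p]
      by (simp add: metric_fun_mult_right metric_fun_mult_left algebra_simps 4)
  qed
qed

lemma smooth_form_semi_symmetric_koszul:
  assumes P: "P \<in> VF" and X: "X \<in> VF" and Y: "Y \<in> VF"
  shows "smooth_form (semi_symmetric_koszul g P X Y)"
proof -
  note k = smooth_form_koszul[OF X Y]
  show ?thesis
    unfolding smooth_form_def semi_symmetric_koszul_def
    using smooth_form_smooth[OF k] smooth_form_add[OF k] smooth_form_mult[OF k]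
    by (auto simp: P X Y metric_fun_add_right metric_fun_mult_right algebra_simps
        intro!: smooth_add smooth_diff smooth_mult metric_fun_smooth)
qed

text \<open>Metric compatibility and torsion-freeness, valid also for degenerate g. On the factors
  they trade derivatives of the metric and brackets for Koszul values, which is what makes the
  curvature terms cancel.\<close>

lemma
  assumes X: "X \<in> VF" and Y: "Y \<in> VF" and Z: "Z \<in> VF"
  shows koszul_metric: "koszul g X Y Z p + koszul g X Z Y p = X p (metric_fun g Y Z)"
    and koszul_torsion_free: "koszul g X Y Z p - koszul g Y X Z p = metric_fun g Z (lie_bracket X Y) p"
proof -
  have m: "metric_fun g U (lie_bracket V W) p = - metric_fun g U (lie_bracket W V) p"
    if "U \<in> VF" "V \<in> VF" "W \<in> VF" for U V W
    unfolding lie_bracket_antisym[of W V] using that by (simp add: metric_fun_minus_right lie_bracket_field)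
  note s = metric_fun_sym[OF X Y] metric_fun_sym[OF X Z] metric_fun_sym[OF Y Z]
  show "koszul g X Y Z p + koszul g X Z Y p = X p (metric_fun g Y Z)"
    using m[OF X Y Z] m[OF Y Z X] m[OF Z X Y] by (simp add: koszul_def s field_simps)
  show "koszul g X Y Z p - koszul g Y X Z p = metric_fun g Z (lie_bracket X Y) p"
    using m[OF X Y Z] m[OF Y Z X] m[OF Z X Y] by (simp add: koszul_def s field_simps)
qed

text \<open>Two extensions of the contraction agree because smooth functions are continuous.\<close>

lemma contraction_eqI:
  assumes dense: "closure (regular_points A g) = UNIV" and h: "h \<in> C"
    and uv: "\<And>p. \<exists>u\<in>T p. \<exists>v\<in>T p. covector_at A \<omega> p = flat A g p u \<and> covector_at A \<tau> p = flat A g p v \<and> h p = g p u v"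
  shows "contraction A g \<omega> \<tau> = h"
proof -
  have b: "bullet_metric A g p (covector_at A \<omega> p) (covector_at A \<tau> p) = h p" for p
  proof -
    from uv[of p] obtain u v where u: "u \<in> T p" "v \<in> T p" "covector_at A \<omega> p = flat A g p u"
      "covector_at A \<tau> p = flat A g p v" "h p = g p u v" by (elim bexE conjE)
    show ?thesis unfolding bullet_metric_def
    proof (rule the_equality)
      show "\<exists>u\<in>T p. \<exists>v\<in>T p. covector_at A \<omega> p = flat A g p u \<and> covector_at A \<tau> p = flat A g p v \<and> h p = g p u v"
        by (rule uv)
      fix c assume "\<exists>u\<in>T p. \<exists>v\<in>T p. covector_at A \<omega> p = flat A g p u \<and> covector_at A \<tau> p = flat A g p v \<and> c = g p u v"
      then obtain u' v' where u': "u' \<in> T p" "v' \<in> T p" "covector_at A \<omega> p = flat A g p u'"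
        "covector_at A \<tau> p = flat A g p v'" "c = g p u' v'" by (elim bexE conjE)
      have "g p u' v' = g p u v'" using u u' flat_apply[of v' p u] flat_apply[of v' p u'] by simp
      also have "\<dots> = g p v' u" using u u' metric_sym by simp
      also have "\<dots> = g p v u" using u u' flat_apply[of u p v] flat_apply[of u p v'] by simp
      finally show "c = h p" using u u' metric_sym by simp
    qed
  qed
  show ?thesis unfolding contraction_def
  proof (rule the_equality)
    show "h \<in> C \<and> (\<forall>p\<in>regular_points A g. h p = bullet_metric A g p (covector_at A \<omega> p) (covector_at A \<tau> p))"
      using h b by simp
    fix k assume k: "k \<in> C \<and> (\<forall>p\<in>regular_points A g. k p = bullet_metric A g p (covector_at A \<omega> p) (covector_at A \<tau> p))"
    have "closed {p. k p = h p}"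
      using k h by (intro closed_Collect_eq smooth_functions_continuous) auto
    moreover have "regular_points A g \<subseteq> {p. k p = h p}" using k b by auto
    ultimately have "closure (regular_points A g) \<subseteq> {p. k p = h p}" by (rule closure_minimal[rotated])
    then show "k = h" using dense by auto
  qed
qed

end

section \<open>Pullbacks of metrics, orthogonal systems and the rank\<close>

context metric_manifold
begin

lemma metric_sum_left:
  assumes "w \<in> T p" "\<And>i. i \<in> I \<Longrightarrow> v i \<in> T p"
  shows "g p (\<lambda>f. \<Sum>i\<in>I. c i * v i f) w = (\<Sum>i\<in>I. c i * g p (v i) w)"
proof -
  have T: "(\<lambda>f. \<Sum>i\<in>I. c i * v i f) \<in> T p" by (rule tangent_sum) (rule assms(2))
  have "g p (\<lambda>f. \<Sum>i\<in>I. c i * v i f) w = flat A g p w (\<lambda>f. \<Sum>i\<in>I. c i * v i f)"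
    by (simp only: flat_apply[OF T] metric_sym[OF T assms(1)])
  also have "\<dots> = (\<Sum>i\<in>I. c i * flat A g p w (v i))"
    by (rule covector_sum[OF covector_metric[OF assms(1)] assms(2)])
  also have "\<dots> = (\<Sum>i\<in>I. c i * g p (v i) w)"
    using assms metric_sym by (intro sum.cong) (simp_all add: flat_def)
  finally show ?thesis .
qed

text \<open>The pushed vectors form only a field along the map, so \<open>metric_fun_smooth\<close>
  does not apply to them. In a frame near the image point their coefficients are the derivatives of
  pulled-back coordinates, and the metric entries are pulled back as well; all of these are
  smooth.\<close>

lemma metric_pullback_smooth:
  fixes A' :: "('n::{t2_space,second_countable_topology}, 'd::real_inner) chart set" and \<pi> :: "'n \<Rightarrow> 'm"
  assumes A': "manifold A'" and \<pi>: "continuous_on UNIV \<pi>" "\<And>f. f \<in> C \<Longrightarrow> (\<lambda>z. f (\<pi> z)) \<in> smooth_functions A'"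
    and push: "\<And>z u. u \<in> tangent_space A' z \<Longrightarrow> push_forward \<pi> u \<in> T (\<pi> z)"
    and X: "X \<in> vector_fields A'" and Y: "Y \<in> vector_fields A'"
  shows "(\<lambda>z. g (\<pi> z) (push_forward \<pi> (X z)) (push_forward \<pi> (Y z))) \<in> smooth_functions A'"
proof -
  interpret A': manifold A' by (rule A')
  show ?thesis
  proof (rule A'.smooth_functions_local)
    fix z
    obtain N x V where N: "\<pi> z \<in> N" and c: "coordinate_frame N x V" by (rule coordinate_frame_exists)
    note V = coordinate_frame_field[OF c] and xC = coordinate_frame_smooth[OF c]
    let ?h = "\<lambda>z. \<Sum>e\<in>Bas. X z (\<lambda>z. x e (\<pi> z)) * (\<Sum>e'\<in>Bas. Y z (\<lambda>z. x e' (\<pi> z)) * metric_fun g (V e') (V e) (\<pi> z))"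
    have "?h \<in> A'.C"
      by (intro A'.smooth_sum A'.smooth_mult A'.vector_field_smooth[OF X \<pi>(2)[OF xC]]
          A'.vector_field_smooth[OF Y \<pi>(2)[OF xC]] \<pi>(2)[OF metric_fun_smooth] V)
    moreover have "g (\<pi> q) (push_forward \<pi> (X q)) (push_forward \<pi> (Y q)) = ?h q" if q: "q \<in> \<pi> -` N" for q
    proof -
      have qN: "\<pi> q \<in> N" using q by simp
      note T = push[OF A'.vector_field_tangent[OF X], of q] push[OF A'.vector_field_tangent[OF Y], of q]
      have VT: "V e (\<pi> q) \<in> T (\<pi> q)" if "e \<in> Bas" for e using vector_field_tangent[OF V[OF that]] .
      have expand: "g (\<pi> q) u w = (\<Sum>e\<in>Bas. u (x e) * g (\<pi> q) (V e (\<pi> q)) w)"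
        if u: "u \<in> T (\<pi> q)" and w: "w \<in> T (\<pi> q)" for u w
      proof -
        have "g (\<pi> q) u w = g (\<pi> q) (\<lambda>f. \<Sum>e\<in>Bas. u (x e) * V e (\<pi> q) f) w"
          by (rule arg_cong[where f = "\<lambda>u. g (\<pi> q) u w"], rule ext) (rule coordinate_frame_expand[OF c qN u])
        also have "\<dots> = (\<Sum>e\<in>Bas. u (x e) * g (\<pi> q) (V e (\<pi> q)) w)"
          by (rule metric_sum_left[OF w VT])
        finally show ?thesis .
      qed
      have "g (\<pi> q) (push_forward \<pi> (X q)) (push_forward \<pi> (Y q)) =
          (\<Sum>e\<in>Bas. push_forward \<pi> (X q) (x e) * g (\<pi> q) (push_forward \<pi> (Y q)) (V e (\<pi> q)))"
        unfolding expand[OF T] using metric_sym[OF VT T(2)] by (intro sum.cong) auto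
      also have "\<dots> = ?h q"
        using expand[OF T(2) VT] by (intro sum.cong) (auto simp: push_forward_def comp_def metric_fun_def)
      finally show ?thesis .
    qed
    ultimately show "\<exists>M h. open M \<and> z \<in> M \<and> h \<in> A'.C \<and>
        (\<forall>q\<in>M. g (\<pi> q) (push_forward \<pi> (X q)) (push_forward \<pi> (Y q)) = h q)"
      using N open_vimage[OF coordinate_frame_open[OF c] \<pi>(1)] by (intro exI[of _ "\<pi> -` N"] exI[of _ ?h]) simp
  qed
qed

text \<open>Vectors are non-null but not normalised: g may take either sign on them, and roots are
  avoided. Numbering them allows a family to be enlarged by one.\<close>

definition orthogonal_system :: "'m \<Rightarrow> nat \<Rightarrow> (nat \<Rightarrow> 'm tangent) \<Rightarrow> bool" where
  "orthogonal_system p m e \<longleftrightarrow> (\<forall>i<m. e i \<in> T p \<and> g p (e i) (e i) \<noteq> 0) \<and>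
     (\<forall>i<m. \<forall>j<m. i \<noteq> j \<longrightarrow> g p (e i) (e j) = 0)"

lemma orthogonal_system_coefficient:
  assumes "orthogonal_system p m e" "j < m"
  shows "g p (\<lambda>f. \<Sum>i<m. c i * e i f) (e j) = c j * g p (e j) (e j)"
proof -
  have "g p (\<lambda>f. \<Sum>i<m. c i * e i f) (e j) = (\<Sum>i<m. c i * g p (e i) (e j))"
    using assms by (intro metric_sum_left) (auto simp: orthogonal_system_def)
  also have "\<dots> = (\<Sum>i<m. if i = j then c j * g p (e j) (e j) else 0)"
    using assms by (intro sum.cong) (auto simp: orthogonal_system_def)
  finally show ?thesis using assms by simp
qed

text \<open>Pairing with e_j isolates the j-th coefficient, so the vectors are independent. Through
  \<open>tangent_parametrization\<close> the three claims become counts of independent and spanning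
  sets in the model space.\<close>

lemma
  assumes e: "orthogonal_system p m e"
  shows orthogonal_system_card: "m \<le> card Bas"
    and orthogonal_system_complete: "m = card Bas \<Longrightarrow> v \<in> T p \<Longrightarrow> \<exists>c. v = (\<lambda>f. \<Sum>i<m. c i * e i f)"
    and orthogonal_system_spanning: "\<forall>v\<in>T p. \<exists>c. v = (\<lambda>f. \<Sum>i<m. c i * e i f) \<Longrightarrow> card Bas \<le> m"
proof -
  obtain L :: "'e \<Rightarrow> 'm tangent" where
    L: "\<forall>a b w w' f. L (a *\<^sub>R w + b *\<^sub>R w') f = a * L w f + b * L w' f" "inj L" "range L = T p"
    by (rule tangent_parametrization)
  have "\<exists>w. L w = e i" if "i < m" for i using e that L(3) unfolding orthogonal_system_def by (metis imageE)
  then obtain w where w: "\<And>i. i < m \<Longrightarrow> L (w i) = e i" by metis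
  have L0: "L 0 f = 0" for f using L(1)[rule_format, of 0 0 0 0 f] by simp
  have Lsum: "L (\<Sum>i\<in>I. c i *\<^sub>R x i) f = (\<Sum>i\<in>I. c i * L (x i) f)" for I c f and x :: "nat \<Rightarrow> 'e"
  proof (induction I rule: infinite_finite_induct)
    case (insert i I)
    then show ?case using L(1)[rule_format, of "c i" "x i" 1 "\<Sum>i\<in>I. c i *\<^sub>R x i" f] by simp
  qed (simp_all add: L0)
  have Lw: "L (\<Sum>i<m. c i *\<^sub>R w i) = (\<lambda>f. \<Sum>i<m. c i * e i f)" for c
    using w by (auto simp: Lsum intro!: sum.cong)
  have inj: "inj_on w {..<m}"
  proof (rule inj_onI, rule ccontr)
    fix i j assume "i \<in> {..<m}" "j \<in> {..<m}" "w i = w j" "i \<noteq> j"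
    then show False using e w[of i] w[of j] unfolding orthogonal_system_def by (metis lessThan_iff)
  qed
  let ?W = "w ` {..<m}"
  have cardW: "card ?W = m" using card_image[OF inj] by simp
  have ind: "independent ?W"
  proof (rule independent_if_scalars_zero)
    fix c x assume "(\<Sum>x\<in>?W. c x *\<^sub>R x) = 0" "x \<in> ?W"
    then obtain j where j: "j < m" "x = w j" and s: "(\<Sum>i<m. c (w i) *\<^sub>R w i) = 0"
      by (auto simp: sum.reindex[OF inj])
    have "(\<lambda>f. \<Sum>i<m. c (w i) * e i f) = (\<lambda>f. 0)" using Lw[of "\<lambda>i. c (w i)"] s L0 by auto
    then have "c (w j) * g p (e j) (e j) = g p (\<lambda>f. 0) (e j)"
      using orthogonal_system_coefficient[OF e j(1), of "\<lambda>i. c (w i)"] by simp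
    then show "c x = 0" using e j by (simp add: orthogonal_system_def metric_zero_left)
  qed simp
  have bound: "card S \<le> card Bas" if "independent S" for S :: "'e set"
    using independent_span_bound[OF finite_Bas that] orthonormal_basis_span[OF orthonormal_Bas] by auto
  show "m \<le> card Bas" using bound[OF ind] cardW by simp
  show "\<exists>c. v = (\<lambda>f. \<Sum>i<m. c i * e i f)" if m: "m = card Bas" and v: "v \<in> T p"
  proof -
    obtain x where x: "v = L x" using v L(3) by auto
    have "x \<in> span ?W"
    proof (rule ccontr)
      assume x: "x \<notin> span ?W"
      then have "x \<notin> ?W" using span_base[of x ?W] by blast
      then have "card (insert x ?W) = Suc m" using cardW by simp
      moreover have "independent (insert x ?W)" using x ind by (simp add: independent_insert)
      ultimately show False using bound[of "insert x ?W"] m by simp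
    qed
    then obtain u where "x = (\<Sum>y\<in>?W. u y *\<^sub>R y)" by (auto simp: span_finite)
    then have "x = (\<Sum>i<m. u (w i) *\<^sub>R w i)" by (simp add: sum.reindex[OF inj])
    then show ?thesis using x Lw[of "\<lambda>i. u (w i)"] by auto
  qed
  show "card Bas \<le> m" if span: "\<forall>v\<in>T p. \<exists>c. v = (\<lambda>f. \<Sum>i<m. c i * e i f)"
  proof -
    have "x \<in> span ?W" for x
    proof -
      have "L x \<in> T p" using L(3) by auto
      then obtain c where "L x = (\<lambda>f. \<Sum>i<m. c i * e i f)" using span by auto
      then have "L x = L (\<Sum>i<m. c i *\<^sub>R w i)" using Lw by simp
      then have "x = (\<Sum>i<m. c i *\<^sub>R w i)" using L(2) by (simp add: inj_eq)
      then show ?thesis by (auto intro: span_sum span_scale span_base)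
    qed
    then have "card Bas \<le> card ?W"
      using independent_span_bound[OF _ orthonormal_basis_independent[OF orthonormal_Bas], of ?W] by auto
    then show ?thesis using cardW by simp
  qed
qed

lemma orthogonal_system_expand:
  assumes e: "orthogonal_system p (card Bas) e" and v: "v \<in> T p"
  shows "v = (\<lambda>f. \<Sum>i<card Bas. (g p v (e i) / g p (e i) (e i)) * e i f)"
proof -
  obtain c where c: "v = (\<lambda>f. \<Sum>i<card Bas. c i * e i f)"
    using orthogonal_system_complete[OF e refl v] by auto
  have "g p v (e i) / g p (e i) (e i) = c i" if "i < card Bas" for i
    using orthogonal_system_coefficient[OF e that, of c] e that unfolding c[symmetric] by (simp add: orthogonal_system_def)
  then have "(\<Sum>i<card Bas. (g p v (e i) / g p (e i) (e i)) * e i f) = (\<Sum>i<card Bas. c i * e i f)" for f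
    by (intro sum.cong) simp_all
  then show ?thesis using c by simp
qed

text \<open>\<open>K\<close> represents every tangent vector modulo the radical, and does so without
  repetition. Its source may be smaller than the model space of the manifold: at a zero of b it is
  the model space of the base.\<close>

lemma metric_rank_eq:
  fixes K :: "'d::real_inner \<Rightarrow> 'm tangent"
  assumes "orthonormal_basis (B :: 'd set)" and K: "\<And>w. K w \<in> T p"
    and lin: "\<And>a b w w' f. K (a *\<^sub>R w + b *\<^sub>R w') f = a * K w f + b * K w' f"
    and onto: "\<And>u. u \<in> T p \<Longrightarrow> \<exists>w. \<forall>v\<in>T p. g p u v = g p (K w) v"
    and inj: "\<And>w. (\<forall>v\<in>T p. g p (K w) v = 0) \<Longrightarrow> w = 0"
  shows "metric_rank A g p = card B"
proof -
  let ?M = "\<lambda>w. flat A g p (K w)"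
  have lM: "?M (a *\<^sub>R w + b *\<^sub>R w') v = a * ?M w v + b * ?M w' v" for a b w w' v
  proof (cases "v \<in> T p")
    case True
    have "K (a *\<^sub>R w + b *\<^sub>R w') = (\<lambda>f. a * K w f + b * K w' f)" using lin by auto
    then show ?thesis using True by (simp add: flat_def metric_lincomb_left K)
  qed (simp add: flat_def)
  have "inj ?M"
  proof (rule injI)
    fix w w' assume eq: "?M w = ?M w'"
    have "g p (K (w - w')) v = 0" if "v \<in> T p" for v
      using lM[of 1 w "-1" w' v] fun_cong[OF eq, of v] that by (simp add: flat_def)
    then have "w - w' = 0" using inj by blast
    then show "w = w'" by simp
  qed
  moreover have "cotangent_bullet A g p = range ?M"
  proof
    show "range ?M \<subseteq> cotangent_bullet A g p" using K by (auto simp: cotangent_bullet_def)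
    show "cotangent_bullet A g p \<subseteq> range ?M"
    proof
      fix \<alpha> assume "\<alpha> \<in> cotangent_bullet A g p"
      then obtain u where u: "u \<in> T p" "\<alpha> = flat A g p u" by (auto simp: cotangent_bullet_def)
      obtain w where "\<forall>v\<in>T p. g p u v = g p (K w) v" using onto[OF u(1)] by auto
      then have "\<alpha> = ?M w" by (auto simp: u flat_def)
      then show "\<alpha> \<in> range ?M" by blast
    qed
  qed
  ultimately show ?thesis
    unfolding metric_rank_def using dim_range_injective[OF assms(1), of ?M] lM by simp
qed

lemma metric_rank_nondegenerate:
  assumes nd: "\<And>u. u \<in> T p \<Longrightarrow> (\<forall>v\<in>T p. g p u v = 0) \<Longrightarrow> u = (\<lambda>f. 0)"
  shows "metric_rank A g p = card Bas"
proof -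
  obtain L :: "'e \<Rightarrow> 'm tangent" where
    L: "\<forall>a b w w' f. L (a *\<^sub>R w + b *\<^sub>R w') f = a * L w f + b * L w' f" "inj L" "range L = T p"
    by (rule tangent_parametrization)
  have L0: "L 0 = (\<lambda>f. 0)" using L(1)[rule_format, of 0 0 0 0] by auto
  show ?thesis
  proof (rule metric_rank_eq[OF orthonormal_Bas])
    show T: "L w \<in> T p" for w using L(3) by auto
    show "\<exists>w. \<forall>v\<in>T p. g p u v = g p (L w) v" if "u \<in> T p" for u
      using that L(3) by (metis imageE)
    show "w = 0" if "\<forall>v\<in>T p. g p (L w) v = 0" for w
      using nd[OF T that] L0 injD[OF L(2), of w 0] by simp
  qed (use L(1) in blast)
qed

end

section \<open>Non-degenerate metrics: orthogonal frames and the inverse metric\<close>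

locale nondegenerate_manifold = metric_manifold A g
  for A :: "('m::{t2_space,second_countable_topology}, 'e::real_inner) chart set" and g :: "'m metric" +
  assumes nondegenerate: "nondegenerate A g"
begin

lemma nondegenerate_at:
  assumes "u \<in> T p" "\<forall>v\<in>T p. g p u v = 0" shows "u = (\<lambda>f. 0)"
  using assms nondegenerate by (simp add: nondegenerate_def)

lemma flat_inj:
  assumes u: "u \<in> T p" "u' \<in> T p" and eq: "\<And>v. v \<in> T p \<Longrightarrow> g p u v = g p u' v" shows "u = u'"
proof -
  have "(\<lambda>f. 1 * u f + (-1) * u' f) = (\<lambda>f. 0)"
  proof (rule nondegenerate_at)
    show "(\<lambda>f. 1 * u f + (-1) * u' f) \<in> T p" by (rule tangent_lincomb[OF u])
    show "\<forall>v\<in>T p. g p (\<lambda>f. 1 * u f + (-1) * u' f) v = 0"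
      using metric_lincomb_left[OF u, of _ 1 "-1"] eq by simp
  qed
  then have "1 * u f + (-1) * u' f = 0" for f by (rule fun_cong)
  then show ?thesis by auto
qed

text \<open>A maximal family of vector fields that are orthogonal everywhere and non-null at \<open>p\<close> is a
  frame near \<open>p\<close>: the denominator-free Gram--Schmidt step would enlarge any smaller family.\<close>

lemma orthogonal_fields_exist:
  obtains E where "\<forall>i<card Bas. E i \<in> VF"
    "\<forall>q. \<forall>i<card Bas. \<forall>j<card Bas. i \<noteq> j \<longrightarrow> g q (E i q) (E j q) = 0"
    "\<forall>i<card Bas. g p (E i p) (E i p) \<noteq> 0"
proof -
  define good where "good m E \<longleftrightarrow> (\<forall>i<m. E i \<in> VF) \<and>
    (\<forall>q. \<forall>i<m. \<forall>j<m. i \<noteq> j \<longrightarrow> g q (E i q) (E j q) = 0) \<and> (\<forall>i<m. g p (E i p) (E i p) \<noteq> 0)"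
    for m and E :: "nat \<Rightarrow> 'm vfield"
  have sys: "orthogonal_system p m (\<lambda>i. E i p)" if "good m E" for m E
    using that vector_field_tangent by (auto simp: good_def orthogonal_system_def)
  have "\<exists>m. (\<exists>E. good m E) \<and> (\<forall>k. (\<exists>E. good k E) \<longrightarrow> k \<le> m)"
    by (rule ex_has_greatest_nat[of _ 0 _ "Suc (card Bas)"])
      (use orthogonal_system_card[OF sys] in \<open>force simp: good_def less_Suc_eq_le\<close>)+
  then obtain m E where E: "good m E" and max: "\<And>k E. good k E \<Longrightarrow> k \<le> m" by auto
  have EV: "E i \<in> VF" if "i < m" for i using E that by (simp add: good_def)
  have orth: "g q (E i q) (E j q) = 0" if "i < m" "j < m" "i \<noteq> j" for q i j
    using E that by (simp add: good_def)
  note sysE = sys[OF E]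
  define n where "n i = metric_fun g (E i) (E i)" for i
  define \<Delta> where "\<Delta> q = (\<Prod>i<m. n i q)" for q
  \<comment> \<open>This plays the role of Delta / n_i but is defined also where a norm vanishes, so
    \<open>pr V\<close> is Delta times the usual orthogonal projection and is a smooth field
    everywhere.\<close>
  define c where "c i q = (\<Prod>j\<in>{..<m}-{i}. n j q)" for i q
  have nC: "n i \<in> C" if "i < m" for i using EV[OF that] by (simp add: n_def metric_fun_smooth)
  have C: "\<Delta> \<in> C" "c i \<in> C" for i
    unfolding \<Delta>_def[abs_def] c_def[abs_def] by (auto intro!: smooth_prod nC)
  have \<Delta>p: "\<Delta> p \<noteq> 0" using E by (simp add: \<Delta>_def n_def metric_fun_def good_def)
  have cn: "c j q * n j q = \<Delta> q" if "j < m" for j q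
    using that prod.remove[of "{..<m}" j "\<lambda>i. n i q"] by (simp add: \<Delta>_def c_def mult.commute)
  define pr where "pr V = (\<lambda>q f. 1 * (\<Delta> q * V q f) + 1 * (\<Sum>i<m. (- c i q * metric_fun g V (E i) q) * E i q f))" for V
  have pr: "pr V \<in> VF" if V: "V \<in> VF" for V
  proof -
    have "(\<lambda>q f. \<Sum>i<m. (- c i q * metric_fun g V (E i) q) * E i q f) \<in> VF"
      by (rule field_sum) (use EV V C in \<open>auto intro!: smooth_mult smooth_minus metric_fun_smooth\<close>)
    from field_add[OF field_mult[OF V C(1)] this] show ?thesis by (simp add: pr_def)
  qed
  have pr_orth: "g q (pr V q) (E j q) = 0" if V: "V \<in> VF" and j: "j < m" for V q j
  proof -
    have T: "V q \<in> T q" "E i q \<in> T q" if "i < m" for i using vector_field_tangent V EV that by auto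
    have s: "g q (\<lambda>f. \<Sum>i<m. (- c i q * metric_fun g V (E i) q) * E i q f) (E j q) =
        (\<Sum>i<m. (- c i q * metric_fun g V (E i) q) * g q (E i q) (E j q))"
      by (rule metric_sum_left) (use T j in auto)
    also have "\<dots> = (\<Sum>i<m. if i = j then - c j q * metric_fun g V (E j) q * n j q else 0)"
      by (rule sum.cong) (use orth j in \<open>auto simp: n_def metric_fun_def\<close>)
    also have "\<dots> = - \<Delta> q * g q (V q) (E j q)"
      using j cn[OF j, of q] by (simp add: metric_fun_def algebra_simps)
    finally have s': "g q (\<lambda>f. \<Sum>i<m. (- c i q * metric_fun g V (E i) q) * E i q f) (E j q) = - \<Delta> q * g q (V q) (E j q)" .
    have "g q (pr V q) (E j q) = 1 * g q (\<lambda>f. \<Delta> q * V q f) (E j q) +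
        1 * g q (\<lambda>f. \<Sum>i<m. (- c i q * metric_fun g V (E i) q) * E i q f) (E j q)"
      unfolding pr_def
      by (rule metric_lincomb_left[OF tangent_scale tangent_sum]) (use T j in auto)
    also have "g q (\<lambda>f. \<Delta> q * V q f) (E j q) = \<Delta> q * g q (V q) (E j q)"
      using metric_lincomb_left[OF T(1) T(1) T(2), of j j j "\<Delta> q" 0] j by simp
    finally show ?thesis unfolding s' by simp
  qed
  \<comment> \<open>A non-null vector orthogonal to the family would extend it through
    \<open>pr\<close>, against maximality. Polarisation then gives the same for pairs.\<close>
  have null: "g p u u = 0" if u: "u \<in> T p" and uE: "\<And>i. i < m \<Longrightarrow> g p u (E i p) = 0" for u
  proof -
    obtain V where V: "V \<in> VF" "V p = u" by (rule field_through[OF u])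
    have prp: "pr V p = (\<lambda>f. \<Delta> p * u f)" using uE V(2) by (simp add: pr_def metric_fun_def)
    have "g p (pr V p) (pr V p) = 0"
    proof (rule ccontr)
      assume "g p (pr V p) (pr V p) \<noteq> 0"
      moreover have "g q (E j q) (pr V q) = 0" if "j < m" for j q
        using pr_orth[OF V(1) that, of q] metric_sym vector_field_tangent pr[OF V(1)] EV[OF that] by simp
      ultimately have "good (Suc m) (E(m := pr V))"
        using E pr[OF V(1)] pr_orth[OF V(1)] by (auto simp: good_def less_Suc_eq)
      then show False using max by fastforce
    qed
    moreover have "g p (pr V p) (pr V p) = \<Delta> p * (\<Delta> p * g p u u)"
      unfolding prp using metric_lincomb_left[OF u u tangent_scale[OF u], of "\<Delta> p" 0 "\<Delta> p"]
        metric_lincomb_right[OF u u u, of "\<Delta> p" 0] by simp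
    ultimately show ?thesis using \<Delta>p by simp
  qed
  have null_pair: "g p u u' = 0" if u: "u \<in> T p" "u' \<in> T p"
    and uE: "\<And>i. i < m \<Longrightarrow> g p u (E i p) = 0" "\<And>i. i < m \<Longrightarrow> g p u' (E i p) = 0" for u u'
  proof -
    let ?w = "\<lambda>f. 1 * u f + 1 * u' f"
    have wT: "?w \<in> T p" by (rule tangent_lincomb[OF u])
    have "g p ?w (E i p) = 0" if "i < m" for i
      using metric_lincomb_left[OF u vector_field_tangent[OF EV[OF that]], of 1 1] uE that by simp
    then have "g p ?w ?w = 0" by (rule null[OF wT])
    then have "g p u u + 2 * g p u u' + g p u' u' = 0"
      using metric_lincomb_left[OF u wT, of 1 1] metric_lincomb_right[OF u u(1), of 1 1]
        metric_lincomb_right[OF u u(2), of 1 1] metric_sym[OF u] by simp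
    then show ?thesis using null[OF u(1)] null[OF u(2)] uE by simp
  qed
  have "\<exists>c. v = (\<lambda>f. \<Sum>i<m. c i * E i p f)" if v: "v \<in> T p" for v
  proof -
    have ET: "E i p \<in> T p" if "i < m" for i using vector_field_tangent EV that by auto
    let ?s = "\<lambda>v f. \<Sum>i<m. (g p v (E i p) / g p (E i p) (E i p)) * E i p f"
    let ?r = "\<lambda>v f. 1 * v f + (-1) * ?s v f"
    have sT: "?s v \<in> T p" for v by (rule tangent_sum) (use ET in auto)
    have rT: "?r v \<in> T p" if "v \<in> T p" for v by (rule tangent_lincomb[OF that sT])
    have sE: "g p (?s v) (E j p) = g p v (E j p)" if "j < m" for j v
      unfolding orthogonal_system_coefficient[OF sysE that] using sysE that by (simp add: orthogonal_system_def)
    have rE: "g p (?r v) (E j p) = 0" if "j < m" "v \<in> T p" for j v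
      using metric_lincomb_left[OF that(2) sT ET[OF that(1)], of 1 "-1"] sE[OF that(1)] by simp
    \<comment> \<open>The remainder of v pairs to 0 with every other remainder and is orthogonal to
      the span of the family, hence to every tangent vector; non-degeneracy makes it 0.\<close>
    have "?r v = (\<lambda>f. 0)"
    proof (rule nondegenerate_at[OF rT[OF v]], rule ballI)
      fix w assume w: "w \<in> T p"
      note r = rT[OF v] rT[OF w]
      have vw: "g p (?r v) (?r w) = 0" by (rule null_pair[OF r rE[OF _ v] rE[OF _ w]])
      have "g p (?r v) (?s w) = g p (?s w) (?r v)" by (rule metric_sym[OF r(1) sT])
      also have "\<dots> = (\<Sum>i<m. (g p w (E i p) / g p (E i p) (E i p)) * g p (E i p) (?r v))"
        by (rule metric_sum_left[OF r(1)]) (use ET in auto)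
      also have "\<dots> = 0"
        using rE[OF _ v] metric_sym[OF ET r(1)] by (intro sum.neutral) auto
      finally have vs: "g p (?r v) (?s w) = 0" .
      have "g p (?r v) (?r w) = 1 * g p (?r v) w + (-1) * g p (?r v) (?s w)"
        by (rule metric_lincomb_right[OF w sT r(1)])
      then show "g p (?r v) w = 0" using vw vs by simp
    qed
    then have "1 * v f + (-1) * ?s v f = 0" for f by (rule fun_cong)
    then have "v = ?s v" by auto
    then show ?thesis by (rule exI[of _ "\<lambda>i. g p v (E i p) / g p (E i p) (E i p)"])
  qed
  then have "m = card Bas"
    using orthogonal_system_card[OF sysE] orthogonal_system_spanning[OF sysE] by auto
  then show ?thesis using that[of E] E by (simp add: good_def)
qed

text \<open>The explicit sum supplies the existence that the \<open>THE\<close> in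
  \<open>sharp\<close> asks for; uniqueness is \<open>flat_inj\<close>.\<close>

lemma
  assumes e: "orthogonal_system p (card Bas) e" and \<alpha>: "covector p \<alpha>"
  shows sharp_orthogonal: "sharp A g p \<alpha> = (\<lambda>f. \<Sum>i<card Bas. (\<alpha> (e i) / g p (e i) (e i)) * e i f)"
    and flat_orthogonal: "flat A g p (\<lambda>f. \<Sum>i<card Bas. (\<alpha> (e i) / g p (e i) (e i)) * e i f) = \<alpha>"
proof -
  let ?u = "\<lambda>f. \<Sum>i<card Bas. (\<alpha> (e i) / g p (e i) (e i)) * e i f"
  have eT: "e i \<in> T p" if "i < card Bas" for i using e that by (simp add: orthogonal_system_def)
  have uT: "?u \<in> T p" by (rule tangent_sum) (use eT in auto)
  show flat: "flat A g p ?u = \<alpha>"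
  proof (rule covector_eqI[OF covector_metric[OF uT] \<alpha>])
    fix v assume v: "v \<in> T p"
    have "flat A g p ?u v = (\<Sum>i<card Bas. (\<alpha> (e i) / g p (e i) (e i)) * g p (e i) v)"
      unfolding flat_apply[OF v] by (rule metric_sum_left[OF v]) (use eT in auto)
    also have "\<dots> = (\<Sum>i<card Bas. (g p v (e i) / g p (e i) (e i)) * \<alpha> (e i))"
      using metric_sym[OF v eT] by (intro sum.cong) auto
    also have "\<dots> = \<alpha> (\<lambda>f. \<Sum>i<card Bas. (g p v (e i) / g p (e i) (e i)) * e i f)"
      by (rule covector_sum[OF \<alpha>, symmetric]) (use eT in auto)
    also have "\<dots> = \<alpha> v" by (rule arg_cong[OF orthogonal_system_expand[OF e v, symmetric]])
    finally show "flat A g p ?u v = \<alpha> v" .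
  qed
  show "sharp A g p \<alpha> = ?u" unfolding sharp_def
  proof (rule the_equality)
    show "?u \<in> T p \<and> flat A g p ?u = \<alpha>" using uT flat by blast
    fix u assume u: "u \<in> T p \<and> flat A g p u = \<alpha>"
    show "u = ?u"
    proof (rule flat_inj[OF _ uT])
      show "g p u v = g p ?u v" if "v \<in> T p" for v
        using fun_cong[OF trans[OF conjunct2[OF u] flat[symmetric]], of v] that by (simp only: flat_apply)
    qed (use u in blast)
  qed
qed

lemma
  assumes \<alpha>: "covector p \<alpha>"
  shows sharp_tangent: "sharp A g p \<alpha> \<in> T p" and flat_sharp: "flat A g p (sharp A g p \<alpha>) = \<alpha>"
proof -
  obtain E where E: "\<forall>i<card Bas. E i \<in> VF"
    "\<forall>q. \<forall>i<card Bas. \<forall>j<card Bas. i \<noteq> j \<longrightarrow> g q (E i q) (E j q) = 0"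
    "\<forall>i<card Bas. g p (E i p) (E i p) \<noteq> 0" by (rule orthogonal_fields_exist)
  then have e: "orthogonal_system p (card Bas) (\<lambda>i. E i p)"
    using vector_field_tangent by (auto simp: orthogonal_system_def)
  show "sharp A g p \<alpha> \<in> T p" unfolding sharp_orthogonal[OF e \<alpha>]
    by (rule tangent_sum) (use E vector_field_tangent in auto)
  show "flat A g p (sharp A g p \<alpha>) = \<alpha>" unfolding sharp_orthogonal[OF e \<alpha>]
    by (rule flat_orthogonal[OF e \<alpha>])
qed

lemma metric_sharp: "covector p \<alpha> \<Longrightarrow> v \<in> T p \<Longrightarrow> g p (sharp A g p \<alpha>) v = \<alpha> v"
  using fun_cong[OF flat_sharp, of p \<alpha> v] by (simp add: flat_apply)

lemma inverse_metric_left: "covector p \<alpha> \<Longrightarrow> covector p \<beta> \<Longrightarrow> inverse_metric A g p \<alpha> \<beta> = \<alpha> (sharp A g p \<beta>)"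
  by (simp add: inverse_metric_def metric_sharp sharp_tangent)

lemma inverse_metric_sym: "covector p \<alpha> \<Longrightarrow> covector p \<beta> \<Longrightarrow> inverse_metric A g p \<alpha> \<beta> = inverse_metric A g p \<beta> \<alpha>"
  by (simp add: inverse_metric_def metric_sym sharp_tangent)

text \<open>In an orthogonal frame the inverse metric is diagonal, so its smooth dependence on the
  point reduces to reciprocals of functions. Quantifying over all covectors at \<open>q\<close>,
  instead of forms, allows covectors along a map.\<close>

lemma inverse_metric_frame:
  obtains N E k where "open N" "p \<in> N" "\<forall>i<card Bas. E i \<in> VF \<and> k i \<in> C"
    "\<forall>q\<in>N. \<forall>\<alpha> \<beta>. covector q \<alpha> \<longrightarrow> covector q \<beta> \<longrightarrow>
      inverse_metric A g q \<alpha> \<beta> = (\<Sum>i<card Bas. \<alpha> (E i q) * \<beta> (E i q) * k i q)"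
proof -
  obtain E where E: "\<forall>i<card Bas. E i \<in> VF"
    "\<forall>q. \<forall>i<card Bas. \<forall>j<card Bas. i \<noteq> j \<longrightarrow> g q (E i q) (E j q) = 0"
    "\<forall>i<card Bas. g p (E i p) (E i p) \<noteq> 0" by (rule orthogonal_fields_exist)
  let ?m = "card Bas"
  define n where "n i = metric_fun g (E i) (E i)" for i
  define \<Delta> where "\<Delta> q = (\<Prod>i<?m. n i q)" for q
  define c where "c i q = (\<Prod>j\<in>{..<?m}-{i}. n j q)" for i q
  have nC: "n i \<in> C" if "i < ?m" for i using E(1) that by (simp add: n_def metric_fun_smooth)
  have C: "\<Delta> \<in> C" "c i \<in> C" for i
    unfolding \<Delta>_def[abs_def] c_def[abs_def] by (auto intro!: smooth_prod nC)
  have "\<Delta> p \<noteq> 0" using E(3) by (simp add: \<Delta>_def n_def metric_fun_def)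
  then obtain N k where k: "open N" "p \<in> N" "k \<in> C" "\<forall>q\<in>N. \<Delta> q \<noteq> 0" "\<forall>q\<in>N. k q = inverse (\<Delta> q)"
    by (rule smooth_reciprocal[OF C(1)])
  \<comment> \<open>The reciprocal of each norm is the product of the others over Delta, so one
    application of \<open>smooth_reciprocal\<close>, to Delta, gives a neighbourhood common to all
    indices.\<close>
  have kc: "c i q * k q = inverse (n i q)" if "i < ?m" "q \<in> N" for i q
  proof -
    have "\<Delta> q = n i q * c i q"
      using that prod.remove[of "{..<?m}" i "\<lambda>i. n i q"] by (simp add: \<Delta>_def c_def)
    moreover have "\<Delta> q \<noteq> 0" "k q = inverse (\<Delta> q)" using k(4,5) that by auto
    ultimately show ?thesis by (simp add: field_simps)
  qed
  show ?thesis
  proof (rule that[OF k(1,2)])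
    show "\<forall>i<?m. E i \<in> VF \<and> (\<lambda>q. c i q * k q) \<in> C" using E(1) smooth_mult[OF C(2) k(3)] by blast
    show "\<forall>q\<in>N. \<forall>\<alpha> \<beta>. covector q \<alpha> \<longrightarrow> covector q \<beta> \<longrightarrow>
      inverse_metric A g q \<alpha> \<beta> = (\<Sum>i<?m. \<alpha> (E i q) * \<beta> (E i q) * (c i q * k q))"
    proof (intro ballI allI impI)
      fix q \<alpha> \<beta> assume q: "q \<in> N" and \<alpha>: "covector q \<alpha>" and \<beta>: "covector q \<beta>"
      have "g q (E i q) (E i q) \<noteq> 0" if "i < ?m" for i
        using k(4) q that by (auto simp: \<Delta>_def n_def metric_fun_def)
      then have e: "orthogonal_system q ?m (\<lambda>i. E i q)"
        using E vector_field_tangent by (auto simp: orthogonal_system_def)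
      have "inverse_metric A g q \<alpha> \<beta> = \<alpha> (\<lambda>f. \<Sum>i<?m. (\<beta> (E i q) / g q (E i q) (E i q)) * E i q f)"
        unfolding inverse_metric_left[OF \<alpha> \<beta>] sharp_orthogonal[OF e \<beta>] ..
      also have "\<dots> = (\<Sum>i<?m. (\<beta> (E i q) / g q (E i q) (E i q)) * \<alpha> (E i q))"
        by (rule covector_sum[OF \<alpha>]) (use E(1) vector_field_tangent in auto)
      also have "\<dots> = (\<Sum>i<?m. \<alpha> (E i q) * \<beta> (E i q) * (c i q * k q))"
        using kc[OF _ q] by (intro sum.cong) (simp_all add: n_def metric_fun_def divide_inverse)
      finally show "inverse_metric A g q \<alpha> \<beta> = (\<Sum>i<?m. \<alpha> (E i q) * \<beta> (E i q) * (c i q * k q))" .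
    qed
  qed
qed

text \<open>The covectors sit at the image point but may depend on all of \<open>z\<close>, as the
  restriction of db to one factor does.\<close>

lemma inverse_metric_pullback_smooth:
  fixes A' :: "('n::{t2_space,second_countable_topology}, 'd::real_inner) chart set" and \<pi> :: "'n \<Rightarrow> 'm"
  assumes A': "manifold A'" and \<pi>: "continuous_on UNIV \<pi>" "\<And>f. f \<in> C \<Longrightarrow> (\<lambda>z. f (\<pi> z)) \<in> smooth_functions A'"
    and cov: "\<And>z. covector (\<pi> z) (\<alpha> z)" "\<And>z. covector (\<pi> z) (\<beta> z)"
    and sm: "\<And>X. X \<in> VF \<Longrightarrow> (\<lambda>z. \<alpha> z (X (\<pi> z))) \<in> smooth_functions A'"
      "\<And>X. X \<in> VF \<Longrightarrow> (\<lambda>z. \<beta> z (X (\<pi> z))) \<in> smooth_functions A'"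
  shows "(\<lambda>z. inverse_metric A g (\<pi> z) (\<alpha> z) (\<beta> z)) \<in> smooth_functions A'"
proof -
  interpret A': manifold A' by (rule A')
  show ?thesis
  proof (rule A'.smooth_functions_local)
    fix z
    obtain N E k where N: "open N" "\<pi> z \<in> N" "\<forall>i<card Bas. E i \<in> VF \<and> k i \<in> C"
      "\<forall>q\<in>N. \<forall>\<alpha> \<beta>. covector q \<alpha> \<longrightarrow> covector q \<beta> \<longrightarrow>
        inverse_metric A g q \<alpha> \<beta> = (\<Sum>i<card Bas. \<alpha> (E i q) * \<beta> (E i q) * k i q)"
      by (rule inverse_metric_frame)
    let ?h = "\<lambda>z. \<Sum>i<card Bas. \<alpha> z (E i (\<pi> z)) * \<beta> z (E i (\<pi> z)) * k i (\<pi> z)"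
    have "?h \<in> A'.C" using N(3) by (intro A'.smooth_sum A'.smooth_mult sm \<pi>(2)) auto
    moreover have "\<forall>q\<in>\<pi> -` N. inverse_metric A g (\<pi> q) (\<alpha> q) (\<beta> q) = ?h q"
      using N(4) cov by simp
    ultimately show "\<exists>M h. open M \<and> z \<in> M \<and> h \<in> A'.C \<and> (\<forall>q\<in>M. inverse_metric A g (\<pi> q) (\<alpha> q) (\<beta> q) = h q)"
      using N(2) open_vimage[OF N(1) \<pi>(1)] by (intro exI[of _ "\<pi> -` N"] exI[of _ ?h]) simp
  qed
qed

lemma inverse_metric_smooth:
  assumes \<omega>: "smooth_form \<omega>" and \<tau>: "smooth_form \<tau>"
  shows "(\<lambda>p. inverse_metric A g p (covector_at A \<omega> p) (covector_at A \<tau> p)) \<in> C"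
  by (rule inverse_metric_pullback_smooth[OF manifold_axioms continuous_on_id])
    (simp_all add: covector_covector_at \<omega> \<tau> covector_at_eq smooth_form_smooth)

lemma regular_points_eq: "regular_points A g = UNIV"
  using metric_rank_nondegenerate[OF nondegenerate_at] by (auto simp: regular_points_def intro!: exI[of _ UNIV])

text \<open>Turns the curvature of a factor, defined through a smooth extension, into an expression
  in the inverse metric, which is what contractions on the product produce.\<close>

lemma contraction_nondegenerate:
  assumes \<omega>: "smooth_form \<omega>" and \<tau>: "smooth_form \<tau>"
  shows "contraction A g \<omega> \<tau> = (\<lambda>p. inverse_metric A g p (covector_at A \<omega> p) (covector_at A \<tau> p))"
proof (rule contraction_eqI[OF _ inverse_metric_smooth[OF \<omega> \<tau>]])
  fix p
  note c = covector_covector_at[OF \<omega>, of p] covector_covector_at[OF \<tau>, of p]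
  show "\<exists>u\<in>T p. \<exists>v\<in>T p. covector_at A \<omega> p = flat A g p u \<and> covector_at A \<tau> p = flat A g p v \<and>
      inverse_metric A g p (covector_at A \<omega> p) (covector_at A \<tau> p) = g p u v"
    by (rule bexI[OF _ sharp_tangent[OF c(1)]], rule bexI[OF _ sharp_tangent[OF c(2)]])
      (simp add: flat_sharp[OF c(1)] flat_sharp[OF c(2)] inverse_metric_def)
qed (simp add: regular_points_eq)

end

section \<open>Products\<close>

lemma smooth_on_Pair:
  assumes S: "open S" and f: "smooth_on S f" and g: "smooth_on S g"
  shows "smooth_on S (\<lambda>x. (f x, g x))"
proof -
  have "Ck_on k S (\<lambda>x. (f x, 0) + (0, g x))" for k
  proof (rule Ck_on_add[OF S])
    show "Ck_on k S (\<lambda>x. (f x, 0 :: 'c))"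
      by (rule Ck_on_bounded_linear_comp[OF S, of "\<lambda>y. (y, 0 :: 'c)"])
        (use f in \<open>auto simp: smooth_on_def intro!: bounded_linear_Pair bounded_linear_ident bounded_linear_zero\<close>)
    show "Ck_on k S (\<lambda>x. (0 :: 'b, g x))"
      by (rule Ck_on_bounded_linear_comp[OF S, of "\<lambda>y. (0 :: 'b, y)"])
        (use g in \<open>auto simp: smooth_on_def intro!: bounded_linear_Pair bounded_linear_ident bounded_linear_zero\<close>)
  qed
  then show ?thesis by (simp add: smooth_on_def)
qed

lemma smooth_on_fst:
  fixes f :: "'a::real_inner \<Rightarrow> 'b::real_normed_vector"
  assumes E: "orthonormal_basis (E :: 'a set)" and S: "open S" "open (R :: 'c::real_normed_vector set)" and f: "smooth_on S f"
  shows "smooth_on (S \<times> R) (\<lambda>p. f (fst p))"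
  by (rule smooth_on_compose[OF E open_Times[OF S] S(1) _ _ f])
    (auto intro!: smooth_on_bounded_linear open_Times S bounded_linear_fst)

lemma smooth_on_snd:
  fixes f :: "'a::real_inner \<Rightarrow> 'b::real_normed_vector"
  assumes E: "orthonormal_basis (E :: 'a set)" and S: "open S" "open (R :: 'c::real_normed_vector set)" and f: "smooth_on S f"
  shows "smooth_on (R \<times> S) (\<lambda>p. f (snd p))"
  by (rule smooth_on_compose[OF E open_Times[OF S(2,1)] S(1) _ _ f])
    (auto intro!: smooth_on_bounded_linear open_Times S bounded_linear_snd)

lemma (in manifold) chart_inj: "(U, \<phi>) \<in> A \<Longrightarrow> inj_on \<phi> U"
  by (rule inj_on_inverseI) (rule chart_inv)

text \<open>The directions \<open>d i\<close> are arbitrary: \<open>Bas\<close> of a product is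
  merely some orthonormal basis, while lifts come in the directions (e, 0) and (0, e). Re-expanding
  in a frame gives coefficients that are visibly smooth.\<close>

lemma (in manifold) chart_combination_smooth:
  assumes U: "(U, \<phi>) \<in> A" "p \<in> U" and h: "\<And>i. i \<in> I \<Longrightarrow> h i \<in> C" and f: "f \<in> C"
  obtains N k where "open N" "p \<in> N" "N \<subseteq> U" "k \<in> C"
    "\<forall>q\<in>N. chart_vector U \<phi> q (\<Sum>i\<in>I. h i q *\<^sub>R d i) f = k q"
proof -
  obtain N x W where N: "p \<in> N" "N \<subseteq> U" and c: "coordinate_frame N x W"
    and x: "\<forall>q\<in>N. \<forall>w e. chart_vector U \<phi> q w (x e) = w \<bullet> e" by (rule chart_frame[OF U])
  let ?k = "\<lambda>q. \<Sum>e\<in>Bas. (\<Sum>i\<in>I. h i q * (d i \<bullet> e)) * W e q f"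
  have "?k \<in> C"
    by (intro smooth_sum smooth_mult smooth_const h vector_field_smooth[OF coordinate_frame_field[OF c] f])
  moreover have "\<forall>q\<in>N. chart_vector U \<phi> q (\<Sum>i\<in>I. h i q *\<^sub>R d i) f = ?k q"
  proof
    fix q assume q: "q \<in> N"
    then have "chart_vector U \<phi> q (\<Sum>i\<in>I. h i q *\<^sub>R d i) \<in> T q"
      using tangent_space_chart[OF U(1), of q] N by auto
    from coordinate_frame_expand[OF c q this, of f]
    show "chart_vector U \<phi> q (\<Sum>i\<in>I. h i q *\<^sub>R d i) f = ?k q"
      by (simp only: x[rule_format, OF q] inner_sum_left inner_scaleR_left)
  qed
  ultimately show ?thesis by (intro that[OF coordinate_frame_open[OF c] N])
qed

text \<open>Injectivity forces the choices made by \<open>inv_into\<close>, so the inverse of a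
  product chart can be computed componentwise.\<close>

lemma inv_into_map_prod:
  assumes "inj_on \<phi> U" "inj_on \<psi> V" "x \<in> \<phi> ` U" "y \<in> \<psi> ` V"
  shows "inv_into (U \<times> V) (map_prod \<phi> \<psi>) (x, y) = (inv_into U \<phi> x, inv_into V \<psi> y)"
proof (rule inv_into_f_eq)
  show "inj_on (map_prod \<phi> \<psi>) (U \<times> V)" using assms by (auto simp: inj_on_def)
qed (use assms in \<open>auto simp: f_inv_into_f inv_into_into\<close>)

lemma smooth_manifold_product:
  fixes AB :: "('b::{t2_space,second_countable_topology}, 'eb::real_inner) chart set"
    and AF :: "('f::{t2_space,second_countable_topology}, 'ef::real_inner) chart set"
  assumes "smooth_manifold AB" "smooth_manifold AF"
  shows "smooth_manifold (product_atlas AB AF)"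
proof -
  interpret B: manifold AB by (rule manifold.intro[OF assms(1)])
  interpret F: manifold AF by (rule manifold.intro[OF assms(2)])
  have im: "map_prod \<phi> \<psi> ` (U \<times> V) = \<phi> ` U \<times> \<psi> ` V" for \<phi> :: "'b \<Rightarrow> 'eb" and \<psi> :: "'f \<Rightarrow> 'ef" and U V by force
  have span: "span ((\<lambda>x. (x, 0)) ` B.Bas \<union> (\<lambda>y. (0, y)) ` F.Bas) = (UNIV :: ('eb \<times> 'ef) set)" (is "span ?E = _")
  proof -
    have "(x, y) \<in> span ?E" for x y
    proof -
      have "linear (\<lambda>x :: 'eb. (x, 0 :: 'ef))" "linear (\<lambda>y :: 'ef. (0 :: 'eb, y))" by (auto simp: linear_iff)
      then have "span ((\<lambda>x. (x, 0 :: 'ef)) ` B.Bas) = range (\<lambda>x. (x, 0))"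
        "span ((\<lambda>y. (0 :: 'eb, y)) ` F.Bas) = range (\<lambda>y. (0, y))"
        using orthonormal_basis_span[OF B.orthonormal_Bas] orthonormal_basis_span[OF F.orthonormal_Bas]
        by (auto simp: linear_span_image)
      then have "(x, 0) \<in> span ?E" "(0, y) \<in> span ?E"
        using span_mono[of "(\<lambda>x. (x, 0)) ` B.Bas" ?E] span_mono[of "(\<lambda>y. (0, y)) ` F.Bas" ?E] by blast+
      then show ?thesis using span_add[of "(x, 0)" ?E "(0, y)"] by simp
    qed
    then show ?thesis by auto
  qed
  have hom: "homeomorphism (U \<times> V) (\<phi> ` U \<times> \<psi> ` V) (map_prod \<phi> \<psi>) (inv_into (U \<times> V) (map_prod \<phi> \<psi>))"
    if U: "(U, \<phi>) \<in> AB" and V: "(V, \<psi>) \<in> AF" for U \<phi> V \<psi>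
  proof -
    have c: "continuous_on (\<phi> ` U) (inv_into U \<phi>)" "continuous_on (\<psi> ` V) (inv_into V \<psi>)"
      using B.chart_homeomorphism[OF U] F.chart_homeomorphism[OF V] by (simp_all add: homeomorphism_def)
    have "homeomorphism (U \<times> V) (\<phi> ` U \<times> \<psi> ` V) (\<lambda>p. (\<phi> (fst p), \<psi> (snd p)))
        (\<lambda>p. (inv_into U \<phi> (fst p), inv_into V \<psi> (snd p)))"
    proof (rule homeomorphismI)
      show "continuous_on (U \<times> V) (\<lambda>p. (\<phi> (fst p), \<psi> (snd p)))"
        by (intro continuous_on_Pair continuous_on_compose2[OF B.chart_continuous[OF U]]
            continuous_on_compose2[OF F.chart_continuous[OF V]] continuous_intros) auto
      show "continuous_on (\<phi> ` U \<times> \<psi> ` V) (\<lambda>p. (inv_into U \<phi> (fst p), inv_into V \<psi> (snd p)))"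
        by (intro continuous_on_Pair continuous_on_compose2[OF c(1)] continuous_on_compose2[OF c(2)]
            continuous_intros) auto
    qed (auto simp: B.chart_inv[OF U] F.chart_inv[OF V])
    then show ?thesis
      by (rule homeomorphism_cong) (auto simp: inv_into_map_prod B.chart_inj[OF U] F.chart_inj[OF V])
  qed
  have trans: "smooth_on (map_prod \<phi> \<psi> ` ((U \<times> V) \<inter> (U' \<times> V'))) (map_prod \<phi>' \<psi>' \<circ> inv_into (U \<times> V) (map_prod \<phi> \<psi>))"
    if U: "(U, \<phi>) \<in> AB" "(V, \<psi>) \<in> AF" and U': "(U', \<phi>') \<in> AB" "(V', \<psi>') \<in> AF" for U \<phi> V \<psi> U' \<phi>' V' \<psi>'
  proof -
    have op: "open (\<phi> ` (U \<inter> U'))" "open (\<psi> ` (V \<inter> V'))"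
      using U U' B.chart_open F.chart_open by (auto intro!: B.chart_open_image F.chart_open_image)
    have "smooth_on (\<phi> ` (U \<inter> U') \<times> \<psi> ` (V \<inter> V'))
        (\<lambda>p. ((\<phi>' \<circ> inv_into U \<phi>) (fst p), (\<psi>' \<circ> inv_into V \<psi>) (snd p)))"
      by (intro smooth_on_Pair open_Times op smooth_on_fst[OF B.orthonormal_Bas]
          smooth_on_snd[OF F.orthonormal_Bas] B.chart_transition F.chart_transition U U')
    then have "smooth_on (\<phi> ` (U \<inter> U') \<times> \<psi> ` (V \<inter> V')) (map_prod \<phi>' \<psi>' \<circ> inv_into (U \<times> V) (map_prod \<phi> \<psi>))"
      by (rule smooth_on_transform[OF _ open_Times[OF op]])
        (auto simp: inv_into_map_prod B.chart_inj[OF U(1)] F.chart_inj[OF U(2)])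
    then show ?thesis by (simp add: Times_Int_Times im)
  qed
  show ?thesis
    unfolding smooth_manifold_def
  proof (intro conjI)
    show "\<exists>S :: ('eb \<times> 'ef) set. finite S \<and> span S = UNIV"
      using span by (intro exI[of _ ?E] conjI) (simp_all add: B.finite_Bas F.finite_Bas)
    show "\<forall>(W, \<kappa>)\<in>product_atlas AB AF. open W \<and> open (\<kappa> ` W) \<and> homeomorphism W (\<kappa> ` W) \<kappa> (inv_into W \<kappa>)"
      using hom by (auto simp: product_atlas_def im intro!: open_Times B.chart_open F.chart_open
          B.chart_open_range F.chart_open_range)
    show "(\<Union>(W, \<kappa>)\<in>product_atlas AB AF. W) = UNIV"
    proof -
      have "(x, y) \<in> (\<Union>(W, \<kappa>)\<in>product_atlas AB AF. W)" for x y
      proof -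
        obtain U \<phi> where "(U, \<phi>) \<in> AB" "x \<in> U" by (rule B.chart_at)
        moreover obtain V \<psi> where "(V, \<psi>) \<in> AF" "y \<in> V" by (rule F.chart_at)
        ultimately show ?thesis
          by (intro UN_I[of "(U \<times> V, map_prod \<phi> \<psi>)"]) (auto simp: product_atlas_def)
      qed
      then show ?thesis by auto
    qed
    show "\<forall>(W, \<kappa>)\<in>product_atlas AB AF. \<forall>(W', \<kappa>')\<in>product_atlas AB AF. smooth_on (\<kappa> ` (W \<inter> W')) (\<kappa>' \<circ> inv_into W \<kappa>)"
      using trans by (auto simp: product_atlas_def)
  qed
qed

locale product_manifold = B: manifold AB + F: manifold AF
  for AB :: "('b::{t2_space,second_countable_topology}, 'eb::real_inner) chart set"
    and AF :: "('f::{t2_space,second_countable_topology}, 'ef::real_inner) chart set"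
begin

abbreviation A where "A \<equiv> product_atlas AB AF"

sublocale manifold A
  by (rule manifold.intro[OF smooth_manifold_product[OF B.smooth_manifold F.smooth_manifold]])

abbreviation LB where "LB \<equiv> lift_B AB AF"
abbreviation LF where "LF \<equiv> lift_F AB AF"

lemma product_chart: "(U, \<phi>) \<in> AB \<Longrightarrow> (V, \<psi>) \<in> AF \<Longrightarrow> (U \<times> V, map_prod \<phi> \<psi>) \<in> A"
  by (auto simp: product_atlas_def)

lemma product_chart_inv:
  assumes "(U, \<phi>) \<in> AB" "(V, \<psi>) \<in> AF" "x \<in> \<phi> ` U" "y \<in> \<psi> ` V"
  shows "inv_into (U \<times> V) (map_prod \<phi> \<psi>) (x, y) = (inv_into U \<phi> x, inv_into V \<psi> y)"
  by (rule inv_into_map_prod[OF B.chart_inj[OF assms(1)] F.chart_inj[OF assms(2)] assms(3,4)])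

lemma map_prod_image: "map_prod \<phi> \<psi> ` (U \<times> V) = \<phi> ` U \<times> \<psi> ` V" by force

lemma smooth_fst: assumes "f \<in> B.C" shows "(\<lambda>z. f (fst z)) \<in> C"
  unfolding smooth_functions_def
proof clarify
  fix W \<kappa> assume "(W, \<kappa>) \<in> A"
  then obtain U \<phi> V \<psi> where U: "(U, \<phi>) \<in> AB" and V: "(V, \<psi>) \<in> AF" and W: "W = U \<times> V" "\<kappa> = map_prod \<phi> \<psi>"
    by (auto simp: product_atlas_def)
  have op: "open (\<phi> ` U)" "open (\<psi> ` V)" using U V by (simp_all add: B.chart_open_range F.chart_open_range)
  have "smooth_on (\<phi> ` U \<times> \<psi> ` V) (\<lambda>p. (f \<circ> inv_into U \<phi>) (fst p))"
    by (rule smooth_on_fst[OF B.orthonormal_Bas op B.smooth_on_chart[OF assms U]])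
  then show "smooth_on (\<kappa> ` W) ((\<lambda>z. f (fst z)) \<circ> inv_into W \<kappa>)"
    unfolding W map_prod_image
    by (rule smooth_on_transform[OF _ open_Times[OF op]]) (auto simp: product_chart_inv[OF U V])
qed

lemma smooth_snd: assumes "f \<in> F.C" shows "(\<lambda>z. f (snd z)) \<in> C"
  unfolding smooth_functions_def
proof clarify
  fix W \<kappa> assume "(W, \<kappa>) \<in> A"
  then obtain U \<phi> V \<psi> where U: "(U, \<phi>) \<in> AB" and V: "(V, \<psi>) \<in> AF" and W: "W = U \<times> V" "\<kappa> = map_prod \<phi> \<psi>"
    by (auto simp: product_atlas_def)
  have op: "open (\<phi> ` U)" "open (\<psi> ` V)" using U V by (simp_all add: B.chart_open_range F.chart_open_range)
  have "smooth_on (\<phi> ` U \<times> \<psi> ` V) (\<lambda>p. (f \<circ> inv_into V \<psi>) (snd p))"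
    by (rule smooth_on_snd[OF F.orthonormal_Bas op(2,1) F.smooth_on_chart[OF assms V]])
  then show "smooth_on (\<kappa> ` W) ((\<lambda>z. f (snd z)) \<circ> inv_into W \<kappa>)"
    unfolding W map_prod_image
    by (rule smooth_on_transform[OF _ open_Times[OF op]]) (auto simp: product_chart_inv[OF U V])
qed

lemma smooth_slice_B: assumes f: "f \<in> C" shows "(\<lambda>x. f (x, y)) \<in> B.C"
  unfolding smooth_functions_def
proof clarify
  fix U \<phi> assume U: "(U, \<phi>) \<in> AB"
  obtain V \<psi> where V: "(V, \<psi>) \<in> AF" "y \<in> V" by (rule F.chart_at)
  have op: "open (\<phi> ` U)" using U by (rule B.chart_open_range)
  have "smooth_on (\<phi> ` U) (\<lambda>x. (f \<circ> inv_into (U \<times> V) (map_prod \<phi> \<psi>)) (x, \<psi> y))"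
    by (rule smooth_on_compose[OF orthonormal_Bas op chart_open_range[OF product_chart[OF U V(1)]] _ _
          smooth_on_chart[OF f product_chart[OF U V(1)]]])
      (use V op in \<open>auto simp: map_prod_image intro!: smooth_on_Pair smooth_on_const smooth_on_bounded_linear[OF _ bounded_linear_ident]\<close>)
  then show "smooth_on (\<phi> ` U) ((\<lambda>x. f (x, y)) \<circ> inv_into U \<phi>)"
    by (rule smooth_on_transform[OF _ op]) (use V in \<open>auto simp: product_chart_inv[OF U V(1)] F.chart_inv\<close>)
qed

lemma smooth_slice_F: assumes f: "f \<in> C" shows "(\<lambda>y. f (x, y)) \<in> F.C"
  unfolding smooth_functions_def
proof clarify
  fix V \<psi> assume V: "(V, \<psi>) \<in> AF"
  obtain U \<phi> where U: "(U, \<phi>) \<in> AB" "x \<in> U" by (rule B.chart_at)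
  have op: "open (\<psi> ` V)" using V by (rule F.chart_open_range)
  have "smooth_on (\<psi> ` V) (\<lambda>y. (f \<circ> inv_into (U \<times> V) (map_prod \<phi> \<psi>)) (\<phi> x, y))"
    by (rule smooth_on_compose[OF orthonormal_Bas op chart_open_range[OF product_chart[OF U(1) V]] _ _
          smooth_on_chart[OF f product_chart[OF U(1) V]]])
      (use U op in \<open>auto simp: map_prod_image intro!: smooth_on_Pair smooth_on_const smooth_on_bounded_linear[OF _ bounded_linear_ident]\<close>)
  then show "smooth_on (\<psi> ` V) ((\<lambda>y. f (x, y)) \<circ> inv_into V \<psi>)"
    by (rule smooth_on_transform[OF _ op]) (use U in \<open>auto simp: product_chart_inv[OF U(1) V] B.chart_inv\<close>)
qed

text \<open>Both directions matter: tangent vectors are 0 on non-smooth functions, and projecting a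
  lift must give back the original operator on these too.\<close>

lemma smooth_fst_iff: "(\<lambda>z. f (fst z)) \<in> C \<longleftrightarrow> f \<in> B.C"
  using smooth_fst smooth_slice_B[of "\<lambda>z. f (fst z)"] by auto

lemma smooth_snd_iff: "(\<lambda>z. f (snd z)) \<in> C \<longleftrightarrow> f \<in> F.C"
  using smooth_snd smooth_slice_F[of "\<lambda>z. f (snd z)"] by auto

section \<open>Lifts of tangent vectors and vector fields to the product\<close>

context
  fixes U \<phi> V \<psi> and z :: "'b \<times> 'f"
  assumes U: "(U, \<phi>) \<in> AB" "fst z \<in> U" and V: "(V, \<psi>) \<in> AF" "snd z \<in> V"
begin

abbreviation (input) prod_vector where "prod_vector \<equiv> chart_vector (U \<times> V) (map_prod \<phi> \<psi>) z"

lemma z_in: "z \<in> U \<times> V" using U V by (simp add: mem_Times_iff)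

lemma product_has_derivative:
  "f \<in> C \<Longrightarrow> (f \<circ> inv_into (U \<times> V) (map_prod \<phi> \<psi>) has_derivative (\<lambda>w. prod_vector w f)) (at (\<phi> (fst z), \<psi> (snd z)))"
  using chart_has_derivative[OF product_chart[OF U(1) V(1)] z_in] by (simp add: map_prod_def split_beta)

text \<open>Chain rule along the slice x -> (x, snd z), which in the product chart is affine with
  derivative w -> (w, 0).\<close>

lemma lift_chart_vector_B: "lift_vector_B AB AF z (B.chart_vector U \<phi> (fst z) w) = prod_vector (w, 0)"
proof
  fix f
  show "lift_vector_B AB AF z (B.chart_vector U \<phi> (fst z) w) f = prod_vector (w, 0) f"
  proof (cases "f \<in> C")
    case True
    have op: "open (\<phi> ` U)" using U(1) by (rule B.chart_open_range)
    have "((\<lambda>x. (f \<circ> inv_into (U \<times> V) (map_prod \<phi> \<psi>)) (x, \<psi> (snd z))) has_derivative (\<lambda>w. prod_vector (w, 0) f)) (at (\<phi> (fst z)))"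
      by (rule has_derivative_compose[where f = "\<lambda>x. (x, \<psi> (snd z))" and f' = "\<lambda>w. (w, 0)", OF _ product_has_derivative[OF True]])
        (auto intro!: derivative_eq_intros)
    then have "((\<lambda>x. f (x, snd z)) \<circ> inv_into U \<phi> has_derivative (\<lambda>w. prod_vector (w, 0) f)) (at (\<phi> (fst z)))"
      by (rule has_derivative_transform_within_open[OF _ op])
        (use U V in \<open>auto simp: product_chart_inv[OF U(1) V(1)] F.chart_inv[OF V(1)]\<close>)
    from has_derivative_unique[OF B.chart_has_derivative[OF U smooth_slice_B[OF True]] this]
    have "B.chart_vector U \<phi> (fst z) w (\<lambda>x. f (x, snd z)) = prod_vector (w, 0) f" by (rule fun_cong)
    then show ?thesis using True by (simp add: lift_vector_B_def)
  qed (simp add: lift_vector_B_def chart_vector_def)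
qed

lemma lift_chart_vector_F: "lift_vector_F AB AF z (F.chart_vector V \<psi> (snd z) w) = prod_vector (0, w)"
proof
  fix f
  show "lift_vector_F AB AF z (F.chart_vector V \<psi> (snd z) w) f = prod_vector (0, w) f"
  proof (cases "f \<in> C")
    case True
    have op: "open (\<psi> ` V)" using V(1) by (rule F.chart_open_range)
    have "((\<lambda>y. (f \<circ> inv_into (U \<times> V) (map_prod \<phi> \<psi>)) (\<phi> (fst z), y)) has_derivative (\<lambda>w. prod_vector (0, w) f)) (at (\<psi> (snd z)))"
      by (rule has_derivative_compose[where f = "\<lambda>y. (\<phi> (fst z), y)" and f' = "\<lambda>w. (0, w)", OF _ product_has_derivative[OF True]])
        (auto intro!: derivative_eq_intros)
    then have "((\<lambda>y. f (fst z, y)) \<circ> inv_into V \<psi> has_derivative (\<lambda>w. prod_vector (0, w) f)) (at (\<psi> (snd z)))"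
      by (rule has_derivative_transform_within_open[OF _ op])
        (use U V in \<open>auto simp: product_chart_inv[OF U(1) V(1)] B.chart_inv[OF U(1)]\<close>)
    from has_derivative_unique[OF F.chart_has_derivative[OF V smooth_slice_F[OF True]] this]
    have "F.chart_vector V \<psi> (snd z) w (\<lambda>y. f (fst z, y)) = prod_vector (0, w) f" by (rule fun_cong)
    then show ?thesis using True by (simp add: lift_vector_F_def)
  qed (simp add: lift_vector_F_def chart_vector_def)
qed

lemma prod_vector_split: "prod_vector w f =
    lift_vector_B AB AF z (B.chart_vector U \<phi> (fst z) (fst w)) f + lift_vector_F AB AF z (F.chart_vector V \<psi> (snd z) (snd w)) f"
  unfolding lift_chart_vector_B lift_chart_vector_F
  using linear_add[OF chart_vector_linear[OF product_chart[OF U(1) V(1)] z_in], of "(fst w, 0)" "(0, snd w)" f] by simp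

end

lemma lift_vector_B_tangent:
  assumes "v \<in> B.T (fst z)" shows "lift_vector_B AB AF z v \<in> T z"
proof -
  obtain U \<phi> where U: "(U, \<phi>) \<in> AB" "fst z \<in> U" by (rule B.chart_at)
  obtain V \<psi> where V: "(V, \<psi>) \<in> AF" "snd z \<in> V" by (rule F.chart_at)
  obtain w where "v = B.chart_vector U \<phi> (fst z) w" using assms B.tangent_space_chart[OF U] by auto
  then show ?thesis
    using lift_chart_vector_B[OF U V] tangent_space_chart[OF product_chart[OF U(1) V(1)] z_in[OF U V]] by auto
qed

lemma lift_vector_F_tangent:
  assumes "v \<in> F.T (snd z)" shows "lift_vector_F AB AF z v \<in> T z"
proof -
  obtain U \<phi> where U: "(U, \<phi>) \<in> AB" "fst z \<in> U" by (rule B.chart_at)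
  obtain V \<psi> where V: "(V, \<psi>) \<in> AF" "snd z \<in> V" by (rule F.chart_at)
  obtain w where "v = F.chart_vector V \<psi> (snd z) w" using assms F.tangent_space_chart[OF V] by auto
  then show ?thesis
    using lift_chart_vector_F[OF U V] tangent_space_chart[OF product_chart[OF U(1) V(1)] z_in[OF U V]] by auto
qed

lemma
  assumes v: "v \<in> B.T (fst z)"
  shows push_fst_lift_B: "push_forward fst (lift_vector_B AB AF z v) = v"
    and push_snd_lift_B: "push_forward snd (lift_vector_B AB AF z v) = (\<lambda>f. 0)"
  using B.tangent_nonsmooth[OF v] B.tangent_const_fun[OF v]
  by (auto simp: push_forward_def lift_vector_B_def comp_def smooth_fst_iff)

lemma
  assumes v: "v \<in> F.T (snd z)"
  shows push_snd_lift_F: "push_forward snd (lift_vector_F AB AF z v) = v"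
    and push_fst_lift_F: "push_forward fst (lift_vector_F AB AF z v) = (\<lambda>f. 0)"
  using F.tangent_nonsmooth[OF v] F.tangent_const_fun[OF v]
  by (auto simp: push_forward_def lift_vector_F_def comp_def smooth_snd_iff)

lemma
  assumes u: "u \<in> T z"
  shows push_fst_tangent: "push_forward fst u \<in> B.T (fst z)"
    and push_snd_tangent: "push_forward snd u \<in> F.T (snd z)"
    and tangent_split: "u = (\<lambda>f. lift_vector_B AB AF z (push_forward fst u) f + lift_vector_F AB AF z (push_forward snd u) f)"
proof -
  obtain U \<phi> where U: "(U, \<phi>) \<in> AB" "fst z \<in> U" by (rule B.chart_at)
  obtain V \<psi> where V: "(V, \<psi>) \<in> AF" "snd z \<in> V" by (rule F.chart_at)
  obtain w where w: "u = chart_vector (U \<times> V) (map_prod \<phi> \<psi>) z w"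
    using u tangent_space_chart[OF product_chart[OF U(1) V(1)] z_in[OF U V]] by auto
  let ?b = "B.chart_vector U \<phi> (fst z) (fst w)" and ?f = "F.chart_vector V \<psi> (snd z) (snd w)"
  have b: "?b \<in> B.T (fst z)" and f: "?f \<in> F.T (snd z)"
    using B.tangent_space_chart[OF U] F.tangent_space_chart[OF V] by auto
  have u: "u = (\<lambda>f. lift_vector_B AB AF z ?b f + lift_vector_F AB AF z ?f f)"
    unfolding w by (rule ext) (rule prod_vector_split[OF U V])
  have pb: "push_forward fst u = ?b" and pf: "push_forward snd u = ?f"
    using push_fst_lift_B[OF b] push_snd_lift_B[OF b] push_fst_lift_F[OF f] push_snd_lift_F[OF f]
    by (auto simp: u push_forward_def fun_eq_iff)
  show "push_forward fst u \<in> B.T (fst z)" "push_forward snd u \<in> F.T (snd z)" using b f pb pf by auto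
  show "u = (\<lambda>f. lift_vector_B AB AF z (push_forward fst u) f + lift_vector_F AB AF z (push_forward snd u) f)"
    unfolding pb pf by (rule u)
qed

text \<open>The function lives on the product and need not be a pullback, so smoothness of
  \<open>X\<close> does not suffice directly. In a product chart the lift has the direction with
  coefficients X(x_e) at the first component, along the vectors (e, 0), and these coefficients are
  pullbacks of smooth functions.\<close>

lemma lift_B_smooth:
  assumes X: "X \<in> B.VF" and f: "f \<in> C" shows "(\<lambda>z. LB X z f) \<in> C"
proof (rule smooth_functions_local)
  fix z :: "'b \<times> 'f"
  obtain U \<phi> where U: "(U, \<phi>) \<in> AB" "fst z \<in> U" by (rule B.chart_at)
  obtain V \<psi> where V: "(V, \<psi>) \<in> AF" "snd z \<in> V" by (rule F.chart_at)
  obtain N x W where N: "fst z \<in> N" "N \<subseteq> U" and c: "B.coordinate_frame N x W"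
    and x: "\<forall>q\<in>N. \<forall>w e. B.chart_vector U \<phi> q w (x e) = w \<bullet> e" by (rule B.chart_frame[OF U])
  obtain N' k where N': "open N'" "z \<in> N'" "N' \<subseteq> U \<times> V" and k: "k \<in> C"
    "\<forall>q\<in>N'. chart_vector (U \<times> V) (map_prod \<phi> \<psi>) q (\<Sum>e\<in>B.Bas. X (fst q) (x e) *\<^sub>R (e, 0)) f = k q"
    by (rule chart_combination_smooth[OF product_chart[OF U(1) V(1)] z_in[OF U V]
          smooth_fst[OF B.vector_field_smooth[OF X B.coordinate_frame_smooth[OF c]]] f])
  let ?M = "N' \<inter> (N \<times> UNIV)"
  have "LB X q f = k q" if q: "q \<in> ?M" for q
  proof -
    have qU: "fst q \<in> U" "snd q \<in> V" "fst q \<in> N" "q \<in> N'" using q N' by auto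
    obtain w where w: "X (fst q) = B.chart_vector U \<phi> (fst q) w"
      using B.vector_field_tangent[OF X, of "fst q"] B.tangent_space_chart[OF U(1) qU(1)] by auto
    have "(\<Sum>e\<in>B.Bas. X (fst q) (x e) *\<^sub>R e) = (\<Sum>e\<in>B.Bas. (w \<bullet> e) *\<^sub>R e)" using x qU by (simp add: w)
    then have "w = (\<Sum>e\<in>B.Bas. X (fst q) (x e) *\<^sub>R e)" using B.orthonormal_Bas by (simp add: orthonormal_basis_def)
    then have w': "(w, 0) = (\<Sum>e\<in>B.Bas. X (fst q) (x e) *\<^sub>R (e, 0))"
      by (simp add: prod_eq_iff fst_sum snd_sum)
    have "LB X q f = chart_vector (U \<times> V) (map_prod \<phi> \<psi>) q (w, 0) f"
      unfolding lift_B_def w by (rule fun_cong[OF lift_chart_vector_B[OF U(1) qU(1) V(1) qU(2)]])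
    then show ?thesis using k(2) qU(4) by (simp only: w')
  qed
  moreover have "open ?M" using N'(1) B.coordinate_frame_open[OF c] by (intro open_Int open_Times) auto
  moreover have "z \<in> ?M" using N N' by (simp add: mem_Times_iff)
  ultimately show "\<exists>N h. open N \<and> z \<in> N \<and> h \<in> C \<and> (\<forall>q\<in>N. LB X q f = h q)"
    using k(1) by (intro exI[of _ ?M] exI[of _ k]) simp
qed

lemma lift_F_smooth:
  assumes X: "X \<in> F.VF" and f: "f \<in> C" shows "(\<lambda>z. LF X z f) \<in> C"
proof (rule smooth_functions_local)
  fix z :: "'b \<times> 'f"
  obtain U \<phi> where U: "(U, \<phi>) \<in> AB" "fst z \<in> U" by (rule B.chart_at)
  obtain V \<psi> where V: "(V, \<psi>) \<in> AF" "snd z \<in> V" by (rule F.chart_at)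
  obtain N x W where N: "snd z \<in> N" "N \<subseteq> V" and c: "F.coordinate_frame N x W"
    and x: "\<forall>q\<in>N. \<forall>w e. F.chart_vector V \<psi> q w (x e) = w \<bullet> e" by (rule F.chart_frame[OF V])
  obtain N' k where N': "open N'" "z \<in> N'" "N' \<subseteq> U \<times> V" and k: "k \<in> C"
    "\<forall>q\<in>N'. chart_vector (U \<times> V) (map_prod \<phi> \<psi>) q (\<Sum>e\<in>F.Bas. X (snd q) (x e) *\<^sub>R (0, e)) f = k q"
    by (rule chart_combination_smooth[OF product_chart[OF U(1) V(1)] z_in[OF U V]
          smooth_snd[OF F.vector_field_smooth[OF X F.coordinate_frame_smooth[OF c]]] f])
  let ?M = "N' \<inter> (UNIV \<times> N)"
  have "LF X q f = k q" if q: "q \<in> ?M" for q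
  proof -
    have qU: "fst q \<in> U" "snd q \<in> V" "snd q \<in> N" "q \<in> N'" using q N' by auto
    obtain w where w: "X (snd q) = F.chart_vector V \<psi> (snd q) w"
      using F.vector_field_tangent[OF X, of "snd q"] F.tangent_space_chart[OF V(1) qU(2)] by auto
    have "(\<Sum>e\<in>F.Bas. X (snd q) (x e) *\<^sub>R e) = (\<Sum>e\<in>F.Bas. (w \<bullet> e) *\<^sub>R e)" using x qU by (simp add: w)
    then have "w = (\<Sum>e\<in>F.Bas. X (snd q) (x e) *\<^sub>R e)" using F.orthonormal_Bas by (simp add: orthonormal_basis_def)
    then have w': "(0, w) = (\<Sum>e\<in>F.Bas. X (snd q) (x e) *\<^sub>R (0, e))"
      by (simp add: prod_eq_iff fst_sum snd_sum)
    have "LF X q f = chart_vector (U \<times> V) (map_prod \<phi> \<psi>) q (0, w) f"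
      unfolding lift_F_def w by (rule fun_cong[OF lift_chart_vector_F[OF U(1) qU(1) V(1) qU(2)]])
    then show ?thesis using k(2) qU(4) by (simp only: w')
  qed
  moreover have "open ?M" using N'(1) F.coordinate_frame_open[OF c] by (intro open_Int open_Times) auto
  moreover have "z \<in> ?M" using N N' by (simp add: mem_Times_iff)
  ultimately show "\<exists>N h. open N \<and> z \<in> N \<and> h \<in> C \<and> (\<forall>q\<in>N. LF X q f = h q)"
    using k(1) by (intro exI[of _ ?M] exI[of _ k]) simp
qed

lemma lift_B_field: "X \<in> B.VF \<Longrightarrow> LB X \<in> VF"
  using lift_vector_B_tangent[OF B.vector_field_tangent] lift_B_smooth
  by (intro vector_fieldI) (simp_all add: lift_B_def)

lemma lift_F_field: "V \<in> F.VF \<Longrightarrow> LF V \<in> VF"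
  using lift_vector_F_tangent[OF F.vector_field_tangent] lift_F_smooth
  by (intro vector_fieldI) (simp_all add: lift_F_def)

lemma
  assumes X: "X \<in> B.VF"
  shows lift_B_fst: "f \<in> B.C \<Longrightarrow> LB X z (\<lambda>z. f (fst z)) = X (fst z) f"
    and lift_B_snd: "h \<in> F.C \<Longrightarrow> LB X z (\<lambda>z. h (snd z)) = 0"
    and push_fst_field_B: "push_forward fst (LB X z) = X (fst z)"
    and push_snd_field_B: "push_forward snd (LB X z) = (\<lambda>f. 0)"
  using B.tangent_const_fun[OF B.vector_field_tangent[OF X]] push_fst_lift_B[OF B.vector_field_tangent[OF X]]
    push_snd_lift_B[OF B.vector_field_tangent[OF X]]
  by (auto simp: lift_B_def lift_vector_B_def smooth_fst_iff smooth_snd_iff)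

lemma
  assumes V: "V \<in> F.VF"
  shows lift_F_snd: "f \<in> F.C \<Longrightarrow> LF V z (\<lambda>z. f (snd z)) = V (snd z) f"
    and lift_F_fst: "h \<in> B.C \<Longrightarrow> LF V z (\<lambda>z. h (fst z)) = 0"
    and push_snd_field_F: "push_forward snd (LF V z) = V (snd z)"
    and push_fst_field_F: "push_forward fst (LF V z) = (\<lambda>f. 0)"
  using F.tangent_const_fun[OF F.vector_field_tangent[OF V]] push_snd_lift_F[OF F.vector_field_tangent[OF V]]
    push_fst_lift_F[OF F.vector_field_tangent[OF V]]
  by (auto simp: lift_F_def lift_vector_F_def smooth_fst_iff smooth_snd_iff)

text \<open>A tangent vector is the sum of the lifts of its two projections, so it is determined by
  its action on pullbacks from the factors. This is how brackets of lifts are identified.\<close>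

lemma tangent_eqI:
  assumes u: "u \<in> T z" "u' \<in> T z"
    and fst: "\<And>f. f \<in> B.C \<Longrightarrow> u (\<lambda>z. f (fst z)) = u' (\<lambda>z. f (fst z))"
    and snd: "\<And>f. f \<in> F.C \<Longrightarrow> u (\<lambda>z. f (snd z)) = u' (\<lambda>z. f (snd z))"
  shows "u = u'"
proof -
  have "push_forward fst u = push_forward fst u'"
    using fst B.tangent_nonsmooth[OF push_fst_tangent[OF u(1)]] B.tangent_nonsmooth[OF push_fst_tangent[OF u(2)]]
    by (auto simp: push_forward_def comp_def fun_eq_iff) metis
  moreover have "push_forward snd u = push_forward snd u'"
    using snd F.tangent_nonsmooth[OF push_snd_tangent[OF u(1)]] F.tangent_nonsmooth[OF push_snd_tangent[OF u(2)]]
    by (auto simp: push_forward_def comp_def fun_eq_iff) metis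
  ultimately show ?thesis using tangent_split[OF u(1)] tangent_split[OF u(2)] by simp
qed

lemma lie_bracket_lift_B:
  assumes X: "X \<in> B.VF" and Y: "Y \<in> B.VF"
  shows "lie_bracket (LB X) (LB Y) = LB (lie_bracket X Y)"
proof
  fix z
  note L = lift_B_field[OF X] lift_B_field[OF Y]
  note c = tangent_const_fun[OF vector_field_tangent[OF L(1)]] tangent_const_fun[OF vector_field_tangent[OF L(2)]]
  show "lie_bracket (LB X) (LB Y) z = LB (lie_bracket X Y) z"
  proof (rule tangent_eqI[OF lie_bracket_tangent[OF L] vector_field_tangent[OF lift_B_field[OF B.lie_bracket_field[OF X Y]]]])
    fix f assume f: "f \<in> B.C"
    show "lie_bracket (LB X) (LB Y) z (\<lambda>z. f (fst z)) = LB (lie_bracket X Y) z (\<lambda>z. f (fst z))"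
      using lift_B_fst[OF X B.vector_field_smooth[OF Y f], of z] lift_B_fst[OF Y B.vector_field_smooth[OF X f], of z]
      by (simp add: lie_bracket_def[of "LB X"] lie_derivative_def lift_B_fst[OF X f] lift_B_fst[OF Y f]
          lift_B_fst[OF B.lie_bracket_field[OF X Y] f]) (simp add: lie_bracket_def lie_derivative_def)
  next
    fix f assume f: "f \<in> F.C"
    show "lie_bracket (LB X) (LB Y) z (\<lambda>z. f (snd z)) = LB (lie_bracket X Y) z (\<lambda>z. f (snd z))"
      by (simp add: lie_bracket_def[of "LB X"] lie_derivative_def lift_B_snd[OF X f] lift_B_snd[OF Y f] c
          lift_B_snd[OF B.lie_bracket_field[OF X Y] f])
  qed
qed

lemma lie_bracket_lift_F:
  assumes X: "X \<in> F.VF" and Y: "Y \<in> F.VF"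
  shows "lie_bracket (LF X) (LF Y) = LF (lie_bracket X Y)"
proof
  fix z
  note L = lift_F_field[OF X] lift_F_field[OF Y]
  note c = tangent_const_fun[OF vector_field_tangent[OF L(1)]] tangent_const_fun[OF vector_field_tangent[OF L(2)]]
  show "lie_bracket (LF X) (LF Y) z = LF (lie_bracket X Y) z"
  proof (rule tangent_eqI[OF lie_bracket_tangent[OF L] vector_field_tangent[OF lift_F_field[OF F.lie_bracket_field[OF X Y]]]])
    fix f assume f: "f \<in> F.C"
    show "lie_bracket (LF X) (LF Y) z (\<lambda>z. f (snd z)) = LF (lie_bracket X Y) z (\<lambda>z. f (snd z))"
      using lift_F_snd[OF X F.vector_field_smooth[OF Y f], of z] lift_F_snd[OF Y F.vector_field_smooth[OF X f], of z]
      by (simp add: lie_bracket_def[of "LF X"] lie_derivative_def lift_F_snd[OF X f] lift_F_snd[OF Y f]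
          lift_F_snd[OF F.lie_bracket_field[OF X Y] f]) (simp add: lie_bracket_def lie_derivative_def)
  next
    fix f assume f: "f \<in> B.C"
    show "lie_bracket (LF X) (LF Y) z (\<lambda>z. f (fst z)) = LF (lie_bracket X Y) z (\<lambda>z. f (fst z))"
      by (simp add: lie_bracket_def[of "LF X"] lie_derivative_def lift_F_fst[OF X f] lift_F_fst[OF Y f] c
          lift_F_fst[OF F.lie_bracket_field[OF X Y] f])
  qed
qed

text \<open>Either lift kills the pullbacks from the other factor and maps the pullbacks from its
  own factor to such pullbacks, so both iterated derivatives of a pullback vanish.\<close>

lemma lie_bracket_lift_mixed:
  assumes X: "X \<in> B.VF" and V: "V \<in> F.VF"
  shows "lie_bracket (LB X) (LF V) = (\<lambda>p f. 0)"
proof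
  fix z
  note L = lift_B_field[OF X] lift_F_field[OF V]
  note c = tangent_const_fun[OF vector_field_tangent[OF L(1)]] tangent_const_fun[OF vector_field_tangent[OF L(2)]]
  show "lie_bracket (LB X) (LF V) z = (\<lambda>f. 0)"
  proof (rule tangent_eqI[OF lie_bracket_tangent[OF L] tangent_zero])
    fix f assume f: "f \<in> B.C"
    show "lie_bracket (LB X) (LF V) z (\<lambda>z. f (fst z)) = 0"
      by (simp add: lie_bracket_def lie_derivative_def lift_B_fst[OF X f] lift_F_fst[OF V f] c
          lift_F_fst[OF V B.vector_field_smooth[OF X f]])
  next
    fix f assume f: "f \<in> F.C"
    show "lie_bracket (LB X) (LF V) z (\<lambda>z. f (snd z)) = 0"
      by (simp add: lie_bracket_def lie_derivative_def lift_B_snd[OF X f] lift_F_snd[OF V f] c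
          lift_B_snd[OF X F.vector_field_smooth[OF V f]])
  qed
qed

lemma lie_bracket_lift_mixed': "X \<in> B.VF \<Longrightarrow> V \<in> F.VF \<Longrightarrow> lie_bracket (LF V) (LB X) = (\<lambda>p f. 0)"
  using lie_bracket_antisym[of "LF V" "LB X"] lie_bracket_lift_mixed[of X V] by simp

end

section \<open>Twisted products\<close>

lemma (in manifold) covector_zero_fun: "covector p (\<lambda>v. 0)"
  by (simp add: covector_def)

lemma (in nondegenerate_manifold) flat_at_sharp:
  "covector p \<beta> \<Longrightarrow> u \<in> T p \<Longrightarrow> flat A g p u (sharp A g p \<beta>) = \<beta> u"
  using metric_sym[OF _ sharp_tangent] by (simp add: flat_apply sharp_tangent metric_sharp)

locale twisted_product = B: nondegenerate_manifold AB gB + F: nondegenerate_manifold AF gF + product_manifold AB AF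
  for AB :: "('b::{t2_space,second_countable_topology}, 'eb::real_inner) chart set" and gB :: "'b metric"
    and AF :: "('f::{t2_space,second_countable_topology}, 'ef::real_inner) chart set" and gF :: "'f metric" +
  fixes b :: "'b \<times> 'f \<Rightarrow> real"
  assumes b_smooth: "b \<in> C"
    and db_zero: "\<And>z. b z = 0 \<Longrightarrow> differential A b z = (\<lambda>v. 0)"
begin

abbreviation G where "G \<equiv> twisted_metric gB gF b"

lemma smooth_metric_fst: "X \<in> B.VF \<Longrightarrow> Y \<in> B.VF \<Longrightarrow> (\<lambda>z. metric_fun gB X Y (fst z)) \<in> C"
  by (rule smooth_fst[OF B.metric_fun_smooth])

lemma smooth_metric_snd: "X \<in> F.VF \<Longrightarrow> Y \<in> F.VF \<Longrightarrow> (\<lambda>z. metric_fun gF X Y (snd z)) \<in> C"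
  by (rule smooth_snd[OF F.metric_fun_smooth])

lemma singular_metric_twisted: "singular_metric A G"
  unfolding singular_metric_def
proof (intro conjI allI ballI)
  fix z u v assume u: "u \<in> T z" and v: "v \<in> T z"
  show "G z u v = G z v u"
    using B.metric_sym[OF push_fst_tangent[OF u] push_fst_tangent[OF v]]
      F.metric_sym[OF push_snd_tangent[OF u] push_snd_tangent[OF v]] by (simp add: twisted_metric_def)
  fix w c assume w: "w \<in> T z"
  show "G z (\<lambda>f. u f + c * v f) w = G z u w + c * G z v w"
    using B.metric_add_scale[OF push_fst_tangent[OF u] push_fst_tangent[OF v] push_fst_tangent[OF w], of c]
      F.metric_add_scale[OF push_snd_tangent[OF u] push_snd_tangent[OF v] push_snd_tangent[OF w], of c]
    by (simp add: twisted_metric_def push_forward_def algebra_simps)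
next
  fix X Y assume X: "X \<in> VF" and Y: "Y \<in> VF"
  show "metric_fun G X Y \<in> C"
    unfolding metric_fun_def twisted_metric_def
    by (intro smooth_add smooth_mult smooth_power b_smooth
        B.metric_pullback_smooth[OF manifold_axioms continuous_on_fst[OF continuous_on_id] smooth_fst push_fst_tangent X Y]
        F.metric_pullback_smooth[OF manifold_axioms continuous_on_snd[OF continuous_on_id] smooth_snd push_snd_tangent X Y])
qed

sublocale metric_manifold A G
  by unfold_locales (rule singular_metric_twisted)

lemma metric_lift_B:
  assumes v: "v \<in> B.T (fst z)" and u: "u \<in> T z"
  shows "G z (lift_vector_B AB AF z v) u = gB (fst z) v (push_forward fst u)"
  using F.metric_zero_left[OF push_snd_tangent[OF u]]
  by (simp add: twisted_metric_def push_fst_lift_B[OF v] push_snd_lift_B[OF v])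

lemma metric_lift_F:
  assumes v: "v \<in> F.T (snd z)" and u: "u \<in> T z"
  shows "G z (lift_vector_F AB AF z v) u = (b z)\<^sup>2 * gF (snd z) v (push_forward snd u)"
  using B.metric_zero_left[OF push_fst_tangent[OF u]]
  by (simp add: twisted_metric_def push_snd_lift_F[OF v] push_fst_lift_F[OF v])

lemma metric_rank_nonzero:
  assumes bz: "b z \<noteq> 0" shows "metric_rank A G z = card Bas"
proof (rule metric_rank_nondegenerate)
  fix u assume u: "u \<in> T z" and 0: "\<forall>v\<in>T z. G z u v = 0"
  have "push_forward fst u = (\<lambda>f. 0)"
  proof (rule B.nondegenerate_at[OF push_fst_tangent[OF u]], rule ballI)
    fix v assume v: "v \<in> B.T (fst z)"
    have "G z (lift_vector_B AB AF z v) u = 0"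
      using 0 lift_vector_B_tangent[OF v] metric_sym[OF u] by simp
    then show "gB (fst z) (push_forward fst u) v = 0"
      using metric_lift_B[OF v u] B.metric_sym[OF v push_fst_tangent[OF u]] by simp
  qed
  moreover have "push_forward snd u = (\<lambda>f. 0)"
  proof (rule F.nondegenerate_at[OF push_snd_tangent[OF u]], rule ballI)
    fix v assume v: "v \<in> F.T (snd z)"
    have "G z (lift_vector_F AB AF z v) u = 0"
      using 0 lift_vector_F_tangent[OF v] metric_sym[OF u] by simp
    then show "gF (snd z) (push_forward snd u) v = 0"
      using metric_lift_F[OF v u] F.metric_sym[OF v push_snd_tangent[OF u]] bz by simp
  qed
  ultimately show "u = (\<lambda>f. 0)"
    using tangent_split[OF u] by (simp add: lift_vector_B_def lift_vector_F_def)
qed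

text \<open>At a zero of b the fibre directions make up the radical, and the lifts of vectors of the
  base represent the tangent space modulo it.\<close>

lemma metric_rank_zero:
  assumes bz: "b z = 0" shows "metric_rank A G z = card B.Bas"
proof -
  obtain L :: "'eb \<Rightarrow> 'b tangent" where
    L: "\<forall>a b w w' f. L (a *\<^sub>R w + b *\<^sub>R w') f = a * L w f + b * L w' f" "inj L" "range L = B.T (fst z)"
    by (rule B.tangent_parametrization)
  have LT: "L w \<in> B.T (fst z)" for w using L(3) by auto
  have L0: "L 0 = (\<lambda>f. 0)" using L(1)[rule_format, of 0 0 0 0] by auto
  show ?thesis
  proof (rule metric_rank_eq[OF B.orthonormal_Bas])
    show "lift_vector_B AB AF z (L w) \<in> T z" for w by (rule lift_vector_B_tangent[OF LT])
    show "lift_vector_B AB AF z (L (a *\<^sub>R w + c *\<^sub>R w')) f =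
        a * lift_vector_B AB AF z (L w) f + c * lift_vector_B AB AF z (L w') f" for a c w w' f
      using L(1) by (simp add: lift_vector_B_def)
    show "\<exists>w. \<forall>v\<in>T z. G z u v = G z (lift_vector_B AB AF z (L w)) v" if u: "u \<in> T z" for u
    proof -
      obtain w where w: "push_forward fst u = L w" using push_fst_tangent[OF u] L(3) by auto
      have "G z u v = G z (lift_vector_B AB AF z (L w)) v" if "v \<in> T z" for v
        unfolding metric_lift_B[OF LT that] using bz w by (simp add: twisted_metric_def)
      then show ?thesis by blast
    qed
    show "w = 0" if 0: "\<forall>v\<in>T z. G z (lift_vector_B AB AF z (L w)) v = 0" for w
    proof -
      have "L w = (\<lambda>f. 0)"
      proof (rule B.nondegenerate_at[OF LT], rule ballI)
        fix v assume v: "v \<in> B.T (fst z)"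
        show "gB (fst z) (L w) v = 0"
          using 0 lift_vector_B_tangent[OF v] metric_lift_B[OF LT lift_vector_B_tangent[OF v], of w] push_fst_lift_B[OF v]
          by simp
      qed
      then show ?thesis using L0 injD[OF L(2), of w 0] by simp
    qed
  qed
qed

text \<open>A point lies either in the closure of the open set b \<noteq> 0, all of whose points are
  regular, or in the interior of b = 0, where it is itself regular. Nothing is claimed about the
  rank near the boundary between the two.\<close>

lemma regular_points_dense: "closure (regular_points A G) = UNIV"
proof -
  let ?S = "{z. b z \<noteq> 0}"
  have "z \<in> closure (regular_points A G)" for z
  proof (cases "z \<in> closure ?S")
    case True
    have "open ?S" using smooth_functions_continuous[OF b_smooth] by (intro open_Collect_neq continuous_on_const)
    then have "q \<in> regular_points A G" if "q \<in> ?S" for q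
      using that metric_rank_nonzero unfolding regular_points_def mem_Collect_eq by (intro exI[of _ ?S]) simp
    then have "?S \<subseteq> regular_points A G" by (rule subsetI)
    from set_mp[OF closure_mono[OF this] True] show ?thesis .
  next
    case False
    have "open (- closure ?S)" by (rule open_Compl[OF closed_closure])
    moreover have b0: "b q = 0" if "q \<in> - closure ?S" for q using that closure_subset[of ?S] by auto
    moreover have "z \<in> - closure ?S" using False by simp
    ultimately have "z \<in> regular_points A G"
      using metric_rank_zero[OF b0] unfolding regular_points_def mem_Collect_eq
      by (intro exI[of _ "- closure ?S"]) metis
    then show ?thesis by (rule set_mp[OF closure_subset])
  qed
  then show ?thesis by auto
qed

text \<open>A form with parts \<open>\<alpha>\<close> along \<open>B\<close> and \<open>b \<alpha>'\<close> along \<open>F\<close>. The factor \<open>b\<close> cancels the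
  degeneracy of the metric along \<open>F\<close>, which makes contractions smooth where \<open>b\<close> vanishes.\<close>

definition split_form where
  "split_form \<omega> \<alpha> \<alpha>' \<longleftrightarrow> smooth_form \<omega> \<and>
     (\<forall>z. B.covector (fst z) (\<alpha> z) \<and> F.covector (snd z) (\<alpha>' z)) \<and>
     (\<forall>X\<in>B.VF. (\<lambda>z. \<alpha> z (X (fst z))) \<in> C \<and> (\<forall>z. \<omega> (LB X) z = \<alpha> z (X (fst z)))) \<and>
     (\<forall>V\<in>F.VF. (\<lambda>z. \<alpha>' z (V (snd z))) \<in> C \<and> (\<forall>z. \<omega> (LF V) z = b z * \<alpha>' z (V (snd z)))) \<and>
     (\<forall>z. b z = 0 \<longrightarrow> \<alpha>' z = (\<lambda>v. 0))"

lemma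
  assumes "split_form \<omega> \<alpha> \<alpha>'"
  shows split_form_smooth: "smooth_form \<omega>"
    and split_form_covector: "B.covector (fst z) (\<alpha> z)" "F.covector (snd z) (\<alpha>' z)"
    and split_form_B: "X \<in> B.VF \<Longrightarrow> (\<lambda>z. \<alpha> z (X (fst z))) \<in> C" "X \<in> B.VF \<Longrightarrow> \<omega> (LB X) z = \<alpha> z (X (fst z))"
    and split_form_F: "V \<in> F.VF \<Longrightarrow> (\<lambda>z. \<alpha>' z (V (snd z))) \<in> C" "V \<in> F.VF \<Longrightarrow> \<omega> (LF V) z = b z * \<alpha>' z (V (snd z))"
    and split_form_zero: "b z = 0 \<Longrightarrow> \<alpha>' z = (\<lambda>v. 0)"
  using assms unfolding split_form_def by (simp_all del: split_paired_All)

lemma split_form_covector_at: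
  assumes s: "split_form \<omega> \<alpha> \<alpha>'" and u: "u \<in> T z"
  shows "covector_at A \<omega> z u = \<alpha> z (push_forward fst u) + b z * \<alpha>' z (push_forward snd u)"
proof -
  obtain X where X: "X \<in> B.VF" "X (fst z) = push_forward fst u" by (rule B.field_through[OF push_fst_tangent[OF u]])
  obtain V where V: "V \<in> F.VF" "V (snd z) = push_forward snd u" by (rule F.field_through[OF push_snd_tangent[OF u]])
  have "(\<lambda>p f. LB X p f + LF V p f) z = u"
    using tangent_split[OF u] X(2) V(2) by (simp add: lift_B_def lift_F_def)
  then have "covector_at A \<omega> z u = \<omega> (\<lambda>p f. LB X p f + LF V p f) z"
    using covector_at_eq[OF split_form_smooth[OF s] field_add[OF lift_B_field[OF X(1)] lift_F_field[OF V(1)]], of z] by simp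
  then show ?thesis
    using smooth_form_add[OF split_form_smooth[OF s] lift_B_field[OF X(1)] lift_F_field[OF V(1)], of z]
      split_form_B(2)[OF s X(1)] split_form_F(2)[OF s V(1)] X V by simp
qed

text \<open>The metric along the fibre multiplies by b^2, so 1/b times the g_F-dual of the fibre
  part has flat b \<alpha>'. Where b = 0 that term disappears, which is correct because the form
  then has only its part along B.\<close>

lemma split_form_sharp:
  assumes s: "split_form \<omega> \<alpha> \<alpha>'"
  defines "u \<equiv> \<lambda>z f. lift_vector_B AB AF z (sharp AB gB (fst z) (\<alpha> z)) f
      + inverse (b z) * lift_vector_F AB AF z (sharp AF gF (snd z) (\<alpha>' z)) f"
  shows "u z \<in> T z" "covector_at A \<omega> z = flat A G z (u z)"
    "push_forward fst (u z) = sharp AB gB (fst z) (\<alpha> z)"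
    "push_forward snd (u z) = (\<lambda>f. inverse (b z) * sharp AF gF (snd z) (\<alpha>' z) f)"
proof -
  note cov = split_form_covector[OF s, of z]
  note sT = B.sharp_tangent[OF cov(1)] F.sharp_tangent[OF cov(2)]
  note lT = lift_vector_B_tangent[OF sT(1)] lift_vector_F_tangent[OF sT(2)]
  show uT: "u z \<in> T z" unfolding u_def by (rule tangent_add[OF lT(1) tangent_scale[OF lT(2)]])
  show "push_forward fst (u z) = sharp AB gB (fst z) (\<alpha> z)"
    using fun_cong[OF push_fst_lift_B[OF sT(1)]] fun_cong[OF push_fst_lift_F[OF sT(2)]]
    by (auto simp: u_def push_forward_def)
  show "push_forward snd (u z) = (\<lambda>f. inverse (b z) * sharp AF gF (snd z) (\<alpha>' z) f)"
    using fun_cong[OF push_snd_lift_B[OF sT(1)]] fun_cong[OF push_snd_lift_F[OF sT(2)]]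
    by (auto simp: u_def push_forward_def)
  show "covector_at A \<omega> z = flat A G z (u z)"
  proof (rule covector_eqI[OF covector_covector_at[OF split_form_smooth[OF s]] covector_metric[OF uT]])
    fix v assume v: "v \<in> T z"
    have "G z (u z) v = 1 * G z (lift_vector_B AB AF z (sharp AB gB (fst z) (\<alpha> z))) v
        + inverse (b z) * G z (lift_vector_F AB AF z (sharp AF gF (snd z) (\<alpha>' z))) v"
      using metric_lincomb_left[OF lT v, of 1 "inverse (b z)"] by (simp add: u_def)
    also have "\<dots> = \<alpha> z (push_forward fst v) + inverse (b z) * (b z)\<^sup>2 * \<alpha>' z (push_forward snd v)"
      using metric_lift_B[OF sT(1) v] metric_lift_F[OF sT(2) v]
        B.metric_sharp[OF cov(1) push_fst_tangent[OF v]] F.metric_sharp[OF cov(2) push_snd_tangent[OF v]] by simp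
    \<comment> \<open>True also at b z = 0, where both sides are 0 under the convention for
      \<open>inverse 0\<close>.\<close>
    also have "inverse (b z) * (b z)\<^sup>2 = b z" by (cases "b z = 0") (simp_all add: power2_eq_square)
    finally show "covector_at A \<omega> z v = flat A G z (u z) v"
      using split_form_covector_at[OF s v] flat_apply[OF v] by simp
  qed
qed

lemma contraction_split:
  assumes s: "split_form \<omega> \<alpha> \<alpha>'" and t: "split_form \<tau> \<beta> \<beta>'"
  shows "contraction A G \<omega> \<tau> =
    (\<lambda>z. inverse_metric AB gB (fst z) (\<alpha> z) (\<beta> z) + inverse_metric AF gF (snd z) (\<alpha>' z) (\<beta>' z))"
proof (rule contraction_eqI[OF regular_points_dense])
  note cs = split_form_covector[OF s] and ct = split_form_covector[OF t]
  show "(\<lambda>z. inverse_metric AB gB (fst z) (\<alpha> z) (\<beta> z) + inverse_metric AF gF (snd z) (\<alpha>' z) (\<beta>' z)) \<in> C"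
    by (intro smooth_add
        B.inverse_metric_pullback_smooth[OF manifold_axioms continuous_on_fst[OF continuous_on_id] smooth_fst
          cs(1) ct(1) split_form_B(1)[OF s] split_form_B(1)[OF t]]
        F.inverse_metric_pullback_smooth[OF manifold_axioms continuous_on_snd[OF continuous_on_id] smooth_snd
          cs(2) ct(2) split_form_F(1)[OF s] split_form_F(1)[OF t]])
  fix z
  have "inverse_metric AB gB (fst z) (\<alpha> z) (\<beta> z) + inverse_metric AF gF (snd z) (\<alpha>' z) (\<beta>' z) =
      G z (\<lambda>f. lift_vector_B AB AF z (sharp AB gB (fst z) (\<alpha> z)) f
            + inverse (b z) * lift_vector_F AB AF z (sharp AF gF (snd z) (\<alpha>' z)) f)
          (\<lambda>f. lift_vector_B AB AF z (sharp AB gB (fst z) (\<beta> z)) f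
            + inverse (b z) * lift_vector_F AB AF z (sharp AF gF (snd z) (\<beta>' z)) f)" (is "_ = G z ?u ?v")
  proof -
    note sT = F.sharp_tangent[OF cs(2), of z] F.sharp_tangent[OF ct(2), of z]
    have "gF (snd z) (\<lambda>f. inverse (b z) * sharp AF gF (snd z) (\<alpha>' z) f) (\<lambda>f. inverse (b z) * sharp AF gF (snd z) (\<beta>' z) f)
        = inverse (b z) * (inverse (b z) * inverse_metric AF gF (snd z) (\<alpha>' z) (\<beta>' z))"
      using F.metric_lincomb_left[OF sT(1,1) F.tangent_scale[OF sT(2)], of "inverse (b z)" 0 "inverse (b z)"]
        F.metric_lincomb_right[OF sT(2,2,1), of "inverse (b z)" 0]
      by (simp add: inverse_metric_def)
    then have G: "G z ?u ?v = inverse_metric AB gB (fst z) (\<alpha> z) (\<beta> z) +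
        (b z)\<^sup>2 * (inverse (b z) * (inverse (b z) * inverse_metric AF gF (snd z) (\<alpha>' z) (\<beta>' z)))"
      by (simp add: twisted_metric_def split_form_sharp(3,4)[OF s] split_form_sharp(3,4)[OF t] inverse_metric_def)
    show ?thesis
    proof (cases "b z = 0")
      \<comment> \<open>The fibre term of the inner product is 0 here, so the inverse metric of the
        fibre parts must be 0 too; this is why \<open>split_form\<close> makes the fibre part vanish
        together with b.\<close>
      case True
      then have "inverse_metric AF gF (snd z) (\<alpha>' z) (\<beta>' z) = 0"
        using F.inverse_metric_left[OF cs(2) ct(2), of z] by (simp add: split_form_zero[OF s])
      then show ?thesis unfolding G by simp
    next
      case False
      then show ?thesis unfolding G by (simp add: power2_eq_square field_simps)
    qed
  qed
  then show "\<exists>u\<in>T z. \<exists>v\<in>T z. covector_at A \<omega> z = flat A G z u \<and> covector_at A \<tau> z = flat A G z v \<and>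
      inverse_metric AB gB (fst z) (\<alpha> z) (\<beta> z) + inverse_metric AF gF (snd z) (\<alpha>' z) (\<beta>' z) = G z u v"
    using split_form_sharp(2)[OF s, of z] split_form_sharp(2)[OF t, of z]
    by (intro bexI[OF _ split_form_sharp(1)[OF s]] bexI[OF _ split_form_sharp(1)[OF t]]) simp
qed

end

lemma (in metric_manifold) metric_fun_zero:
  assumes "X \<in> VF"
  shows "metric_fun g X (\<lambda>p f. 0) p = 0" "metric_fun g (\<lambda>p f. 0) X p = 0"
  using metric_zero_left[OF vector_field_tangent[OF assms]] metric_sym[OF tangent_zero vector_field_tangent[OF assms]]
  by (simp_all add: metric_fun_def)

section \<open>The metric and the Koszul form on lifted fields\<close>

context twisted_product
begin

lemma metric_BB: "X \<in> B.VF \<Longrightarrow> Y \<in> B.VF \<Longrightarrow> metric_fun G (LB X) (LB Y) = (\<lambda>z. metric_fun gB X Y (fst z))"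
  using F.metric_zero_left[OF F.tangent_zero]
  by (simp add: metric_fun_def twisted_metric_def push_fst_field_B push_snd_field_B)

lemma metric_FF: "U \<in> F.VF \<Longrightarrow> V \<in> F.VF \<Longrightarrow> metric_fun G (LF U) (LF V) = (\<lambda>z. (b z)\<^sup>2 * metric_fun gF U V (snd z))"
  using B.metric_zero_left[OF B.tangent_zero]
  by (simp add: metric_fun_def twisted_metric_def push_fst_field_F push_snd_field_F)

lemma metric_BF: "X \<in> B.VF \<Longrightarrow> V \<in> F.VF \<Longrightarrow> metric_fun G (LB X) (LF V) = (\<lambda>z. 0)"
  using B.metric_zero_left[OF B.tangent_zero] F.metric_zero_left[OF F.vector_field_tangent]
    B.metric_sym[OF B.tangent_zero B.vector_field_tangent] B.metric_zero_left[OF B.vector_field_tangent]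
  by (simp add: metric_fun_def twisted_metric_def push_fst_field_F push_snd_field_F push_fst_field_B push_snd_field_B)

lemma metric_FB: "X \<in> B.VF \<Longrightarrow> V \<in> F.VF \<Longrightarrow> metric_fun G (LF V) (LB X) = (\<lambda>z. 0)"
  using metric_fun_sym[OF lift_F_field lift_B_field] metric_BF by simp

lemma derivative_metric_fst_B:
  "X \<in> B.VF \<Longrightarrow> Y \<in> B.VF \<Longrightarrow> Z \<in> B.VF \<Longrightarrow>
    LB X z (\<lambda>z. metric_fun gB Y Z (fst z)) = X (fst z) (metric_fun gB Y Z)"
  by (rule lift_B_fst[OF _ B.metric_fun_smooth])

lemma derivative_metric_fst_F:
  "V \<in> F.VF \<Longrightarrow> Y \<in> B.VF \<Longrightarrow> Z \<in> B.VF \<Longrightarrow> LF V z (\<lambda>z. metric_fun gB Y Z (fst z)) = 0"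
  by (rule lift_F_fst[OF _ B.metric_fun_smooth])

lemma derivative_metric_snd_B:
  "X \<in> B.VF \<Longrightarrow> V \<in> F.VF \<Longrightarrow> W \<in> F.VF \<Longrightarrow> LB X z (\<lambda>z. metric_fun gF V W (snd z)) = 0"
  by (rule lift_B_snd[OF _ F.metric_fun_smooth])

lemma derivative_metric_snd_F:
  "U \<in> F.VF \<Longrightarrow> V \<in> F.VF \<Longrightarrow> W \<in> F.VF \<Longrightarrow>
    LF U z (\<lambda>z. metric_fun gF V W (snd z)) = U (snd z) (metric_fun gF V W)"
  by (rule lift_F_snd[OF _ F.metric_fun_smooth])

lemma derivative_square_B:
  "X \<in> B.VF \<Longrightarrow> V \<in> F.VF \<Longrightarrow> W \<in> F.VF \<Longrightarrow>
    LB X z (\<lambda>z. (b z)\<^sup>2 * metric_fun gF V W (snd z)) = 2 * b z * LB X z b * metric_fun gF V W (snd z)"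
  using tangent_mult_fun[OF vector_field_tangent[OF lift_B_field] smooth_power[OF b_smooth] smooth_metric_snd, of X V W z 2]
    tangent_power2_fun[OF vector_field_tangent[OF lift_B_field] b_smooth, of X z]
  by (simp add: derivative_metric_snd_B)

lemma derivative_square_F:
  "U \<in> F.VF \<Longrightarrow> V \<in> F.VF \<Longrightarrow> W \<in> F.VF \<Longrightarrow>
    LF U z (\<lambda>z. (b z)\<^sup>2 * metric_fun gF V W (snd z)) =
      2 * b z * LF U z b * metric_fun gF V W (snd z) + (b z)\<^sup>2 * U (snd z) (metric_fun gF V W)"
  using tangent_mult_fun[OF vector_field_tangent[OF lift_F_field] smooth_power[OF b_smooth] smooth_metric_snd, of U V W z 2]
    tangent_power2_fun[OF vector_field_tangent[OF lift_F_field] b_smooth, of U z]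
  by (simp add: derivative_metric_snd_F)

lemma derivative_zero_B: "X \<in> B.VF \<Longrightarrow> LB X z (\<lambda>z. 0) = 0"
  by (rule tangent_const_fun[OF vector_field_tangent[OF lift_B_field]])

lemma derivative_zero_F: "V \<in> F.VF \<Longrightarrow> LF V z (\<lambda>z. 0) = 0"
  by (rule tangent_const_fun[OF vector_field_tangent[OF lift_F_field]])

lemmas koszul_lift_simps = koszul_def metric_BB metric_FF metric_BF metric_FB
  derivative_metric_fst_B derivative_metric_fst_F derivative_square_B derivative_square_F
  derivative_zero_B derivative_zero_F lie_bracket_lift_B lie_bracket_lift_F lie_bracket_lift_mixed
  lie_bracket_lift_mixed' B.lie_bracket_field F.lie_bracket_field
  metric_fun_zero[OF lift_B_field] metric_fun_zero[OF lift_F_field]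

lemma koszul_BBB: "X \<in> B.VF \<Longrightarrow> Y \<in> B.VF \<Longrightarrow> Z \<in> B.VF \<Longrightarrow>
    koszul G (LB X) (LB Y) (LB Z) z = koszul gB X Y Z (fst z)"
  by (simp add: koszul_lift_simps)

lemma koszul_BBF: "X \<in> B.VF \<Longrightarrow> Y \<in> B.VF \<Longrightarrow> W \<in> F.VF \<Longrightarrow>
    koszul G (LB X) (LB Y) (LF W) z = 0"
  by (simp add: koszul_lift_simps)

lemma koszul_BFB: "X \<in> B.VF \<Longrightarrow> Z \<in> B.VF \<Longrightarrow> V \<in> F.VF \<Longrightarrow>
    koszul G (LB X) (LF V) (LB Z) z = 0"
  by (simp add: koszul_lift_simps)

lemma koszul_FBB: "X \<in> B.VF \<Longrightarrow> Z \<in> B.VF \<Longrightarrow> V \<in> F.VF \<Longrightarrow>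
    koszul G (LF V) (LB X) (LB Z) z = 0"
  by (simp add: koszul_lift_simps)

lemma koszul_BFF: "X \<in> B.VF \<Longrightarrow> V \<in> F.VF \<Longrightarrow> W \<in> F.VF \<Longrightarrow>
    koszul G (LB X) (LF V) (LF W) z = b z * LB X z b * metric_fun gF V W (snd z)"
  by (simp add: koszul_lift_simps)

lemma koszul_FBF: "X \<in> B.VF \<Longrightarrow> V \<in> F.VF \<Longrightarrow> W \<in> F.VF \<Longrightarrow>
    koszul G (LF V) (LB X) (LF W) z = b z * LB X z b * metric_fun gF V W (snd z)"
  by (simp add: koszul_lift_simps F.metric_fun_sym[of V W])

lemma koszul_FFB: "X \<in> B.VF \<Longrightarrow> U \<in> F.VF \<Longrightarrow> V \<in> F.VF \<Longrightarrow>
    koszul G (LF U) (LF V) (LB X) z = - (b z * LB X z b * metric_fun gF U V (snd z))"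
  by (simp add: koszul_lift_simps)

lemma koszul_FFF: "U \<in> F.VF \<Longrightarrow> V \<in> F.VF \<Longrightarrow> W \<in> F.VF \<Longrightarrow>
    koszul G (LF U) (LF V) (LF W) z = (b z)\<^sup>2 * koszul gF U V W (snd z) +
    b z * (LF U z b * metric_fun gF V W (snd z) + LF V z b * metric_fun gF U W (snd z) - LF W z b * metric_fun gF U V (snd z))"
  by (simp add: koszul_lift_simps F.metric_fun_sym[of W U]) (simp add: field_simps)

definition db_B where "db_B z = restrict_B AB AF z (differential A b z)"
definition db_F where "db_F z = restrict_F AB AF z (differential A b z)"

lemma db_B_apply: "X \<in> B.VF \<Longrightarrow> db_B z (X (fst z)) = LB X z b"
  using B.vector_field_tangent lift_vector_B_tangent
  by (simp add: db_B_def restrict_B_def differential_def lift_B_def)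

lemma db_F_apply: "V \<in> F.VF \<Longrightarrow> db_F z (V (snd z)) = LF V z b"
  using F.vector_field_tangent lift_vector_F_tangent
  by (simp add: db_F_def restrict_F_def differential_def lift_F_def)

lemma covector_db_B: "B.covector (fst z) (db_B z)"
proof -
  have "db_B z v = (if v \<in> B.T (fst z) then v (\<lambda>x. b (x, snd z)) else 0)" for v
    using lift_vector_B_tangent[of v z] b_smooth
    by (simp add: db_B_def restrict_B_def differential_def) (simp add: lift_vector_B_def)
  then show ?thesis by (simp add: B.covector_def B.tangent_lincomb)
qed

lemma covector_db_F: "F.covector (snd z) (db_F z)"
proof -
  have "db_F z v = (if v \<in> F.T (snd z) then v (\<lambda>y. b (fst z, y)) else 0)" for v
    using lift_vector_F_tangent[of v z] b_smooth
    by (simp add: db_F_def restrict_F_def differential_def) (simp add: lift_vector_F_def)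
  then show ?thesis by (simp add: F.covector_def F.tangent_lincomb)
qed

text \<open>The hypothesis on db enters through these facts: they make the fibre parts of the Koszul
  forms vanish where b does, as \<open>split_form\<close> demands.\<close>

lemma lift_b_zero:
  assumes "b z = 0"
  shows "X \<in> B.VF \<Longrightarrow> LB X z b = 0" "V \<in> F.VF \<Longrightarrow> LF V z b = 0" "db_F z = (\<lambda>v. 0)"
proof -
  have d: "v b = 0" if "v \<in> T z" for v
    using fun_cong[OF db_zero[OF assms], of v] that by (simp add: differential_def)
  show "X \<in> B.VF \<Longrightarrow> LB X z b = 0" "V \<in> F.VF \<Longrightarrow> LF V z b = 0"
    using d vector_field_tangent lift_B_field lift_F_field by auto
  show "db_F z = (\<lambda>v. 0)" by (simp add: db_F_def db_zero[OF assms] restrict_F_def)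
qed

lemma smooth_derivative_b:
  "X \<in> B.VF \<Longrightarrow> (\<lambda>z. LB X z b) \<in> C" "V \<in> F.VF \<Longrightarrow> (\<lambda>z. LF V z b) \<in> C"
  using lift_B_smooth lift_F_smooth b_smooth by auto

end

section \<open>The semi-symmetric Koszul form on lifted fields\<close>

locale twisted_product_field = twisted_product AB gB AF gF b
  for AB :: "('b::{t2_space,second_countable_topology}, 'eb::real_inner) chart set" and gB :: "'b metric"
    and AF :: "('f::{t2_space,second_countable_topology}, 'ef::real_inner) chart set" and gF :: "'f metric"
    and b :: "'b \<times> 'f \<Rightarrow> real" +
  fixes P :: "'b vfield"
  assumes P: "P \<in> B.VF"
begin

abbreviation KB where "KB \<equiv> semi_symmetric_koszul gB P"
abbreviation K where "K \<equiv> semi_symmetric_koszul G (LB P)"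

lemma K_BBB: "X \<in> B.VF \<Longrightarrow> Y \<in> B.VF \<Longrightarrow> Z \<in> B.VF \<Longrightarrow>
    K (LB X) (LB Y) (LB Z) = (\<lambda>z. KB X Y Z (fst z))"
  by (simp add: semi_symmetric_koszul_def koszul_BBB metric_BB P)

lemma K_BBF: "X \<in> B.VF \<Longrightarrow> Y \<in> B.VF \<Longrightarrow> W \<in> F.VF \<Longrightarrow>
    K (LB X) (LB Y) (LF W) = (\<lambda>z. 0)"
  by (simp add: semi_symmetric_koszul_def koszul_BBF metric_BF P)

lemma K_BFB: "X \<in> B.VF \<Longrightarrow> Z \<in> B.VF \<Longrightarrow> V \<in> F.VF \<Longrightarrow>
    K (LB X) (LF V) (LB Z) = (\<lambda>z. 0)"
  by (simp add: semi_symmetric_koszul_def koszul_BFB metric_BF metric_FB P)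

lemma K_FBB: "X \<in> B.VF \<Longrightarrow> Z \<in> B.VF \<Longrightarrow> V \<in> F.VF \<Longrightarrow>
    K (LF V) (LB X) (LB Z) = (\<lambda>z. 0)"
  by (simp add: semi_symmetric_koszul_def koszul_FBB metric_BF metric_FB P)

text \<open>One factor b is pulled out front here and in the other forms with an argument along F in
  the last place: what is left is the fibre part in the sense of \<open>split_form\<close>.\<close>

lemma K_BFF: "X \<in> B.VF \<Longrightarrow> V \<in> F.VF \<Longrightarrow> W \<in> F.VF \<Longrightarrow>
    K (LB X) (LF V) (LF W) = (\<lambda>z. b z * (LB X z b * metric_fun gF V W (snd z)))"
  by (simp add: semi_symmetric_koszul_def koszul_BFF metric_BF metric_FB P mult.assoc)

lemma K_FBF: "X \<in> B.VF \<Longrightarrow> V \<in> F.VF \<Longrightarrow> W \<in> F.VF \<Longrightarrow>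
    K (LF V) (LB X) (LF W) =
    (\<lambda>z. b z * ((LB X z b + b z * metric_fun gB X P (fst z)) * metric_fun gF V W (snd z)))"
  by (simp add: semi_symmetric_koszul_def koszul_FBF metric_BB metric_FF metric_BF metric_FB P
      algebra_simps power2_eq_square)

lemma K_FFB: "X \<in> B.VF \<Longrightarrow> U \<in> F.VF \<Longrightarrow> V \<in> F.VF \<Longrightarrow>
    K (LF U) (LF V) (LB X) =
    (\<lambda>z. - (b z * metric_fun gF U V (snd z)) * (LB X z b + b z * metric_fun gB P X (fst z)))"
  by (simp add: semi_symmetric_koszul_def koszul_FFB metric_BB metric_FF metric_BF metric_FB P
      algebra_simps power2_eq_square)

text \<open>P is tangent to B, so both correction terms vanish by orthogonality of the
  factors.\<close>

lemma K_FFF: "U \<in> F.VF \<Longrightarrow> V \<in> F.VF \<Longrightarrow> W \<in> F.VF \<Longrightarrow>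
    K (LF U) (LF V) (LF W) = (\<lambda>z. b z * (b z * koszul gF U V W (snd z) +
    (LF U z b * metric_fun gF V W (snd z) + LF V z b * metric_fun gF U W (snd z) - metric_fun gF U V (snd z) * LF W z b)))"
  by (simp add: semi_symmetric_koszul_def koszul_FFF metric_BF metric_FB P
      algebra_simps power2_eq_square)

end

text \<open>Evaluates the form on a single vector instead of a field; it is applied to the vector
  dual to the restriction of db, which is given only pointwise.\<close>

lemma (in metric_manifold) semi_symmetric_koszul_covector:
  assumes P: "P \<in> VF" and X: "X \<in> VF" and Y: "Y \<in> VF" and v: "v \<in> T p"
  shows "covector_at A (semi_symmetric_koszul g P X Y) p v = covector_at A (koszul g X Y) p v
    + metric_fun g Y P p * flat A g p (X p) v - metric_fun g X Y p * flat A g p (P p) v"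
proof -
  obtain Z where Z: "Z \<in> VF" "Z p = v" by (rule field_through[OF v])
  show ?thesis
    using covector_at_eq[OF smooth_form_semi_symmetric_koszul[OF P X Y] Z(1), of p]
      covector_at_eq[OF smooth_form_koszul[OF X Y] Z(1), of p] v Z(2)
    by (simp add: semi_symmetric_koszul_def flat_apply metric_fun_def)
qed

context nondegenerate_manifold
begin

lemma inverse_metric_zero_left: "covector p \<beta> \<Longrightarrow> inverse_metric A g p (\<lambda>v. 0) \<beta> = 0"
  using inverse_metric_left[OF covector_zero_fun, of p \<beta>] by simp

end

section \<open>Forms whose part along F is a multiple of the flat of a field\<close>

context twisted_product
begin

lemma contraction_split_commute:
  assumes "split_form \<omega> \<alpha> \<alpha>'" "split_form \<tau> \<beta> \<beta>'"
  shows "contraction A G \<omega> \<tau> = contraction A G \<tau> \<omega>"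
  using B.inverse_metric_sym[OF split_form_covector(1)[OF assms(1)] split_form_covector(1)[OF assms(2)]]
    F.inverse_metric_sym[OF split_form_covector(2)[OF assms(1)] split_form_covector(2)[OF assms(2)]]
  by (simp add: contraction_split[OF assms] contraction_split[OF assms(2,1)])

text \<open>The fibre part common to K(X,V,.) and K(V,X,.) for X along B and V along F; the two
  differ only in the scalar \<open>s\<close>.\<close>

definition fibre_covector where
  "fibre_covector s V z = (\<lambda>v. s z * flat AF gF (snd z) (V (snd z)) v)"

lemma covector_fibre: "V \<in> F.VF \<Longrightarrow> F.covector (snd z) (fibre_covector s V z)"
  using F.covector_combine[OF F.covector_metric F.covector_metric, of "V (snd z)" "snd z" "V (snd z)" "s z" 0]
  by (simp add: F.vector_field_tangent fibre_covector_def)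

lemma fibre_covector_apply:
  "V \<in> F.VF \<Longrightarrow> W \<in> F.VF \<Longrightarrow> fibre_covector s V z (W (snd z)) = s z * metric_fun gF V W (snd z)"
  by (simp add: fibre_covector_def F.flat_apply F.vector_field_tangent metric_fun_def)

lemma split_form_fibre:
  assumes "smooth_form \<omega>" and V: "V \<in> F.VF" and s: "s \<in> C" "\<And>z. b z = 0 \<Longrightarrow> s z = 0"
    and "\<And>X z. X \<in> B.VF \<Longrightarrow> \<omega> (LB X) z = 0"
    and "\<And>W z. W \<in> F.VF \<Longrightarrow> \<omega> (LF W) z = b z * (s z * metric_fun gF V W (snd z))"
  shows "split_form \<omega> (\<lambda>z v. 0) (fibre_covector s V)"
  using assms
  by (simp del: split_paired_All add: split_form_def covector_fibre B.covector_zero_fun fibre_covector_apply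
      smooth_const smooth_mult smooth_metric_snd) (simp del: split_paired_All add: fibre_covector_def)

lemma inverse_metric_fibre:
  assumes V: "V \<in> F.VF" and \<beta>: "F.covector (snd z) \<beta>"
  shows "inverse_metric AF gF (snd z) (fibre_covector s V z) \<beta> = s z * \<beta> (V (snd z))"
  using F.inverse_metric_left[OF covector_fibre[OF V] \<beta>] F.flat_at_sharp[OF \<beta> F.vector_field_tangent[OF V]]
  by (simp add: fibre_covector_def)

text \<open>The inverse metric paired with the flat of V evaluates the other covector at V, and the
  base part of \<open>\<omega>\<close> is 0. Contractions with a mixed Koszul form thus reduce to
  values of known fibre parts.\<close>

lemma contraction_fibre:
  assumes V: "V \<in> F.VF" and \<omega>: "split_form \<omega> (\<lambda>z v. 0) (fibre_covector s V)" and \<tau>: "split_form \<tau> \<beta> \<beta>'"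
  shows "contraction A G \<omega> \<tau> z = s z * \<beta>' z (V (snd z))"
  using inverse_metric_fibre[OF V split_form_covector(2)[OF \<tau>, of z]]
    B.inverse_metric_zero_left[OF split_form_covector(1)[OF \<tau>, of z]]
  by (simp add: contraction_split[OF \<omega> \<tau>])

end

context twisted_product_field
begin

lemma smooth_form_K: "X \<in> VF \<Longrightarrow> Y \<in> VF \<Longrightarrow> smooth_form (K X Y)"
  by (rule smooth_form_semi_symmetric_koszul[OF lift_B_field[OF P]])

lemma smooth_form_KB: "X \<in> B.VF \<Longrightarrow> Y \<in> B.VF \<Longrightarrow> B.smooth_form (KB X Y)"
  by (rule B.smooth_form_semi_symmetric_koszul[OF P])

lemma split_form_BB:
  assumes X: "X \<in> B.VF" and Y: "Y \<in> B.VF"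
  shows "split_form (K (LB X) (LB Y)) (\<lambda>z. covector_at AB (KB X Y) (fst z)) (\<lambda>z v. 0)"
  using X Y smooth_fst[OF B.smooth_form_smooth[OF smooth_form_KB[OF X Y]]]
  by (simp del: split_paired_All add: split_form_def smooth_form_K lift_B_field
      B.covector_covector_at[OF smooth_form_KB[OF X Y]] F.covector_zero_fun
      B.covector_at_eq[OF smooth_form_KB[OF X Y]] K_BBB K_BBF smooth_const)

lemma split_form_BF:
  assumes X: "X \<in> B.VF" and V: "V \<in> F.VF"
  shows "split_form (K (LB X) (LF V)) (\<lambda>z v. 0) (fibre_covector (\<lambda>z. LB X z b) V)"
  using X V by (intro split_form_fibre smooth_form_K lift_B_field lift_F_field smooth_derivative_b)
    (simp_all add: K_BFB K_BFF lift_b_zero)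

lemma split_form_FB:
  assumes X: "X \<in> B.VF" and V: "V \<in> F.VF"
  shows "split_form (K (LF V) (LB X)) (\<lambda>z v. 0) (fibre_covector (\<lambda>z. LB X z b + b z * metric_fun gB X P (fst z)) V)"
  using X V by (intro split_form_fibre smooth_form_K lift_B_field lift_F_field smooth_derivative_b
      smooth_add smooth_mult b_smooth smooth_metric_fst P)
    (simp_all add: K_FBB K_FBF lift_b_zero)

text \<open>In \<open>K_FFB\<close> the derivative of b and the product with P are replaced by the
  covectors db and flat of P, so that the form can be contracted.\<close>

definition FF_base where
  "FF_base U V z = (\<lambda>v. - (b z * metric_fun gF U V (snd z)) * (db_B z v + b z * flat AB gB (fst z) (P (fst z)) v))"

text \<open>\<open>K_FFF\<close> with one factor b taken out and the last field replaced by
  covectors. Every summand carries b or a derivative of b, so all vanish where b does.\<close>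

definition FF_fibre where
  "FF_fibre U V z = (\<lambda>v. b z * covector_at AF (koszul gF U V) (snd z) v +
     (LF U z b * flat AF gF (snd z) (V (snd z)) v + LF V z b * flat AF gF (snd z) (U (snd z)) v
       - metric_fun gF U V (snd z) * db_F z v))"

lemma FF_base_apply: "X \<in> B.VF \<Longrightarrow>
    FF_base U V z (X (fst z)) = - (b z * metric_fun gF U V (snd z)) * (LB X z b + b z * metric_fun gB P X (fst z))"
  by (simp add: FF_base_def db_B_apply B.flat_apply B.vector_field_tangent metric_fun_def)

lemma FF_fibre_apply: "U \<in> F.VF \<Longrightarrow> V \<in> F.VF \<Longrightarrow> W \<in> F.VF \<Longrightarrow>
    FF_fibre U V z (W (snd z)) = b z * koszul gF U V W (snd z) +
    (LF U z b * metric_fun gF V W (snd z) + LF V z b * metric_fun gF U W (snd z) - metric_fun gF U V (snd z) * LF W z b)"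
  by (simp add: FF_fibre_def db_F_apply F.flat_apply F.vector_field_tangent metric_fun_def
      F.covector_at_eq[OF F.smooth_form_koszul])

lemma covector_FF_base: "B.covector (fst z) (FF_base U V z)"
  using B.covector_combine[OF covector_db_B B.covector_metric[OF B.vector_field_tangent[OF P]],
      of z "- (b z * metric_fun gF U V (snd z))" "- (b z * metric_fun gF U V (snd z)) * b z"]
  by (simp add: FF_base_def algebra_simps)

lemma covector_FF_fibre:
  assumes U: "U \<in> F.VF" and V: "V \<in> F.VF"
  shows "F.covector (snd z) (FF_fibre U V z)"
proof -
  note c = F.covector_covector_at[OF F.smooth_form_koszul[OF U V], of "snd z"]
    F.covector_metric[OF F.vector_field_tangent[OF V], of "snd z"]
    F.covector_metric[OF F.vector_field_tangent[OF U], of "snd z"]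
  note F.covector_combine[OF F.covector_combine[OF c(1,2), of "b z" "LF U z b"]
      F.covector_combine[OF c(3) covector_db_F, of "LF V z b" "- metric_fun gF U V (snd z)"], of 1 1]
  then show ?thesis by (simp add: FF_fibre_def algebra_simps)
qed

lemma smooth_koszul_snd: "U \<in> F.VF \<Longrightarrow> V \<in> F.VF \<Longrightarrow> W \<in> F.VF \<Longrightarrow> (\<lambda>z. koszul gF U V W (snd z)) \<in> C"
  by (rule smooth_snd[OF F.smooth_form_smooth[OF F.smooth_form_koszul]])

lemmas lift_smooth = smooth_add smooth_mult smooth_diff smooth_minus b_smooth smooth_derivative_b
  smooth_metric_fst smooth_metric_snd smooth_koszul_snd

lemma split_form_FF:
  assumes U: "U \<in> F.VF" and V: "V \<in> F.VF"
  shows "split_form (K (LF U) (LF V)) (FF_base U V) (FF_fibre U V)"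
  unfolding split_form_def
proof (intro conjI allI ballI impI)
  show "smooth_form (K (LF U) (LF V))" using U V by (intro smooth_form_K lift_F_field)
  fix z
  show "B.covector (fst z) (FF_base U V z)" by (rule covector_FF_base)
  show "F.covector (snd z) (FF_fibre U V z)" by (rule covector_FF_fibre[OF U V])
next
  fix X assume X: "X \<in> B.VF"
  show "(\<lambda>z. FF_base U V z (X (fst z))) \<in> C"
    unfolding FF_base_apply[OF X] by (intro lift_smooth U V X P)
  show "K (LF U) (LF V) (LB X) z = FF_base U V z (X (fst z))" for z
    using U V X by (simp add: FF_base_apply K_FFB)
next
  fix W assume W: "W \<in> F.VF"
  show "(\<lambda>z. FF_fibre U V z (W (snd z))) \<in> C"
    unfolding FF_fibre_apply[OF U V W] by (intro lift_smooth U V W)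
  show "K (LF U) (LF V) (LF W) z = b z * FF_fibre U V z (W (snd z))" for z
    using U V W by (simp add: FF_fibre_apply K_FFF)
next
  fix z assume "b z = 0"
  then show "FF_fibre U V z = (\<lambda>v. 0)" using U V by (simp add: FF_fibre_def lift_b_zero)
qed

subsection \<open>Contractions of the Koszul forms\<close>

lemma contraction_BB_BB:
  assumes "X \<in> B.VF" "Y \<in> B.VF" "Z \<in> B.VF" "T' \<in> B.VF"
  shows "contraction A G (K (LB X) (LB Y)) (K (LB Z) (LB T')) z = contraction AB gB (KB X Y) (KB Z T') (fst z)"
  using assms B.contraction_nondegenerate[OF smooth_form_KB smooth_form_KB, of X Y Z T']
    F.inverse_metric_zero_left[OF F.covector_zero_fun]
  by (simp add: contraction_split[OF split_form_BB split_form_BB])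

lemma contraction_BF_BB:
  "X \<in> B.VF \<Longrightarrow> V \<in> F.VF \<Longrightarrow> Y \<in> B.VF \<Longrightarrow> Z \<in> B.VF \<Longrightarrow>
    contraction A G (K (LB X) (LF V)) (K (LB Y) (LB Z)) z = 0"
  using contraction_fibre[OF _ split_form_BF split_form_BB] by simp

lemma contraction_FB_BB:
  "X \<in> B.VF \<Longrightarrow> V \<in> F.VF \<Longrightarrow> Y \<in> B.VF \<Longrightarrow> Z \<in> B.VF \<Longrightarrow>
    contraction A G (K (LF V) (LB X)) (K (LB Y) (LB Z)) z = 0"
  using contraction_fibre[OF _ split_form_FB split_form_BB] by simp

lemma contraction_BB_BF:
  "X \<in> B.VF \<Longrightarrow> V \<in> F.VF \<Longrightarrow> Y \<in> B.VF \<Longrightarrow> Z \<in> B.VF \<Longrightarrow>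
    contraction A G (K (LB Y) (LB Z)) (K (LB X) (LF V)) z = 0"
  using contraction_split_commute[OF split_form_BB split_form_BF] contraction_BF_BB by simp

lemma contraction_BB_FB:
  "X \<in> B.VF \<Longrightarrow> V \<in> F.VF \<Longrightarrow> Y \<in> B.VF \<Longrightarrow> Z \<in> B.VF \<Longrightarrow>
    contraction A G (K (LB Y) (LB Z)) (K (LF V) (LB X)) z = 0"
  using contraction_split_commute[OF split_form_BB split_form_FB] contraction_FB_BB by simp

lemma contraction_BF_BF:
  "X \<in> B.VF \<Longrightarrow> V \<in> F.VF \<Longrightarrow> Y \<in> B.VF \<Longrightarrow> W \<in> F.VF \<Longrightarrow>
    contraction A G (K (LB X) (LF V)) (K (LB Y) (LF W)) z = LB X z b * (LB Y z b * metric_fun gF W V (snd z))"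
  using contraction_fibre[OF _ split_form_BF split_form_BF] by (simp add: fibre_covector_apply)

lemma contraction_FB_FB:
  "X \<in> B.VF \<Longrightarrow> V \<in> F.VF \<Longrightarrow> Y \<in> B.VF \<Longrightarrow> W \<in> F.VF \<Longrightarrow>
    contraction A G (K (LF V) (LB X)) (K (LF W) (LB Y)) z = (LB X z b + b z * metric_fun gB X P (fst z)) *
      ((LB Y z b + b z * metric_fun gB Y P (fst z)) * metric_fun gF W V (snd z))"
  using contraction_fibre[OF _ split_form_FB split_form_FB] by (simp add: fibre_covector_apply)

lemma contraction_FB_BF:
  "X \<in> B.VF \<Longrightarrow> V \<in> F.VF \<Longrightarrow> Y \<in> B.VF \<Longrightarrow> W \<in> F.VF \<Longrightarrow>
    contraction A G (K (LF V) (LB X)) (K (LB Y) (LF W)) z = (LB X z b + b z * metric_fun gB X P (fst z)) *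
      (LB Y z b * metric_fun gF W V (snd z))"
  using contraction_fibre[OF _ split_form_FB split_form_BF] by (simp add: fibre_covector_apply)

lemma contraction_BF_FF:
  "X \<in> B.VF \<Longrightarrow> V \<in> F.VF \<Longrightarrow> U \<in> F.VF \<Longrightarrow> W \<in> F.VF \<Longrightarrow>
    contraction A G (K (LB X) (LF V)) (K (LF U) (LF W)) z = LB X z b * FF_fibre U W z (V (snd z))"
  using contraction_fibre[OF _ split_form_BF split_form_FF] by simp

lemma contraction_FF_BF:
  "X \<in> B.VF \<Longrightarrow> V \<in> F.VF \<Longrightarrow> U \<in> F.VF \<Longrightarrow> W \<in> F.VF \<Longrightarrow>
    contraction A G (K (LF U) (LF W)) (K (LB X) (LF V)) z = LB X z b * FF_fibre U W z (V (snd z))"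
  using contraction_split_commute[OF split_form_FF split_form_BF] contraction_BF_FF by simp

lemma contraction_FB_FF:
  "X \<in> B.VF \<Longrightarrow> V \<in> F.VF \<Longrightarrow> U \<in> F.VF \<Longrightarrow> W \<in> F.VF \<Longrightarrow>
    contraction A G (K (LF V) (LB X)) (K (LF U) (LF W)) z =
      (LB X z b + b z * metric_fun gB X P (fst z)) * FF_fibre U W z (V (snd z))"
  using contraction_fibre[OF _ split_form_FB split_form_FF] by simp

text \<open>The curvature formula pairs db with the ordinary Koszul form of B, so the semi-symmetric
  covector is split into that form and its two P-terms before it meets db. Against the flat of P it
  is simply evaluated, which leaves \<open>KB X Y P\<close>.\<close>

lemma contraction_BB_FF:
  assumes X: "X \<in> B.VF" and Y: "Y \<in> B.VF" and V: "V \<in> F.VF" and W: "W \<in> F.VF"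
  shows "contraction A G (K (LB X) (LB Y)) (K (LF V) (LF W)) z = - (b z * metric_fun gF V W (snd z)) *
    (inverse_metric AB gB (fst z) (covector_at AB (koszul gB X Y) (fst z)) (db_B z)
      + metric_fun gB Y P (fst z) * LB X z b - metric_fun gB X Y (fst z) * LB P z b + b z * KB X Y P (fst z))"
proof -
  let ?k = "covector_at AB (KB X Y) (fst z)"
  have k: "B.covector (fst z) ?k" by (rule B.covector_covector_at[OF smooth_form_KB[OF X Y]])
  have k': "B.covector (fst z) (covector_at AB (koszul gB X Y) (fst z))"
    by (rule B.covector_covector_at[OF B.smooth_form_koszul[OF X Y]])
  note fl = B.flat_at_sharp[OF covector_db_B B.vector_field_tangent]
  have "inverse_metric AB gB (fst z) ?k (FF_base V W z) = FF_base V W z (sharp AB gB (fst z) ?k)"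
    using B.inverse_metric_sym[OF k covector_FF_base] B.inverse_metric_left[OF covector_FF_base k] by simp
  also have "\<dots> = - (b z * metric_fun gF V W (snd z)) * (inverse_metric AB gB (fst z) ?k (db_B z) + b z * ?k (P (fst z)))"
    using B.inverse_metric_left[OF covector_db_B k] B.inverse_metric_sym[OF k covector_db_B]
      B.flat_at_sharp[OF k B.vector_field_tangent[OF P]] by (simp add: FF_base_def)
  also have "?k (P (fst z)) = KB X Y P (fst z)" by (rule B.covector_at_eq[OF smooth_form_KB[OF X Y] P])
  also have "inverse_metric AB gB (fst z) ?k (db_B z) =
      inverse_metric AB gB (fst z) (covector_at AB (koszul gB X Y) (fst z)) (db_B z)
      + metric_fun gB Y P (fst z) * LB X z b - metric_fun gB X Y (fst z) * LB P z b"
    unfolding B.inverse_metric_left[OF k covector_db_B] B.inverse_metric_left[OF k' covector_db_B]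
      B.semi_symmetric_koszul_covector[OF P X Y B.sharp_tangent[OF covector_db_B]]
    by (simp add: fl X P db_B_apply)
  finally have "inverse_metric AB gB (fst z) ?k (FF_base V W z) = - (b z * metric_fun gF V W (snd z)) *
    (inverse_metric AB gB (fst z) (covector_at AB (koszul gB X Y) (fst z)) (db_B z)
      + metric_fun gB Y P (fst z) * LB X z b - metric_fun gB X Y (fst z) * LB P z b + b z * KB X Y P (fst z))" .
  then show ?thesis
    using F.inverse_metric_zero_left[OF covector_FF_fibre[OF V W]]
    by (simp add: contraction_split[OF split_form_BB[OF X Y] split_form_FF[OF V W]])
qed

lemma inverse_metric_FF_fibre:
  assumes U: "U \<in> F.VF" and V: "V \<in> F.VF" and \<beta>: "F.covector (snd z) \<beta>"
  shows "inverse_metric AF gF (snd z) (FF_fibre U V z) \<beta> =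
    b z * inverse_metric AF gF (snd z) (covector_at AF (koszul gF U V) (snd z)) \<beta> +
    (LF U z b * \<beta> (V (snd z)) + LF V z b * \<beta> (U (snd z)) - metric_fun gF U V (snd z) * inverse_metric AF gF (snd z) (db_F z) \<beta>)"
  unfolding F.inverse_metric_left[OF covector_FF_fibre[OF U V] \<beta>] F.inverse_metric_left[OF covector_db_F \<beta>]
    F.inverse_metric_left[OF F.covector_covector_at[OF F.smooth_form_koszul[OF U V]] \<beta>]
  by (simp add: FF_fibre_def F.flat_at_sharp[OF \<beta> F.vector_field_tangent] U V)

text \<open>Both base parts are multiples of db + b times the flat of P, whose square under the
  inverse metric of B gives the factor with 2 b P(b) and b^2 g_B(P,P). Along F, each flat evaluates
  the other covector; the resulting values of \<open>FF_fibre\<close> are left to be expanded by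
  \<open>FF_fibre_apply\<close>.\<close>

lemma contraction_FF_FF:
  assumes U: "U \<in> F.VF" and V: "V \<in> F.VF" and W: "W \<in> F.VF" and Q: "Q \<in> F.VF"
  defines "g \<equiv> \<lambda>V W z. metric_fun gF V W (snd z)"
    and "k \<equiv> \<lambda>U V z. inverse_metric AF gF (snd z) (covector_at AF (koszul gF U V) (snd z)) (db_F z)"
  shows "contraction A G (K (LF U) (LF V)) (K (LF W) (LF Q)) z =
    b z * g U V z * (b z * g W Q z) * (inverse_metric AB gB (fst z) (db_B z) (db_B z)
      + 2 * b z * LB P z b + (b z)\<^sup>2 * metric_fun gB P P (fst z)) +
    (b z * (b z * contraction AF gF (koszul gF U V) (koszul gF W Q) (snd z) +
        (LF W z b * koszul gF U V Q (snd z) + LF Q z b * koszul gF U V W (snd z) - g W Q z * k U V z)) +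
      (LF U z b * FF_fibre W Q z (V (snd z)) + LF V z b * FF_fibre W Q z (U (snd z)) -
        g U V z * (b z * k W Q z + (LF W z b * LF Q z b + LF Q z b * LF W z b
          - g W Q z * inverse_metric AF gF (snd z) (db_F z) (db_F z)))))"
proof -
  have cov: "F.covector (snd z) (covector_at AF (koszul gF U V) (snd z))"
    "F.covector (snd z) (covector_at AF (koszul gF W Q) (snd z))"
    by (rule F.covector_covector_at[OF F.smooth_form_koszul[OF U V]], rule F.covector_covector_at[OF F.smooth_form_koszul[OF W Q]])
  have con: "contraction AF gF (koszul gF U V) (koszul gF W Q) (snd z) =
      inverse_metric AF gF (snd z) (covector_at AF (koszul gF U V) (snd z)) (covector_at AF (koszul gF W Q) (snd z))"
    by (simp add: F.contraction_nondegenerate[OF F.smooth_form_koszul[OF U V] F.smooth_form_koszul[OF W Q]])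
  note cWQ = covector_FF_fibre[OF W Q, of z]
  have 1: "inverse_metric AF gF (snd z) (covector_at AF (koszul gF U V) (snd z)) (FF_fibre W Q z) =
     b z * contraction AF gF (koszul gF U V) (koszul gF W Q) (snd z) +
        (LF W z b * koszul gF U V Q (snd z) + LF Q z b * koszul gF U V W (snd z) - g W Q z * k U V z)"
    unfolding F.inverse_metric_sym[OF cov(1) cWQ] inverse_metric_FF_fibre[OF W Q cov(1)] con
      F.inverse_metric_sym[OF cov(2,1)] F.inverse_metric_sym[OF covector_db_F cov(1)]
    by (simp add: g_def k_def F.covector_at_eq[OF F.smooth_form_koszul] U V W Q)
  have 2: "inverse_metric AF gF (snd z) (db_F z) (FF_fibre W Q z) =
     b z * k W Q z + (LF W z b * LF Q z b + LF Q z b * LF W z b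
          - g W Q z * inverse_metric AF gF (snd z) (db_F z) (db_F z))"
    unfolding F.inverse_metric_sym[OF covector_db_F cWQ] inverse_metric_FF_fibre[OF W Q covector_db_F]
    by (simp add: g_def k_def db_F_apply W Q)
  have "inverse_metric AB gB (fst z) (FF_base U V z) (FF_base W Q z) =
      - (b z * g U V z) * (inverse_metric AB gB (fst z) (db_B z) (FF_base W Q z) + b z * FF_base W Q z (P (fst z)))"
    using B.inverse_metric_left[OF covector_FF_base covector_FF_base, of z U V W Q]
      B.inverse_metric_left[OF covector_db_B covector_FF_base, of z W Q]
      B.flat_at_sharp[OF covector_FF_base B.vector_field_tangent[OF P], of z W Q]
    by (simp add: FF_base_def[of U V] g_def)
  also have "inverse_metric AB gB (fst z) (db_B z) (FF_base W Q z) =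
      - (b z * g W Q z) * (inverse_metric AB gB (fst z) (db_B z) (db_B z) + b z * LB P z b)"
    using B.inverse_metric_sym[OF covector_db_B covector_FF_base, of z W Q]
      B.inverse_metric_left[OF covector_FF_base covector_db_B, of z W Q]
      B.inverse_metric_left[OF covector_db_B covector_db_B, of z]
      B.flat_at_sharp[OF covector_db_B B.vector_field_tangent[OF P], of z]
    by (simp add: FF_base_def g_def db_B_apply P)
  also have "FF_base W Q z (P (fst z)) = - (b z * g W Q z) * (LB P z b + b z * metric_fun gB P P (fst z))"
    by (simp add: FF_base_apply[OF P] g_def)
  finally have 3: "inverse_metric AB gB (fst z) (FF_base U V z) (FF_base W Q z) =
      b z * g U V z * (b z * g W Q z) * (inverse_metric AB gB (fst z) (db_B z) (db_B z)
      + 2 * b z * LB P z b + (b z)\<^sup>2 * metric_fun gB P P (fst z))"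
    by (simp add: algebra_simps power2_eq_square)
  show ?thesis
    unfolding contraction_split[OF split_form_FF[OF U V] split_form_FF[OF W Q]] 3
      inverse_metric_FF_fibre[OF U V cWQ] 1 2 by (simp add: g_def)
qed

end

text \<open>Disposes of the bracket term in the curvature when one field comes from B and the other
  from F, since such lifts commute.\<close>

lemma (in metric_manifold) semi_symmetric_koszul_zero_left:
  assumes P: "P \<in> VF" and Y: "Y \<in> VF" and Z: "Z \<in> VF"
  shows "semi_symmetric_koszul g P (\<lambda>p f. 0) Y Z p = 0"
proof -
  note c = tangent_const_fun[OF vector_field_tangent[OF Y]] tangent_const_fun[OF vector_field_tangent[OF Z]]
  have "lie_bracket (\<lambda>p f. 0) Y = (\<lambda>p f. 0)" "lie_bracket Z (\<lambda>p f. 0) = (\<lambda>p f. 0)"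
    using c by (auto simp: lie_bracket_def lie_derivative_def)
  moreover have "metric_fun g (\<lambda>p f. 0) X = (\<lambda>z. 0)" "metric_fun g X (\<lambda>p f. 0) = (\<lambda>z. 0)" if "X \<in> VF" for X
    using metric_fun_zero[OF that] by auto
  ultimately show ?thesis
    using c Y Z P lie_bracket_field[OF Y Z] by (simp add: semi_symmetric_koszul_def koszul_def)
qed

context twisted_product_field
begin

abbreviation R where "R \<equiv> semi_symmetric_curvature A G (LB P)"

lemma R_expand: "R X Y Z W z = X z (K Y Z W) - Y z (K X Z W) - K (lie_bracket X Y) Z W z
    + contraction A G (K X Z) (K Y W) z - contraction A G (K Y Z) (K X W) z"
  by (simp add: semi_symmetric_curvature_def curvature_of_def)

lemma derivative_koszul_B: "X \<in> B.VF \<Longrightarrow> U \<in> F.VF \<Longrightarrow> V \<in> F.VF \<Longrightarrow> W \<in> F.VF \<Longrightarrow>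
    LB X z (\<lambda>z. koszul gF U V W (snd z)) = 0"
  by (rule lift_B_snd[OF _ F.smooth_form_smooth[OF F.smooth_form_koszul]])

lemma derivative_koszul_F: "X \<in> F.VF \<Longrightarrow> U \<in> F.VF \<Longrightarrow> V \<in> F.VF \<Longrightarrow> W \<in> F.VF \<Longrightarrow>
    LF X z (\<lambda>z. koszul gF U V W (snd z)) = X (snd z) (koszul gF U V W)"
  by (rule lift_F_snd[OF _ F.smooth_form_smooth[OF F.smooth_form_koszul]])

lemmas lift_derivatives = derivative_metric_fst_B derivative_metric_fst_F derivative_metric_snd_B
  derivative_metric_snd_F derivative_koszul_B derivative_koszul_F

lemma mixed_derivative: "X \<in> B.VF \<Longrightarrow> V \<in> F.VF \<Longrightarrow> LF V z (\<lambda>z. LB X z b) = LB X z (\<lambda>z. LF V z b)"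
  using fun_cong[OF fun_cong[OF lie_bracket_lift_mixed], of X V z b] by (simp add: lie_bracket_def lie_derivative_def)

lemma bracket_derivative_B: "X \<in> B.VF \<Longrightarrow> Y \<in> B.VF \<Longrightarrow>
    LB (lie_bracket X Y) z b = LB X z (\<lambda>z. LB Y z b) - LB Y z (\<lambda>z. LB X z b)"
  using fun_cong[OF fun_cong[OF lie_bracket_lift_B], of X Y z b] by (simp add: lie_bracket_def[of "LB X"] lie_derivative_def)

lemma bracket_derivative_F: "X \<in> F.VF \<Longrightarrow> Y \<in> F.VF \<Longrightarrow>
    LF (lie_bracket X Y) z b = LF X z (\<lambda>z. LF Y z b) - LF Y z (\<lambda>z. LF X z b)"
  using fun_cong[OF fun_cong[OF lie_bracket_lift_F], of X Y z b] by (simp add: lie_bracket_def[of "LF X"] lie_derivative_def)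

lemmas K_zero_left = semi_symmetric_koszul_zero_left[OF lift_B_field[OF P]]

subsection \<open>The curvature of lifted vector fields\<close>

lemma R_BBBB:
  assumes X: "X \<in> B.VF" and Y: "Y \<in> B.VF" and Z: "Z \<in> B.VF" and W: "W \<in> B.VF"
  shows "R (LB X) (LB Y) (LB Z) (LB W) z = semi_symmetric_curvature AB gB P X Y Z W (fst z)"
  using lift_B_fst[OF X B.smooth_form_smooth[OF smooth_form_KB[OF Y Z] W], of z]
    lift_B_fst[OF Y B.smooth_form_smooth[OF smooth_form_KB[OF X Z] W], of z]
  by (simp add: R_expand semi_symmetric_curvature_def curvature_of_def lie_bracket_lift_B K_BBB contraction_BB_BB
      B.lie_bracket_field X Y Z W)

lemma R_BBBF:
  assumes X: "X \<in> B.VF" and Y: "Y \<in> B.VF" and Z: "Z \<in> B.VF" and W: "W \<in> F.VF"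
  shows "R (LB X) (LB Y) (LB Z) (LF W) z = 0"
  by (simp add: R_expand lie_bracket_lift_B K_BBF contraction_BB_BF B.lie_bracket_field derivative_zero_B X Y Z W)

lemma R_BFBB:
  assumes X: "X \<in> B.VF" and Y: "Y \<in> B.VF" and Z: "Z \<in> B.VF" and W: "W \<in> F.VF"
  shows "R (LB Z) (LF W) (LB X) (LB Y) z = 0"
  using lift_F_fst[OF W B.smooth_form_smooth[OF smooth_form_KB[OF Z X] Y], of z]
  by (simp add: R_expand lie_bracket_lift_mixed K_zero_left K_BBB K_FBB contraction_BB_FB contraction_FB_BB
      lift_B_field derivative_zero_B X Y Z W)

text \<open>After antisymmetrisation in X and Y the products X(b) Y(b) drop out, the second
  derivatives combine to [X,Y](b), which the bracket term removes, and the two contractions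
  coincide.\<close>

lemma R_BBFF:
  assumes X: "X \<in> B.VF" and Y: "Y \<in> B.VF" and V: "V \<in> F.VF" and W: "W \<in> F.VF"
  shows "R (LB X) (LB Y) (LF V) (LF W) z = 0"
proof -
  have D: "LB X z (K (LB Y) (LF V) (LF W)) =
      (LB X z b * LB Y z b + b z * LB X z (\<lambda>z. LB Y z b)) * metric_fun gF V W (snd z)"
    if X: "X \<in> B.VF" and Y: "Y \<in> B.VF" for X Y
    by (simp add: K_BFF X Y V W tangent_mult_fun[OF vector_field_tangent[OF lift_B_field[OF X]]] lift_smooth
        lift_derivatives algebra_simps)
  show ?thesis
    unfolding R_expand D[OF X Y] D[OF Y X] lie_bracket_lift_B[OF X Y]
    by (simp add: K_BFF contraction_BF_BF bracket_derivative_B B.lie_bracket_field X Y V W algebra_simps)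
qed

text \<open>The Koszul terms are 0, and the two contractions are the same product because g_F is
  symmetric.\<close>

lemma R_FFBB:
  assumes X: "X \<in> B.VF" and Y: "Y \<in> B.VF" and V: "V \<in> F.VF" and W: "W \<in> F.VF"
  shows "R (LF V) (LF W) (LB X) (LB Y) z = 0"
  by (simp add: R_expand lie_bracket_lift_F K_FBB contraction_FB_FB F.lie_bracket_field derivative_zero_F
      F.metric_fun_sym[of V W] X Y V W)

text \<open>Differentiating K(V,Y,W) along X produces X(g_B(Y,P)), which metric compatibility splits
  into K_B(X,Y,P) + K_B(X,P,Y). The first summand is cancelled by the contraction of the forms of X,
  Y and V, W; the second is the Koszul term that survives.\<close>

lemma R_BFBF:
  assumes X: "X \<in> B.VF" and Y: "Y \<in> B.VF" and V: "V \<in> F.VF" and W: "W \<in> F.VF"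
  shows "R (LB X) (LF V) (LB Y) (LF W) z =
      b z * LB X z (\<lambda>z. LB Y z b) * metric_fun gF V W (snd z)
      - b z * inverse_metric AB gB (fst z) (covector_at AB (koszul gB X Y) (fst z)) (db_B z) * metric_fun gF V W (snd z)
      + (b z)\<^sup>2 * koszul gB X P Y (fst z) * metric_fun gF V W (snd z)
      + (b z)\<^sup>2 * metric_fun gB P P (fst z) * metric_fun gB X Y (fst z) * metric_fun gF V W (snd z)
      - (b z)\<^sup>2 * metric_fun gB X P (fst z) * metric_fun gB P Y (fst z) * metric_fun gF V W (snd z)
      + b z * LB P z b * metric_fun gB X Y (fst z) * metric_fun gF V W (snd z)"
proof -
  have D: "LB X z (K (LF V) (LB Y) (LF W)) =
      (LB X z b * (LB Y z b + b z * metric_fun gB Y P (fst z)) +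
       b z * (LB X z (\<lambda>z. LB Y z b) + LB X z b * metric_fun gB Y P (fst z) + b z * X (fst z) (metric_fun gB Y P)))
      * metric_fun gF V W (snd z)"
    by (simp add: K_FBF X Y V W P tangent_mult_fun[OF vector_field_tangent[OF lift_B_field[OF X]]]
        tangent_add_fun[OF vector_field_tangent[OF lift_B_field[OF X]]] lift_smooth
        lift_derivatives algebra_simps)
  have k: "X (fst z) (metric_fun gB Y P) = koszul gB X Y P (fst z) + koszul gB X P Y (fst z)"
    by (rule B.koszul_metric[OF X Y P, symmetric])
  show ?thesis
    unfolding R_expand D k lie_bracket_lift_mixed[OF X V]
    by (simp add: K_BBF K_zero_left contraction_BB_FF contraction_FB_BF semi_symmetric_koszul_def[of gB]
        derivative_zero_F lift_B_field lift_F_field F.metric_fun_sym[of V W] B.metric_fun_sym[of P Y] B.metric_fun_sym[of P X]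
        X Y V W P) (simp add: algebra_simps power2_eq_square)
qed

text \<open>P does not occur: the forms of X with U and with W involve only X(b) and have no part
  along B, and the part along F of the forms on two fibre fields is free of P. The Koszul values of
  F cancel after metric compatibility is used for V(g_F(U,W)).\<close>

lemma R_BFFF:
  assumes X: "X \<in> B.VF" and U: "U \<in> F.VF" and V: "V \<in> F.VF" and W: "W \<in> F.VF"
  shows "R (LB X) (LF V) (LF U) (LF W) z =
      b z * LB X z (\<lambda>z. LF U z b) * metric_fun gF W V (snd z) - LB X z b * LF U z b * metric_fun gF W V (snd z)
      - b z * LB X z (\<lambda>z. LF W z b) * metric_fun gF U V (snd z) + LB X z b * LF W z b * metric_fun gF U V (snd z)"
proof -
  have D1: "LB X z (K (LF V) (LF U) (LF W)) =
      2 * b z * LB X z b * koszul gF V U W (snd z) +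
      LB X z b * (LF V z b * metric_fun gF U W (snd z) + LF U z b * metric_fun gF V W (snd z) - metric_fun gF V U (snd z) * LF W z b) +
      b z * (LB X z (\<lambda>z. LF V z b) * metric_fun gF U W (snd z) + LB X z (\<lambda>z. LF U z b) * metric_fun gF V W (snd z)
        - metric_fun gF V U (snd z) * LB X z (\<lambda>z. LF W z b))"
    by (simp add: K_FFF X U V W tangent_mult_fun[OF vector_field_tangent[OF lift_B_field[OF X]]]
        tangent_add_fun[OF vector_field_tangent[OF lift_B_field[OF X]]]
        tangent_diff_fun[OF vector_field_tangent[OF lift_B_field[OF X]]] lift_smooth
        lift_derivatives algebra_simps)
  have D2: "LF V z (K (LB X) (LF U) (LF W)) =
      (LF V z b * LB X z b + b z * LB X z (\<lambda>z. LF V z b)) * metric_fun gF U W (snd z)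
      + b z * LB X z b * V (snd z) (metric_fun gF U W)"
    by (simp add: K_BFF X U V W tangent_mult_fun[OF vector_field_tangent[OF lift_F_field[OF V]]] lift_smooth
        lift_derivatives mixed_derivative algebra_simps)
  have k: "V (snd z) (metric_fun gF U W) = koszul gF V U W (snd z) + koszul gF V W U (snd z)"
    by (rule F.koszul_metric[OF V U W, symmetric])
  show ?thesis
    unfolding R_expand D1 D2 k lie_bracket_lift_mixed[OF X V]
    by (simp add: K_zero_left contraction_BF_FF contraction_FF_BF FF_fibre_apply lift_F_field
        F.metric_fun_sym[of W V] F.metric_fun_sym[of W U] F.metric_fun_sym[of V U] X U V W)
      (simp add: algebra_simps)
qed

text \<open>Computed on its own, because this curvature is in general not symmetric under exchange
  of pairs: R(X,V,Y,W) contains K_B(X,P,Y), which need not be symmetric in X and Y. Here the terms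
  with g_B(X,P) coming from the derivatives cancel those from the bracket and the
  contractions.\<close>

lemma R_FFBF:
  assumes X: "X \<in> B.VF" and U: "U \<in> F.VF" and V: "V \<in> F.VF" and W: "W \<in> F.VF"
  shows "R (LF U) (LF W) (LB X) (LF V) z =
      b z * LB X z (\<lambda>z. LF U z b) * metric_fun gF W V (snd z) - LB X z b * LF U z b * metric_fun gF W V (snd z)
      - b z * LB X z (\<lambda>z. LF W z b) * metric_fun gF U V (snd z) + LB X z b * LF W z b * metric_fun gF U V (snd z)"
proof -
  have D: "LF U z (K (LF W) (LB X) (LF V)) =
      (LF U z b * (LB X z b + b z * metric_fun gB X P (fst z)) +
        b z * (LB X z (\<lambda>z. LF U z b) + LF U z b * metric_fun gB X P (fst z))) * metric_fun gF W V (snd z)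
      + b z * (LB X z b + b z * metric_fun gB X P (fst z)) * U (snd z) (metric_fun gF W V)"
    if U: "U \<in> F.VF" and W: "W \<in> F.VF" for U W
    by (simp add: K_FBF X U V W P tangent_mult_fun[OF vector_field_tangent[OF lift_F_field[OF U]]]
        tangent_add_fun[OF vector_field_tangent[OF lift_F_field[OF U]]] lift_smooth
        lift_derivatives mixed_derivative algebra_simps)
  have k: "U (snd z) (metric_fun gF W V) = koszul gF U W V (snd z) + koszul gF U V W (snd z)"
      "W (snd z) (metric_fun gF U V) = koszul gF W U V (snd z) + koszul gF W V U (snd z)"
    by (rule F.koszul_metric[OF U W V, symmetric], rule F.koszul_metric[OF W U V, symmetric])
  have t: "metric_fun gF (lie_bracket U W) V (snd z) = koszul gF U W V (snd z) - koszul gF W U V (snd z)"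
    using F.koszul_torsion_free[OF U W V, of "snd z"] F.metric_fun_sym[OF F.lie_bracket_field[OF U W] V] by simp
  show ?thesis
    unfolding R_expand D[OF U W] D[OF W U] k lie_bracket_lift_F[OF U W]
    by (simp add: K_FBF t contraction_FB_FF FF_fibre_apply F.lie_bracket_field
        F.metric_fun_sym[of W V] F.metric_fun_sym[of W U] F.metric_fun_sym[of V U] X U V W P)
      (simp add: algebra_simps)
qed

text \<open>P enters only through the base parts in the two contractions, whose prefactor b^2 turns
  2 b P(b) + b^2 g_B(P,P) into the cubic and quartic terms. Terms with a derivative of b times a
  single Koszul value of F come from the derivatives, the bracket and the contractions, and cancel
  once \<open>k\<close> and \<open>t\<close> are applied; only the pairings with db remain.\<close>

lemma R_FFFF:
  assumes U: "U \<in> F.VF" and V: "V \<in> F.VF" and W: "W \<in> F.VF" and Q: "Q \<in> F.VF"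
  defines "g \<equiv> \<lambda>V W z. metric_fun gF V W (snd z)"
    and "h \<equiv> \<lambda>U V z. b z * LF U z (\<lambda>z. LF V z b) - 2 * LF U z b * LF V z b
      - b z * inverse_metric AF gF (snd z) (covector_at AF (koszul gF U V) (snd z)) (db_F z)"
  shows "R (LF U) (LF V) (LF W) (LF Q) z = (b z)\<^sup>2 * curvature AF gF U V W Q (snd z)
      + ((b z)\<^sup>2 * inverse_metric AB gB (fst z) (db_B z) (db_B z) + inverse_metric AF gF (snd z) (db_F z) (db_F z)
         + 2 * (b z)^3 * LB P z b + (b z)^4 * metric_fun gB P P (fst z))
        * (g U W z * g V Q z - g V W z * g U Q z)
      + h U W z * g V Q z + h V Q z * g U W z - h V W z * g U Q z - h U Q z * g V W z"
proof -
  have D: "LF U z (K (LF V) (LF W) (LF Q)) =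
      2 * b z * LF U z b * koszul gF V W Q (snd z) + (b z)\<^sup>2 * U (snd z) (koszul gF V W Q) +
      LF U z b * (LF V z b * g W Q z + LF W z b * g V Q z - g V W z * LF Q z b) +
      b z * (LF U z (\<lambda>z. LF V z b) * g W Q z + LF U z (\<lambda>z. LF W z b) * g V Q z - g V W z * LF U z (\<lambda>z. LF Q z b)) +
      b z * (LF V z b * U (snd z) (metric_fun gF W Q) + LF W z b * U (snd z) (metric_fun gF V Q)
        - LF Q z b * U (snd z) (metric_fun gF V W))"
    if U: "U \<in> F.VF" and V: "V \<in> F.VF" for U V
    by (simp add: K_FFF U V W Q g_def tangent_mult_fun[OF vector_field_tangent[OF lift_F_field[OF U]]]
        tangent_add_fun[OF vector_field_tangent[OF lift_F_field[OF U]]]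
        tangent_diff_fun[OF vector_field_tangent[OF lift_F_field[OF U]]] lift_smooth
        lift_derivatives algebra_simps power2_eq_square)
  have k: "X (snd z) (metric_fun gF Y Z) = koszul gF X Y Z (snd z) + koszul gF X Z Y (snd z)"
    if "X \<in> F.VF" "Y \<in> F.VF" "Z \<in> F.VF" for X Y Z
    by (rule F.koszul_metric[OF that, symmetric])
  have t: "metric_fun gF (lie_bracket U V) Z (snd z) = koszul gF U V Z (snd z) - koszul gF V U Z (snd z)"
    if "Z \<in> F.VF" for Z
    using F.koszul_torsion_free[OF U V that, of "snd z"] F.metric_fun_sym[OF F.lie_bracket_field[OF U V] that] by simp
  \<comment> \<open>Orients each product in one way, so that the final simplification recognises
    equal monomials.\<close>
  have s: "metric_fun gF V U = metric_fun gF U V" "metric_fun gF W U = metric_fun gF U W" "metric_fun gF Q U = metric_fun gF U Q"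
    "metric_fun gF W V = metric_fun gF V W" "metric_fun gF Q V = metric_fun gF V Q" "metric_fun gF Q W = metric_fun gF W Q"
    by (rule F.metric_fun_sym; fact)+
  have br: "K (LF (lie_bracket U V)) (LF W) (LF Q) z = b z * (b z * koszul gF (lie_bracket U V) W Q (snd z) +
      ((LF U z (\<lambda>z. LF V z b) - LF V z (\<lambda>z. LF U z b)) * g W Q z
        + LF W z b * (koszul gF U V Q (snd z) - koszul gF V U Q (snd z))
        - (koszul gF U V W (snd z) - koszul gF V U W (snd z)) * LF Q z b))"
    by (simp add: K_FFF U V W Q F.lie_bracket_field bracket_derivative_F t g_def)
  have c: "curvature AF gF U V W Q (snd z) = U (snd z) (koszul gF V W Q) - V (snd z) (koszul gF U W Q)
      - koszul gF (lie_bracket U V) W Q (snd z) + contraction AF gF (koszul gF U W) (koszul gF V Q) (snd z)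
      - contraction AF gF (koszul gF V W) (koszul gF U Q) (snd z)"
    by (simp add: curvature_def curvature_of_def)
  show ?thesis
    unfolding R_expand D[OF U V] D[OF V U] lie_bracket_lift_F[OF U V] br c
      contraction_FF_FF[OF U W V Q] contraction_FF_FF[OF V W U Q]
      FF_fibre_apply[OF V Q W] FF_fibre_apply[OF V Q U] FF_fibre_apply[OF U Q W] FF_fibre_apply[OF U Q V]
      k[OF U W Q] k[OF U V Q] k[OF U V W] k[OF V W Q] k[OF V U Q] k[OF V U W]
      g_def h_def s
    by (simp add: algebra_simps power2_eq_square power3_eq_cube power4_eq_xxxx)
qed

end

theorem theorem5p9:
  fixes AB :: "('b::{t2_space,second_countable_topology}, 'eb::real_inner) chart set"
    and AF :: "('f::{t2_space,second_countable_topology}, 'ef::real_inner) chart set"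
    and gB :: "'b metric" and gF :: "'f metric"
    and b :: "'b \<times> 'f \<Rightarrow> real" and P :: "'b vfield"
  assumes B: "nondegenerate_semi_riemannian_manifold AB gB"
    and F: "nondegenerate_semi_riemannian_manifold AF gF"
    and b: "b \<in> smooth_functions (product_atlas AB AF)"
    and db: "\<And>z. b z = 0 \<Longrightarrow> differential (product_atlas AB AF) b z = (\<lambda>v. 0)"
    and P: "P \<in> vector_fields AB"
  shows
    "let A = product_atlas AB AF;
         LB = lift_B AB AF;
         LF = lift_F AB AF;
         R = semi_symmetric_curvature A (twisted_metric gB gF b) (LB P);
         D = (\<lambda>X. lie_derivative X b);
         DD = (\<lambda>X Y. lie_derivative X (lie_derivative Y b));
         GB = (\<lambda>X Y z. metric_fun gB X Y (fst z));
         GF = (\<lambda>U V z. metric_fun gF U V (snd z));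
         dbB = (\<lambda>z. restrict_B AB AF z (differential A b z));
         dbF = (\<lambda>z. restrict_F AB AF z (differential A b z));
         GBstar = (\<lambda>\<alpha> \<beta> z. inverse_metric AB gB (fst z) (\<alpha> z) (\<beta> z));
         GFstar = (\<lambda>\<alpha> \<beta> z. inverse_metric AF gF (snd z) (\<alpha> z) (\<beta> z));
         NB = (\<lambda>X Y z. covector_at AB (koszul gB X Y) (fst z));
         NF = (\<lambda>U V z. covector_at AF (koszul gF U V) (snd z));
         H = (\<lambda>U V z. b z * DD (LF U) (LF V) z - 2 * D (LF U) z * D (LF V) z
                - b z * GFstar (NF U V) dbF z)
     in \<forall>X\<in>vector_fields AB. \<forall>Y\<in>vector_fields AB. \<forall>Z\<in>vector_fields AB. \<forall>T\<in>vector_fields AB.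
        \<forall>U\<in>vector_fields AF. \<forall>V\<in>vector_fields AF. \<forall>W\<in>vector_fields AF. \<forall>Q\<in>vector_fields AF.
        \<forall>z.
        R (LB X) (LB Y) (LB Z) (LB T) z = semi_symmetric_curvature AB gB P X Y Z T (fst z)
      \<and> (R (LB X) (LB Y) (LB Z) (LF W) z = 0 \<and> R (LB Z) (LF W) (LB X) (LB Y) z = 0)
      \<and> (R (LB X) (LB Y) (LF V) (LF W) z = 0 \<and> R (LF V) (LF W) (LB X) (LB Y) z = 0)
      \<and> R (LB X) (LF V) (LB Y) (LF W) z =
            b z * DD (LB X) (LB Y) z * GF V W z
          - b z * GBstar (NB X Y) dbB z * GF V W z
          + (b z)^2 * koszul gB X P Y (fst z) * GF V W z
          + (b z)^2 * GB P P z * GB X Y z * GF V W z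
          - (b z)^2 * GB X P z * GB P Y z * GF V W z
          + b z * D (LB P) z * GB X Y z * GF V W z
      \<and> (R (LB X) (LF V) (LF U) (LF W) z = R (LF U) (LF W) (LB X) (LF V) z
         \<and> R (LF U) (LF W) (LB X) (LF V) z =
            b z * DD (LB X) (LF U) z * GF W V z
          - D (LB X) z * D (LF U) z * GF W V z
          - b z * DD (LB X) (LF W) z * GF U V z
          + D (LB X) z * D (LF W) z * GF U V z)
      \<and> R (LF U) (LF V) (LF W) (LF Q) z =
            (b z)^2 * curvature AF gF U V W Q (snd z)
          + ((b z)^2 * GBstar dbB dbB z + GFstar dbF dbF z
             + 2 * (b z)^3 * D (LB P) z + (b z)^4 * GB P P z)
            * (GF U W z * GF V Q z - GF V W z * GF U Q z)
          + H U W z * GF V Q z + H V Q z * GF U W z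
          - H V W z * GF U Q z - H U Q z * GF V W z"
proof -
  interpret B: manifold AB
    using B by (intro manifold.intro) (simp add: nondegenerate_semi_riemannian_manifold_def)
  interpret F: manifold AF
    using F by (intro manifold.intro) (simp add: nondegenerate_semi_riemannian_manifold_def)
  interpret twisted_product_field AB gB AF gF b P
    by unfold_locales
      (use B F b db P in \<open>simp_all add: nondegenerate_semi_riemannian_manifold_def\<close>)
  show ?thesis
    unfolding Let_def lie_derivative_def db_B_def[symmetric] db_F_def[symmetric]
    by (intro ballI allI conjI)
      (simp_all only: R_BBBB R_BBBF R_BFBB R_BBFF R_FFBB R_BFBF R_BFFF R_FFBF R_FFFF)
qed

end
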